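(* The only Ramanujan congruence for $\overline{t}(n)$ is $$\overline{t}(3n+2) \equiv 0 \pmod{3}.$$ That is, for a prime $\ell$ and an integer $a$ with $0\le a\le \ell-1$, one has $\overline{t}(\ell n + a)\equiv 0 \pmod{\ell}$ for all integers $n\ge 0$ if and only if $(\ell,a)=(3,2)$.
   Context: An overpartition of $n$ is a partition of $n$ (a non-increasing sequence of positive integers with sum $n$) in which the final occurrence of each number may be overlined or not. The function $\overline{t}(n)$ counts the overpartitions of $n$ satisfying: (i) the difference between two successive parts may be odd only if the larger part is overlined; (ii) if the smallest part is odd, then it is overlined. For example, $\overline{t}(4)=8$. Here $\overline{t}(0)=1$. It is known that its generating function is $$\sum_{n\ge 0}\overline{t}(n)q^n = \prod_{n\ge 1}\frac{1-q^{3n}}{(1-q^{2n})(1-q^{n})},$$ which may be taken as the definition of $\overline{t}(n)$. A Ramanujan congruence for $\overline{t}(n)$ is a congruence of the form $\overline{t}(\ell n+a)\equiv 0\pmod{\ell}$ (for all $n \geq 0$), where $\ell$ is a prime and $a$ represents a residue class modulo $\ell$, $0\le a\le \ell-1$. *)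

theory Defs
  imports
    "HOL-Analysis.Analysis"
    "HOL-Computational_Algebra.Computational_Algebra"
    "HOL-Number_Theory.Cong"
begin

text \<open>
  The numbers \<open>tbar n\<close> are the coefficients of the formal power series
  \[\prod_{n\ge 1} \frac{1-q^{3n}}{(1-q^{2n})(1-q^{n})}.\]
  All series have integer coefficients, so \<^const>\<open>inverse\<close> is not available on them;
  \<open>fps_right_inverse f 1\<close> is the multiplicative inverse of a series \<open>f\<close> with
  constant coefficient 1 over any ring.  The infinite product is the limit in the \<open>q\<close>-adic
  topology, and \<^const>\<open>prodinf\<close> starts at index 0, whence the shift by \<^const>\<open>Suc\<close>.
\<close>

definition tbar_factor :: "nat \<Rightarrow> int fps" where
  "tbar_factor n =
     (1 - fps_X ^ (3 * n)) * fps_right_inverse ((1 - fps_X ^ (2 * n)) * (1 - fps_X ^ n)) 1"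

definition tbar_gf :: "int fps" where
  "tbar_gf = (\<Prod>n. tbar_factor (Suc n))"

definition tbar :: "nat \<Rightarrow> int" where
  "tbar n = fps_nth tbar_gf n"

lemma tbar_factor_mult:
  assumes "n \<ge> 1"
  shows "tbar_factor n * ((1 - fps_X ^ (2 * n)) * (1 - fps_X ^ n)) = 1 - fps_X ^ (3 * n)"
proof -
  have "fps_nth ((1 - fps_X ^ (2 * n)) * (1 - fps_X ^ n) :: int fps) 0 * 1 = 1"
    using assms by (simp add: fps_mult_nth)
  from fps_right_inverse[OF this] show ?thesis
    by (simp add: tbar_factor_def algebra_simps)
qed

lemma tbar_factor_eq:
  assumes "n \<ge> 1"
  shows "\<exists>h. tbar_factor n = 1 + fps_X ^ n * h"
proof -
  define D I :: "int fps" where "D = (1 - fps_X ^ (2 * n)) * (1 - fps_X ^ n)"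
    and "I = fps_right_inverse D 1"
  have "fps_nth D 0 * 1 = 1"
    using assms by (simp add: D_def fps_mult_nth)
  from fps_right_inverse[OF this] have DI: "D * I = 1"
    by (simp add: I_def)
  have pow: "fps_X ^ (2 * n) = (fps_X ^ n) ^ 2" "fps_X ^ (3 * n) = (fps_X ^ n) ^ 3"
    by (simp_all only: power_mult mult.commute)
  have "1 - y ^ 3 = (1 - y ^ 2) * (1 - y) + y * (1 + y - 2 * y ^ 2)" for y :: "int fps"
    by algebra
  from this[of "fps_X ^ n"]
  have num: "1 - fps_X ^ (3 * n) = D + fps_X ^ n * (1 + fps_X ^ n - 2 * fps_X ^ (2 * n))"
    unfolding D_def pow .
  have "tbar_factor n = (1 - fps_X ^ (3 * n)) * I"
    by (simp add: tbar_factor_def I_def D_def)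
  also have "\<dots> = 1 + fps_X ^ n * ((1 + fps_X ^ n - 2 * fps_X ^ (2 * n)) * I)"
    unfolding num distrib_right DI by (simp add: mult.assoc)
  finally show ?thesis by blast
qed

lemma tbar_partial_prod_nth:
  assumes "m \<le> N" "N \<le> M"
  shows "fps_nth (\<Prod>k<M. tbar_factor (Suc k)) m = fps_nth (\<Prod>k<N. tbar_factor (Suc k)) m"
  using assms(2)
proof (induction M rule: dec_induct)
  case (step M)
  obtain h where h: "tbar_factor (Suc M) = 1 + fps_X ^ Suc M * h"
    using tbar_factor_eq[of "Suc M"] by auto
  have "(\<Prod>k<Suc M. tbar_factor (Suc k)) =
          (\<Prod>k<M. tbar_factor (Suc k)) + fps_X ^ Suc M * (h * (\<Prod>k<M. tbar_factor (Suc k)))"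
    unfolding prod.lessThan_Suc h by (simp add: algebra_simps)
  then show ?case
    using step assms(1) by (simp only: fps_add_nth fps_X_power_mult_nth) auto
qed auto

lemma tbar_has_prod:
  "(\<lambda>n. tbar_factor (Suc n)) has_prod Abs_fps (\<lambda>m. fps_nth (\<Prod>k<m. tbar_factor (Suc k)) m)"
    (is "_ has_prod ?P")
proof -
  have "(\<lambda>n. \<Prod>i\<le>n. tbar_factor (Suc i)) \<longlonglongrightarrow> ?P"
  proof (rule tendsto_fpsI)
    fix m
    show "\<forall>\<^sub>F n in sequentially. fps_nth (\<Prod>i\<le>n. tbar_factor (Suc i)) m = fps_nth ?P m"
      using eventually_ge_at_top[of m]
    proof eventually_elim
      case (elim n)
      have "fps_nth (\<Prod>k<Suc n. tbar_factor (Suc k)) m = fps_nth (\<Prod>k<m. tbar_factor (Suc k)) m"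
        by (rule tbar_partial_prod_nth) (use elim in auto)
      then show ?case
        by (simp only: lessThan_Suc_atMost fps_nth_Abs_fps)
    qed
  qed
  moreover have "fps_nth ?P 0 = 1"
    by simp
  hence "?P \<noteq> 0"
    by (metis fps_zero_nth zero_neq_one)
  ultimately show ?thesis
    by (simp add: has_prod_def raw_has_prod_def)
qed

lemma tbar_eq_partial_prod:
  assumes "n \<le> N"
  shows "tbar n = fps_nth (\<Prod>k<N. tbar_factor (Suc k)) n"
proof -
  have "tbar_gf = Abs_fps (\<lambda>m. fps_nth (\<Prod>k<m. tbar_factor (Suc k)) m)"
    unfolding tbar_gf_def using has_prod_unique[OF tbar_has_prod] by simp
  then show ?thesis
    using tbar_partial_prod_nth[OF order_refl assms] unfolding tbar_def by (metis fps_nth_Abs_fps)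
qed

lemma tbar_0: "tbar 0 = 1"
  by (simp add: tbar_eq_partial_prod[of 0 0])


lemma tbar_factor_nth:
  assumes "j \<ge> 1"
  shows "fps_nth (tbar_factor j) m = (if m = 0 then 1 else 0) - (if m = 3 * j then 1 else 0)
           + (if m < j then 0 else fps_nth (tbar_factor j) (m - j))
           + (if m < 2 * j then 0 else fps_nth (tbar_factor j) (m - 2 * j))
           - (if m < 3 * j then 0 else fps_nth (tbar_factor j) (m - 3 * j))"
proof -
  have "fps_X ^ (2 * j) * fps_X ^ j = (fps_X ^ (3 * j) :: int fps)"
    by (simp flip: power_add)
  moreover have "f = 1 - z + x * f + y * f - z * f"
    if "y * x = z" "f * ((1 - y) * (1 - x)) = 1 - z" for f x y z :: "int fps"
    using that(2) by (simp add: that(1)[symmetric] algebra_simps)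
  ultimately have "tbar_factor j = 1 - fps_X ^ (3 * j) + fps_X ^ j * tbar_factor j
           + fps_X ^ (2 * j) * tbar_factor j - fps_X ^ (3 * j) * tbar_factor j"
    using tbar_factor_mult[OF assms] by blast
  from arg_cong[OF this, of "\<lambda>f. fps_nth f m"] show ?thesis
    by (simp only: fps_add_nth fps_sub_nth fps_X_power_mult_nth fps_X_power_nth fps_one_nth)
qed

lemma tbar_4: "tbar 4 = 8"
proof -
  have idx: "{0..4} = {0, 1, 2, 3, 4 :: nat}" "{0..3} = {0, 1, 2, 3 :: nat}"
    "{0..2} = {0, 1, 2 :: nat}" "{0..1} = {0, 1 :: nat}" "{..<4} = {0, 1, 2, 3 :: nat}"
    by auto
  have "tbar 4 = fps_nth (\<Prod>k<4. tbar_factor (Suc k)) 4"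
    by (rule tbar_eq_partial_prod) simp
  also have "\<dots> = fps_nth (tbar_factor 1 * (tbar_factor 2 * (tbar_factor 3 * tbar_factor 4))) 4"
    by (simp add: idx(5) mult.assoc flip: numeral_2_eq_2)
  also have "\<dots> = 8"
    by (simp add: fps_mult_nth idx tbar_factor_nth[of 1] tbar_factor_nth[of 2]
        tbar_factor_nth[of 3] tbar_factor_nth[of 4] del: One_nat_def)
  finally show ?thesis .
qed

end

theory Submission
  imports
    Defs
    "Berlekamp_Zassenhaus.Finite_Field"
    "HOL-Algebra.Algebraic_Closure_Type"
begin

text \<open>
  Write \<open>f = \<Sum> tbar n q\<^sup>n = \<Prod> (1 - q\<^sup>3\<^sup>n) / ((1 - q\<^sup>2\<^sup>n) (1 - q\<^sup>n))\<close> and \<open>\<theta> = q d/dq\<close>.  Up to normalisation \<open>f\<close> is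
  an eta quotient of weight \<open>-1/2\<close> and level 6 whose expansion starts at exponent 0, and the proof
  is an elementary version of the theory of modular forms modulo \<open>l\<close> on \<open>\<Gamma>\<^sub>0(6)\<close>, a
  group of genus 0.

  Over the integers.  The Eisenstein series \<open>V = 1 + 3q + \<dots>\<close> and \<open>W = q - q\<^sup>2 + \<dots>\<close> span the
  forms of weight 1, and the logarithmic derivative of \<open>V\<close> is a quasimodular form of weight 2.
  All that is needed from modularity are four identities (\<open>theta_eis_V\<close>,
  \<open>theta_eis_W\<close>, \<open>theta_dlog_V\<close>, \<open>dlog_tbar_eq\<close>): they say that \<open>\<theta>\<close>
  acts on the ring generated by \<open>V\<close>, \<open>W\<close> and the quasimodular form, and how \<open>\<theta> f / f\<close> lies in it.
  They rest on formulas for products of two Lambert series as single Lambert series, and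
  all of these are instances of one combinatorial identity in the style of Liouville (\<open>kernel_sum\<close>),
  applied to six kernels that depend on residues modulo 6.  The congruence \<open>tbar (3n+2) \<equiv> 0\<close> is the equation
  \<open>\<theta>\<^sup>2 f \<equiv> \<theta> f\<close> modulo 3, which drops out of these formulas.

  Modulo a prime \<open>p \<ge> 5\<close>.  A congruence in the class \<open>a\<close> (with \<open>a \<noteq> 0\<close>, as \<open>tbar 0 = 1\<close>) is a
  linear relation between \<open>\<theta> f, \<dots>, \<theta>\<^sup>p\<^sup>-\<^sup>1 f\<close> in which the coefficient of \<open>\<theta> f\<close> is not 0.  Such a
  relation is impossible (\<open>no_theta_relation\<close>).  Take \<open>x = W / V\<close> as the variable.  Then \<open>V\<close>
  becomes a power series in \<open>x\<close> that solves a linear differential equation of order two with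
  polynomial coefficients.  In characteristic \<open>p\<close> its truncation \<open>B\<close> below degree \<open>p\<close> is again a
  solution, \<open>V = B c\<close> with \<open>c' = 0\<close>, and \<open>B\<close> has \<open>p - 1\<close> simple roots away from the cusps
  (the supersingular points).  Also \<open>f = c\<^sub>1 G\<close> with a polynomial \<open>G\<close> that is
  \<open>B\<^bsup>(p-1)/2\<^esup>\<close> up to factors that live at cusps, and \<open>\<theta> = C D\<close> where \<open>C = c\<^sup>2\<close> is a constant of the
  derivation and \<open>D = x (1-x) (1-9x) B\<^sup>2 d/dx\<close> acts on polynomials.

  At a root of \<open>B\<close> the operator \<open>D\<close> raises the order of vanishing by exactly 1 unless
  that order is divisible by \<open>p\<close>; this is the rule for the filtration of \<open>\<theta> f\<close>.  As the order
  of \<open>G\<close> is \<open>(p-1)/2\<close>, nothing special happens in the first \<open>(p+1)/2\<close> steps.  On the other hand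
  \<open>\<theta>\<^sup>p x = \<theta> x\<close> makes \<open>C\<^sup>p\<^sup>-\<^sup>1\<close> a rational function of \<open>x\<close>, so \<open>C\<close> generates a Kummer extension
  (\<open>kummer_degree\<close>), and the orders of vanishing at a suitable root of \<open>B\<close> leave only \<open>p - 1\<close> and
  \<open>(p-1)/2\<close> for its degree.  In the
  first case a linear relation is trivial, in the second it only links \<open>\<theta> f\<close> to
  \<open>\<theta>\<^bsup>(p+1)/2\<^esup> f\<close>, and these have different orders of vanishing.
\<close>

text \<open>
  The notions of primality, order and degree below are those for type classes and for the type of polynomials.
\<close>

hide_const (open) Divisibility.prime Coset.order Polynomials.degree Polynomials.lead_coeff
  up_ring.coeff up_ring.monom module.smult Divisibility.irreducible

section \<open>A combinatorial identity for products of Lambert series\<close>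

text \<open>
  The index set of the coefficient of \<open>q\<^sup>N\<close> in a product of two Lambert series.
\<close>

definition quads :: "nat \<Rightarrow> (nat \<times> nat \<times> nat \<times> nat) set" where
  "quads N = {(a, m, b, n). 0 < a \<and> 0 < m \<and> 0 < b \<and> 0 < n \<and> a * m + b * n = N}"

lemma finite_quads [simp]: "finite (quads N)"
proof (rule finite_subset)
  have le: "x \<le> N" if "x * y + z = N" "0 < y" for x y z :: nat
    using that by (metis Suc_leI le_add1 mult.right_neutral mult_le_mono2 order.trans One_nat_def)
  show "quads N \<subseteq> {..N} \<times> {..N} \<times> {..N} \<times> {..N}"
  proof
    fix x assume "x \<in> quads N"
    then obtain a m b n where *: "x = (a, m, b, n)" "0 < a" "0 < m" "0 < b" "0 < n" "a * m + b * n = N"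
      by (auto simp: quads_def)
    have "a \<le> N" "m \<le> N" "b \<le> N" "n \<le> N"
      using le[of a m "b * n"] le[of m a "b * n"] le[of b n "a * m"] le[of n b "a * m"] *
      by (simp_all add: mult.commute add.commute)
    then show "x \<in> {..N} \<times> {..N} \<times> {..N} \<times> {..N}" using * by simp
  qed
qed auto

lemma sum_trichotomy:
  fixes u v :: "'a \<Rightarrow> nat" and f :: "'a \<Rightarrow> 'b :: comm_monoid_add"
  assumes "finite Q"
  shows "sum f Q = sum f {x \<in> Q. v x < u x} + sum f {x \<in> Q. u x < v x} + sum f {x \<in> Q. u x = v x}"
proof -
  have "sum f Q = (\<Sum>x\<in>Q. (if v x < u x then f x else 0) + (if u x < v x then f x else 0)
      + (if u x = v x then f x else 0))"
    by (rule sum.cong) auto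
  then show ?thesis
    using assms by (simp add: sum.distrib sum.inter_filter)
qed

text \<open>
  The kernel is a function of triples \<open>(a, b, c)\<close> with \<open>a + b + c = 0\<close> that is even and invariant
  under permutations.  Comparing \<open>m\<close> with \<open>n\<close> in \<open>a m + b n = N\<close> and subtracting the smaller
  from the larger maps the solutions with \<open>m > n\<close> to those with \<open>a < b\<close>, and the solutions
  with \<open>m < n\<close> to those with \<open>a > b\<close>.  Under this map \<open>k(a, b)\<close> turns into \<open>k(a, -b)\<close> by symmetry, so
  that everything cancels but the two diagonals \<open>m = n\<close> and \<open>a = b\<close>.
\<close>

lemma kernel_sum:
  fixes k :: "int \<Rightarrow> int \<Rightarrow> int"
  assumes sym: "\<And>a b. k b a = k a b"
    and even: "\<And>a b. k (- a) (- b) = k a b"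
    and rot: "\<And>a b. k a (- a - b) = k a b"
    and N: "0 < N"
  shows "(\<Sum>(a, m, b, n)\<in>quads N. k (int a) (int b) - k (int a) (- int b))
       = (\<Sum>d | d dvd N. (\<Sum>a = 1..<d. k (int a) (- int d)) - (int (N div d) - 1) * k (int d) 0)"
proof -
  have rot1: "k a (b - a) = k a (- b)" for a b
    using rot[of a "b - a"] by simp
  have rot2: "k (a - b) b = k a (- b)" for a b
    using rot1[of b a] even[of b "- a"] by (simp add: sym)
  have rot0: "k a (- a) = k a 0" for a
    using rot[of a 0] by simp
  have dv1: "(a * m + b * m) div (a + b) = m" "a + b dvd a * m + b * m" if "0 < a" for a b m :: nat
    using that by (simp_all flip: distrib_right)
  have dv2: "a * m + (d - a) * m = d * m" if "a < d" for a d m :: nat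
    using that by (simp flip: distrib_right)
  have dv3: "(a * m + a * n) div a = m + n" "a dvd a * m + a * n" if "0 < a" for a m n :: nat
    using that by (simp_all flip: distrib_left)
  have dv4: "a * m + a * (c - m) = a * c" if "m < c" for a c m :: nat
    using that by (simp flip: distrib_left)
  define fst' snd' trd' fth' :: "nat \<times> nat \<times> nat \<times> nat \<Rightarrow> nat"
    where "fst' = (\<lambda>(a, m, b, n). a)" and "snd' = (\<lambda>(a, m, b, n). m)"
      and "trd' = (\<lambda>(a, m, b, n). b)" and "fth' = (\<lambda>(a, m, b, n). n)"
  note defs = fst'_def snd'_def trd'_def fth'_def
  define Q where "Q = quads N"
  define f where "f = (\<lambda>(a :: nat, m :: nat, b :: nat, n :: nat). k (int a) (int b))"
  define g where "g = (\<lambda>(a :: nat, m :: nat, b :: nat, n :: nat). k (int a) (- int b))"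
  have fQ: "finite Q" by (simp add: Q_def)
  \<comment> \<open>subtract the smaller of \<open>m\<close>, \<open>n\<close> from the larger one\<close>
  have "sum f {x \<in> Q. fth' x < snd' x} = sum g {x \<in> Q. fst' x < trd' x}"
    by (rule sum.reindex_bij_witness[where i = "\<lambda>(a, m, b, n). (a, m + n, b - a, n)"
          and j = "\<lambda>(a, m, b, n). (a, m - n, a + b, n)"])
      (auto simp: Q_def quads_def f_def g_def defs algebra_simps diff_mult_distrib2 of_nat_diff rot1[symmetric] dest!: less_imp_Suc_add)
  moreover have "sum f {x \<in> Q. snd' x < fth' x} = sum g {x \<in> Q. trd' x < fst' x}"
    by (rule sum.reindex_bij_witness[where i = "\<lambda>(a, m, b, n). (a - b, m, b, n + m)"
          and j = "\<lambda>(a, m, b, n). (a + b, m, b, n - m)"])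
      (auto simp: Q_def quads_def f_def g_def defs algebra_simps diff_mult_distrib2 of_nat_diff rot2[symmetric] dest!: less_imp_Suc_add)
  moreover have "sum f {x \<in> Q. snd' x = fth' x} = (\<Sum>(d, a)\<in>(SIGMA d:{d. d dvd N}. {1..<d}). k (int a) (- int d))"
    by (rule sum.reindex_bij_witness[where i = "\<lambda>(d, a). (a, N div d, d - a, N div d)"
          and j = "\<lambda>(a, m, b, n). (a + b, a)"])
      (use N dv1 dv2 in \<open>auto simp: Q_def quads_def f_def g_def defs of_nat_diff rot1[symmetric] 
         elim!: dvdE intro!: Nat.gr0I\<close>)
  moreover have "sum g {x \<in> Q. fst' x = trd' x} = (\<Sum>(d, m)\<in>(SIGMA d:{d. d dvd N}. {1..<N div d}). k (int d) 0)"
    by (rule sum.reindex_bij_witness[where i = "\<lambda>(d, m). (d, m, d, N div d - m)"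
          and j = "\<lambda>(a, m, b, n). (a, m)"])
      (use N rot0 dv3 dv4 in \<open>auto simp: Q_def quads_def f_def g_def defs of_nat_diff 
         elim!: dvdE intro!: Nat.gr0I\<close>)
  moreover have "sum f Q - sum g Q = (\<Sum>(a, m, b, n)\<in>quads N. k (int a) (int b) - k (int a) (- int b))"
    by (simp add: Q_def f_def g_def sum_subtractf case_prod_unfold)
  moreover have "finite {d. d dvd N}" using N by simp
  moreover have "(\<Sum>d | d dvd N. int (N div d - Suc 0) * k (int d) 0) = (\<Sum>d | d dvd N. (int (N div d) - 1) * k (int d) 0)"
    by (rule sum.cong) (use N in \<open>auto simp: of_nat_diff elim!: dvdE\<close>)
  ultimately show ?thesis
    using sum_trichotomy[OF fQ, of f fth' snd'] sum_trichotomy[OF fQ, of g trd' fst']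
    by (simp add: sum.Sigma[symmetric] sum_subtractf)
qed

definition lambert_series :: "(nat \<Rightarrow> int) \<Rightarrow> int fps" where
  "lambert_series g = Abs_fps (\<lambda>N. if N = 0 then 0 else \<Sum>d | d dvd N. g d)"

lemma lambert_series_nth: "lambert_series g $ N = (if N = 0 then 0 else \<Sum>d | d dvd N. g d)"
  by (simp add: lambert_series_def)

lemma lambert_series_mult_nth: "(lambert_series g * lambert_series h) $ N = (\<Sum>(a, m, b, n)\<in>quads N. g a * h b)"
proof -
  define P where "P = {(i, j). 0 < i \<and> 0 < j \<and> i + j = N}"
  have "P \<subseteq> {..N} \<times> {..N}" by (auto simp: P_def)
  then have fP: "finite P" by (rule finite_subset) simp
  have "(lambert_series g * lambert_series h) $ N = (\<Sum>i = 0..N. lambert_series g $ i * lambert_series h $ (N - i))"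
    by (simp add: fps_mult_nth)
  also have "\<dots> = (\<Sum>i\<in>{0<..<N}. lambert_series g $ i * lambert_series h $ (N - i))"
    by (rule sum.mono_neutral_right) (auto simp: lambert_series_nth)
  also have "\<dots> = (\<Sum>(i, j)\<in>P. lambert_series g $ i * lambert_series h $ j)"
    by (rule sum.reindex_bij_witness[where i = fst and j = "\<lambda>i. (i, N - i)"]) (auto simp: P_def)
  also have "\<dots> = (\<Sum>x\<in>P. \<Sum>(a, b)\<in>{a. a dvd fst x} \<times> {b. b dvd snd x}. g a * h b)"
    by (rule sum.cong) (auto simp: P_def lambert_series_nth sum_product sum.cartesian_product)
  also have "\<dots> = (\<Sum>(x, y)\<in>(SIGMA x:P. {a. a dvd fst x} \<times> {b. b dvd snd x}). case y of (a, b) \<Rightarrow> g a * h b)"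
    by (rule sum.Sigma) (use fP in \<open>auto simp: P_def\<close>)
  also have "\<dots> = (\<Sum>(a, m, b, n)\<in>quads N. g a * h b)"
    by (rule sum.reindex_bij_witness[where i = "\<lambda>(a, m, b, n). ((a * m, b * n), a, b)"
          and j = "\<lambda>((i, j), a, b). (a, i div a, b, j div b)"])
      (auto simp: quads_def P_def elim!: dvdE)
  finally show ?thesis .
qed

definition theta :: "'a :: comm_semiring_1 fps \<Rightarrow> 'a fps" where
  "theta f = fps_X * fps_deriv f"

lemma theta_nth [simp]: "theta f $ n = of_nat n * f $ n"
  by (simp add: theta_def fps_mult_fps_X_deriv_shift)

section \<open>Kernels that are given by residues modulo 6\<close>

definition tab :: "int list list \<Rightarrow> int \<Rightarrow> int \<Rightarrow> int" where
  "tab T a b = T ! nat (a mod 6) ! nat (b mod 6)"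

text \<open>
  The sum over the three entries of a triple \<open>(a, b, -a-b)\<close>; the table lists the
  coefficient of the \<open>p\<close>-th power of an entry, depending on the residues of this entry and of another one.
\<close>

definition kernel :: "int list list \<Rightarrow> nat \<Rightarrow> int \<Rightarrow> int \<Rightarrow> int" where
  "kernel T p a b = tab T a b * a ^ p + tab T b a * b ^ p + tab T (- a - b) a * (- a - b) ^ p"

text \<open>
  The conditions that make \<open>kernel\<close> even and symmetric: the coefficient of an entry may not depend
  on which of the other two entries is looked up.
\<close>

definition symmetric_table :: "int list list \<Rightarrow> nat \<Rightarrow> bool" where
  "symmetric_table T p \<longleftrightarrow> (\<forall>i<6. \<forall>j<6. T ! i ! ((12 - i - j) mod 6) = T ! i ! j \<and>
     T ! ((6 - i) mod 6) ! ((6 - j) mod 6) = (- 1) ^ p * T ! i ! j)"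

lemma nat_mod6_third: "nat ((- a - b) mod 6) = (12 - nat (a mod 6) - nat (b mod 6)) mod 6" for a b :: int
proof -
  have "12 - r - s = (- x - y) + 6 * (2 + q + t)" if "6 * q + r = x" "6 * t + s = y" for x y q r s t :: int
    by (simp add: that[symmetric] algebra_simps)
  from this[OF mult_div_mod_eq mult_div_mod_eq]
  have "12 - a mod 6 - b mod 6 = (- a - b) + 6 * (2 + a div 6 + b div 6)" .
  then have "(- a - b) mod 6 = (12 - a mod 6 - b mod 6) mod 6"
    by (simp only: mod_mult_self2)
  moreover have "0 \<le> 12 - a mod 6 - b mod 6"
    using pos_mod_bound[of 6 a] pos_mod_bound[of 6 b] by linarith
  then have "nat ((12 - a mod 6 - b mod 6) mod 6) = nat (12 - a mod 6 - b mod 6) mod 6"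
    by (subst nat_mod_distrib) (simp_all only: nat_numeral zero_le_numeral)
  moreover have "nat (12 - x - y) = 12 - nat x - nat y" if "0 \<le> x" "0 \<le> y" for x y :: int
    using that by linarith
  then have "nat (12 - a mod 6 - b mod 6) = 12 - nat (a mod 6) - nat (b mod 6)"
    by (simp only: pos_mod_sign zero_less_numeral)
  ultimately show ?thesis
    by metis
qed

lemma nat_mod6_uminus: "nat ((- a) mod 6) = (6 - nat (a mod 6)) mod 6" for a :: int
proof -
  have "12 - nat (a mod 6) = 6 + (6 - nat (a mod 6))"
    using pos_mod_bound[of 6 a] by linarith
  then show ?thesis
    using nat_mod6_third[of a 0] by (simp only: diff_0_right mod_0 nat_zero_as_int[symmetric] nat_0 diff_zero mod_add_self1)
qed

lemma nat_mod6_less: "nat (a mod 6) < 6" for a :: int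
  by simp

lemma tab_symmetry:
  assumes "symmetric_table T p"
  shows "tab T a (- a - b) = tab T a b" "tab T (- a) (- b) = (- 1) ^ p * tab T a b"
  using assms nat_mod6_less[of a] nat_mod6_less[of b]
  unfolding symmetric_table_def tab_def nat_mod6_uminus nat_mod6_third by blast+

lemma neg_one_power_mult: "(- 1) ^ p * (- c) ^ p = (c :: int) ^ p"
  by (simp flip: power_mult_distrib)

lemma kernel_symmetry:
  assumes T: "symmetric_table T p"
  shows "kernel T p b a = kernel T p a b" "kernel T p (- a) (- b) = kernel T p a b"
    "kernel T p a (- a - b) = kernel T p a b"
proof -
  have 1: "tab T (- a - b) b = tab T (- a - b) a" for a b
    using tab_symmetry(1)[OF T, of "- a - b" a] by simp
  have 2: "tab T (- x) (- y) * (- z) ^ p = tab T x y * z ^ p" for x y z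
  proof -
    have "tab T (- x) (- y) * (- z) ^ p = tab T x y * ((- 1) ^ p * (- z) ^ p)"
      unfolding tab_symmetry(2)[OF T] by (simp only: mult_ac)
    then show ?thesis
      by (simp only: neg_one_power_mult)
  qed
  have c: "- b - a = - a - b" "- (- a) - (- b) = - (- a - b)" "- a - (- a - b) = b"
    by simp_all
  show "kernel T p b a = kernel T p a b"
    unfolding kernel_def c(1) 1[of a b] by (simp only: add_ac)
  show "kernel T p (- a) (- b) = kernel T p a b"
    unfolding kernel_def c(2) 2[of a b a] 2[of b a b] 2[of "- a - b" a "- a - b"] ..
  show "kernel T p a (- a - b) = kernel T p a b"
    unfolding kernel_def c(3) tab_symmetry(1)[OF T, of a b] by (simp only: add_ac)
qed

lemma sum_lessThan_6:
  fixes f :: "nat \<Rightarrow> 'a :: comm_monoid_add"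
  shows "(\<Sum>a<6 * n + r. f a) = (\<Sum>j<n. \<Sum>i<6. f (6 * j + i)) + (\<Sum>i<r. f (6 * n + i))"
proof (induction r)
  case 0
  show ?case
    by (induction n) (simp_all add: eval_nat_numeral add_ac)
qed (simp add: add_ac)

lemma periodic_power_sum_0:
  fixes u :: "nat \<Rightarrow> int"
  assumes "r < 6"
  shows "(\<Sum>a<6 * n + r. u (a mod 6)) = int n * (\<Sum>i<6. u i) + (\<Sum>i<r. u i)"
  using assms by (simp add: sum_lessThan_6 del: sum.lessThan_Suc)

lemma periodic_power_sum_1:
  fixes u :: "nat \<Rightarrow> int"
  assumes "r < 6"
  shows "(\<Sum>a<6 * n + r. u (a mod 6) * int a) =
    (\<Sum>i<6. u i * (3 * int n * (int n - 1) + int i * int n)) + (\<Sum>i<r. u i * (6 * int n + int i))"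
proof -
  have "(\<Sum>j<n. \<Sum>i<6. u i * (6 * int j + int i)) =
      (\<Sum>i<6. u i * (3 * int n * (int n - 1) + int i * int n))"
    by (induction n) (simp_all add: eval_nat_numeral algebra_simps)
  then show ?thesis
    using assms by (simp add: sum_lessThan_6 del: sum.lessThan_Suc)
qed

lemma periodic_power_sum_2:
  fixes u :: "nat \<Rightarrow> int"
  assumes "r < 6"
  shows "(\<Sum>a<6 * n + r. u (a mod 6) * int a ^ 2) =
    (\<Sum>i<6. u i * (6 * int n * (int n - 1) * (2 * int n - 1) + 6 * int i * int n * (int n - 1) + int i ^ 2 * int n))
    + (\<Sum>i<r. u i * (6 * int n + int i) ^ 2)"
proof -
  have "(\<Sum>j<n. \<Sum>i<6. u i * (6 * int j + int i) ^ 2) =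
      (\<Sum>i<6. u i * (6 * int n * (int n - 1) * (2 * int n - 1) + 6 * int i * int n * (int n - 1) + int i ^ 2 * int n))"
    by (induction n) (simp_all add: eval_nat_numeral algebra_simps)
  then show ?thesis
    using assms by (simp add: sum_lessThan_6 del: sum.lessThan_Suc)
qed

lemma tab_of_nat_uminus:
  "tab T (int a) (- int b) = T ! (a mod 6) ! ((6 - b mod 6) mod 6)"
  by (simp add: tab_def nat_mod6_uminus nat_mod_distrib)

text \<open>
  The symmetries leave only sums of powers of \<open>a\<close> weighted by periodic functions of \<open>a\<close>, for which
  there are closed formulas.
\<close>

lemma kernel_row_sum:
  assumes T: "symmetric_table T p"
  shows "(\<Sum>a = 1..<d. kernel T p (int a) (- int d)) =
     2 * (\<Sum>a<d. T ! (a mod 6) ! ((6 - d mod 6) mod 6) * int a ^ p)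
     + int d ^ p * (\<Sum>a<d. T ! (d mod 6) ! ((6 - a mod 6) mod 6))
     - (if d = 0 then 0 else 2 * T ! 0 ! ((6 - d mod 6) mod 6) * 0 ^ p + int d ^ p * T ! (d mod 6) ! 0)"
proof -
  define f where "f a = tab T (int a) (- int d) * int a ^ p" for a
  define g where "g a = tab T (int d) (- int a)" for a
  have *: "kernel T p (int a) (- int d) = f a + f (d - a) + int d ^ p * g a" if "a < d" for a
  proof -
    define c where "c = int (d - a)"
    have c: "- int a - - int d = c" "- c - int a = - int d"
      using that by (simp_all add: c_def)
    have 1: "tab T c (int a) = tab T c (- int d)"
      using tab_symmetry(1)[OF T, of c "int a"] unfolding c by simp
    have 2: "tab T (- int d) (int a) * (- int d) ^ p = int d ^ p * tab T (int d) (- int a)"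
      using tab_symmetry(2)[OF T, of "int d" "- int a"]
      unfolding minus_minus neg_one_power_mult[of p "int d", symmetric] by (simp only: mult_ac)
    show ?thesis
      unfolding kernel_def f_def g_def c c_def[symmetric] 1 2 by simp
  qed
  have "(\<Sum>a = 1..<d. kernel T p (int a) (- int d)) = (\<Sum>a = 1..<d. f a + f (d - a) + int d ^ p * g a)"
    by (rule sum.cong) (auto simp: *)
  also have "\<dots> = (\<Sum>a = 1..<d. f a) + (\<Sum>a = 1..<d. f (d - a)) + int d ^ p * (\<Sum>a = 1..<d. g a)"
    by (simp add: sum.distrib sum_distrib_left)
  also have "(\<Sum>a = 1..<d. f (d - a)) = (\<Sum>a = 1..<d. f a)"
    by (rule sum.reindex_bij_witness[where i = "\<lambda>a. d - a" and j = "\<lambda>a. d - a"]) auto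
  also have "(\<Sum>a = 1..<d. f a) + (\<Sum>a = 1..<d. f a) = 2 * (\<Sum>a = 1..<d. f a)"
    by simp
  finally have *: "(\<Sum>a = 1..<d. kernel T p (int a) (- int d)) =
      2 * (\<Sum>a = 1..<d. f a) + int d ^ p * (\<Sum>a = 1..<d. g a)" .
  have drop: "(\<Sum>a = 1..<d. h a) = (\<Sum>a<d. h a) - (if d = 0 then 0 else h 0)" for h :: "nat \<Rightarrow> int"
    by (simp add: atLeast1_lessThan_eq_remove0 sum_diff1)
  show ?thesis
    unfolding * drop unfolding f_def g_def tab_of_nat_uminus
    by (cases "d = 0") (simp_all add: right_diff_distrib)
qed

text \<open>
  The weights of the diagonal \<open>a = b\<close> involve \<open>N / d\<close>.  If the kernel is \<open>d\<close> times
  something there, then they produce \<open>N\<close> and hence a derivative \<open>\<theta>\<close> of a Lambert series.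
\<close>

lemma kernel_lambert:
  assumes T: "symmetric_table T p"
    and s: "\<And>d. 0 < d \<Longrightarrow> (\<Sum>a = 1..<d. kernel T p (int a) (- int d)) + int d * u d = s d"
    and u: "\<And>d. 0 < d \<Longrightarrow> kernel T p (int d) 0 = int d * u d"
  shows "Abs_fps (\<lambda>N. \<Sum>(a, m, b, n)\<in>quads N. kernel T p (int a) (int b) - kernel T p (int a) (- int b))
         = lambert_series s - theta (lambert_series u)"
proof (rule fps_ext)
  fix N
  let ?K = "kernel T p"
  show "Abs_fps (\<lambda>N. \<Sum>(a, m, b, n)\<in>quads N. ?K (int a) (int b) - ?K (int a) (- int b)) $ N
    = (lambert_series s - theta (lambert_series u)) $ N"
  proof (cases "N = 0")
    case True
    then have "quads N = {}" by (auto simp: quads_def)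
    with True show ?thesis by (simp add: lambert_series_nth)
  next
    case False
    then have "(\<Sum>(a, m, b, n)\<in>quads N. ?K (int a) (int b) - ?K (int a) (- int b)) =
       (\<Sum>d | d dvd N. (\<Sum>a = 1..<d. ?K (int a) (- int d)) - (int (N div d) - 1) * ?K (int d) 0)"
      by (intro kernel_sum kernel_symmetry[OF T]) simp
    also have "\<dots> = (\<Sum>d | d dvd N. s d - int N * u d)"
    proof (rule sum.cong[OF refl])
      fix d assume "d \<in> {d. d dvd N}"
      then obtain c where c: "N = d * c" by (auto elim: dvdE)
      with False have "0 < d" by auto
      with c show "(\<Sum>a = 1..<d. ?K (int a) (- int d)) - (int (N div d) - 1) * ?K (int d) 0 = s d - int N * u d"
        unfolding s[OF \<open>0 < d\<close>, symmetric] u[OF \<open>0 < d\<close>] using \<open>0 < d\<close> by (simp add: algebra_simps)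
    qed
    finally show ?thesis
      using False by (simp add: lambert_series_nth sum_subtractf flip: sum_distrib_left)
  qed
qed

lemma kernel_int_cases:
  "kernel T p a b = T ! nat (a mod 6) ! nat (b mod 6) * a ^ p + T ! nat (b mod 6) ! nat (a mod 6) * b ^ p
     + T ! ((12 - nat (a mod 6) - nat (b mod 6)) mod 6) ! nat (a mod 6) * (- a - b) ^ p"
  by (simp add: kernel_def tab_def nat_mod6_third)

text \<open>
  In terms of residues as indices, an identity for \<open>k(a, b) - k(a, -b)\<close> becomes 36 identities between
  polynomials in \<open>a\<close> and \<open>b\<close>.
\<close>

lemma kernel_diff:
  fixes a b :: nat
  defines "i \<equiv> a mod 6" and "j \<equiv> b mod 6"
  shows "kernel T p (int a) (int b) - kernel T p (int a) (- int b) =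
      (T ! i ! j * int a ^ p + T ! j ! i * int b ^ p + T ! ((12 - i - j) mod 6) ! i * (- int a - int b) ^ p)
    - (T ! i ! ((6 - j) mod 6) * int a ^ p + T ! ((6 - j) mod 6) ! i * (- int b) ^ p
        + T ! ((12 - i - (6 - j) mod 6) mod 6) ! i * (- int a + int b) ^ p)"
  by (simp add: kernel_int_cases nat_mod6_uminus nat_mod_distrib i_def j_def)

definition periodic :: "int list \<Rightarrow> nat \<Rightarrow> nat \<Rightarrow> int" where
  "periodic c p d = c ! (d mod 6) * int d ^ p"

lemma lessThan_6: "i < 6 \<Longrightarrow> i = 0 \<or> i = 1 \<or> i = 2 \<or> i = 3 \<or> i = 4 \<or> i = (5 :: nat)"
  by auto

lemma all_less_6: "(\<forall>i<6. P i) \<longleftrightarrow> P 0 \<and> P 1 \<and> P 2 \<and> P 3 \<and> P 4 \<and> P (5 :: nat)"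
  by (auto dest!: lessThan_6)

lemma sum_less_6:
  fixes f :: "nat \<Rightarrow> int"
  shows "sum f {..<6} = f 0 + f 1 + f 2 + f 3 + f 4 + f 5" "sum f {..<5} = f 0 + f 1 + f 2 + f 3 + f 4"
    "sum f {..<4} = f 0 + f 1 + f 2 + f 3" "sum f {..<3} = f 0 + f 1 + f 2" "sum f {..<2} = f 0 + f 1"
    "sum f {..<1} = f 0"
  by (simp_all add: eval_nat_numeral)

text \<open>
  With \<open>d = 6 n + r\<close> and a fixed residue \<open>r\<close> the row sum is a polynomial in \<open>n\<close>; this and the next two lemmas
  give it in the degrees 0, 1 and 2.
\<close>

lemma kernel_row_sum_0:
  assumes T: "symmetric_table T 0" and "0 < d"
  defines "r \<equiv> d mod 6" and "n \<equiv> int (d div 6)"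
  shows "(\<Sum>a = 1..<d. kernel T 0 (int a) (- int d)) =
     2 * (n * (\<Sum>i<6. T ! i ! ((6 - r) mod 6)) + (\<Sum>i<r. T ! i ! ((6 - r) mod 6)))
     + (n * (\<Sum>i<6. T ! r ! ((6 - i) mod 6)) + (\<Sum>i<r. T ! r ! ((6 - i) mod 6)))
     - (2 * T ! 0 ! ((6 - r) mod 6) + T ! r ! 0)"
proof -
  have r: "r < 6" and d: "6 * (d div 6) + r = d" by (simp_all add: r_def)
  have d0: "(d = 0) = False" using \<open>0 < d\<close> by simp
  note sums = periodic_power_sum_0[OF r, of "\<lambda>i. T ! i ! ((6 - r) mod 6)" "d div 6", unfolded d]
    periodic_power_sum_0[OF r, of "\<lambda>i. T ! r ! ((6 - i) mod 6)" "d div 6", unfolded d]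
  show ?thesis
    unfolding kernel_row_sum[OF T] r_def[symmetric] d0 if_False power_0 power_one_right mult_1_left mult_1_right
      sums n_def ..
qed

lemma kernel_row_sum_1:
  assumes T: "symmetric_table T 1" and "0 < d"
  defines "r \<equiv> d mod 6" and "n \<equiv> int (d div 6)"
  shows "(\<Sum>a = 1..<d. kernel T 1 (int a) (- int d)) =
     2 * ((\<Sum>i<6. T ! i ! ((6 - r) mod 6) * (3 * n * (n - 1) + int i * n))
          + (\<Sum>i<r. T ! i ! ((6 - r) mod 6) * (6 * n + int i)))
     + int d * (n * (\<Sum>i<6. T ! r ! ((6 - i) mod 6)) + (\<Sum>i<r. T ! r ! ((6 - i) mod 6)))
     - int d * T ! r ! 0"
proof -
  have r: "r < 6" and d: "6 * (d div 6) + r = d" by (simp_all add: r_def)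
  have d0: "(d = 0) = False" using \<open>0 < d\<close> by simp
  note sums = periodic_power_sum_1[OF r, of "\<lambda>i. T ! i ! ((6 - r) mod 6)" "d div 6", unfolded d]
    periodic_power_sum_0[OF r, of "\<lambda>i. T ! r ! ((6 - i) mod 6)" "d div 6", unfolded d]
  show ?thesis
    unfolding kernel_row_sum[OF T] r_def[symmetric] d0 if_False power_0 power_one_right mult_1_left mult_1_right
      sums n_def zero_power[OF zero_less_one] zero_power2 mult_zero_right add_0_left ..
qed

lemma kernel_row_sum_2:
  assumes T: "symmetric_table T 2" and "0 < d"
  defines "r \<equiv> d mod 6" and "n \<equiv> int (d div 6)"
  shows "(\<Sum>a = 1..<d. kernel T 2 (int a) (- int d)) =
     2 * ((\<Sum>i<6. T ! i ! ((6 - r) mod 6) * (6 * n * (n - 1) * (2 * n - 1) + 6 * int i * n * (n - 1) + int i ^ 2 * n))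
          + (\<Sum>i<r. T ! i ! ((6 - r) mod 6) * (6 * n + int i) ^ 2))
     + int d ^ 2 * (n * (\<Sum>i<6. T ! r ! ((6 - i) mod 6)) + (\<Sum>i<r. T ! r ! ((6 - i) mod 6)))
     - int d ^ 2 * T ! r ! 0"
proof -
  have r: "r < 6" and d: "6 * (d div 6) + r = d" by (simp_all add: r_def)
  have d0: "(d = 0) = False" using \<open>0 < d\<close> by simp
  note sums = periodic_power_sum_2[OF r, of "\<lambda>i. T ! i ! ((6 - r) mod 6)" "d div 6", unfolded d]
    periodic_power_sum_0[OF r, of "\<lambda>i. T ! r ! ((6 - i) mod 6)" "d div 6", unfolded d]
  show ?thesis
    unfolding kernel_row_sum[OF T] r_def[symmetric] d0 if_False power_0 power_one_right mult_1_left mult_1_right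
      sums n_def zero_power[OF zero_less_one] zero_power2 mult_zero_right add_0_left ..
qed

lemma div_mod_6_int: "6 * int (d div 6) + int (d mod 6) = int d"
  using arg_cong[OF mult_div_mod_eq[of 6 d], of int] by (simp only: of_nat_add of_nat_mult of_nat_numeral)

lemma nat_mod_6_less: "d mod 6 < (6 :: nat)"
  by simp

lemma kernel_column:
  "kernel T p (int d) 0 = T ! (d mod 6) ! 0 * int d ^ p + T ! 0 ! (d mod 6) * 0 ^ p
     + T ! ((12 - d mod 6) mod 6) ! (d mod 6) * (- int d) ^ p"
  by (simp add: kernel_int_cases nat_mod_distrib)

abbreviation "coef_v \<equiv> [0, 1, 0, 0, 0, - 1] :: int list"
abbreviation "coef_w \<equiv> [0, 1, - 2, 0, 2, - 1] :: int list"
abbreviation "coef_e \<equiv> [- 2, 3, - 3, 2, - 3, 3] :: int list"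
abbreviation "coef_f \<equiv> [- 2, - 1, 1, 2, 1, - 1] :: int list"
abbreviation "coef_g \<equiv> [0, 3, - 3, 6, - 3, 3] :: int list"
abbreviation "coef_d \<equiv> [0, - 4, 4, 0, 4, - 4] :: int list"

section \<open>Six kernels of level 6\<close>

text \<open>
  Each kernel is a solution of the linear system that prescribes \<open>k(a, b) - k(a, -b)\<close> as a
  sum of symmetrised products of two periodic functions, scaled so as to be integral.  The first three tables serve the products of weight
  two of the Eisenstein series \<open>V\<close> and \<open>W\<close>.
\<close>

definition table_vv :: "int list list" where
  "table_vv = [[0, 0, 0, 0, 0, 0],
    [0, 1, 1, 1, 1, 0],
    [0, 1, 0, 1, 0, 1],
    [0, 1, 1, 0, 1, 1],
    [0, 1, 0, 1, 0, 1],
    [0, 0, 1, 1, 1, 1]]"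

lemma symmetric_table_vv: "symmetric_table table_vv 0"
  by (simp add: symmetric_table_def all_less_6 table_vv_def)

lemma diff_table_vv: "(kernel table_vv 0 (int a) (int b) - kernel table_vv 0 (int a) (- int b)) =
    3 * (periodic coef_v 0 a * periodic coef_v 0 b)"
proof -
  have "\<forall>i<6. \<forall>j<6. ((table_vv ! i ! j * x ^ 0 + table_vv ! j ! i * y ^ 0 + table_vv ! ((12 - i - j) mod 6) ! i * (- x - y) ^ 0)
    - (table_vv ! i ! ((6 - j) mod 6) * x ^ 0 + table_vv ! ((6 - j) mod 6) ! i * (- y) ^ 0
        + table_vv ! ((12 - i - (6 - j) mod 6) mod 6) ! i * (- x + y) ^ 0)) =
    3 * (coef_v ! i * x ^ 0 * (coef_v ! j * y ^ 0))" for x y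
    by (simp add: all_less_6 table_vv_def)
  then show ?thesis
    unfolding kernel_diff periodic_def by (simp only: nat_mod_6_less)
qed

lemma row_table_vv:
  assumes "0 < d"
  shows "2 * (\<Sum>a = 1..<d. kernel table_vv 0 (int a) (- int d)) =  periodic [0, 4, 3, 4, 3, 4] 1 d - 4 * periodic coef_v 0 d"
proof -
  define n where "n = int (d div 6)"
  have "\<forall>r<6. 2 * (2 * (n * (\<Sum>i<6. table_vv ! i ! ((6 - r) mod 6)) + (\<Sum>i<r. table_vv ! i ! ((6 - r) mod 6)))
     + (n * (\<Sum>i<6. table_vv ! r ! ((6 - i) mod 6)) + (\<Sum>i<r. table_vv ! r ! ((6 - i) mod 6)))
     - (2 * table_vv ! 0 ! ((6 - r) mod 6) + table_vv ! r ! 0)) =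
      ([0, 4, 3, 4, 3, 4] ! r * (6 * n + int r) ^ 1) - 4 * (coef_v ! r * (6 * n + int r) ^ 0)"
    by (simp add: all_less_6 sum_less_6 table_vv_def algebra_simps)
  from this[rule_format, OF nat_mod_6_less, of d] show ?thesis
    unfolding kernel_row_sum_0[OF symmetric_table_vv assms] periodic_def n_def div_mod_6_int .
qed

lemma column_table_vv: "kernel table_vv 0 (int d) 0 = 0"
proof -
  have "\<forall>r<6. table_vv ! r ! 0 * x ^ 0 + table_vv ! 0 ! r * 0 ^ 0 + table_vv ! ((12 - r) mod 6) ! r * (- x) ^ 0 = 0" for x
    by (simp add: all_less_6 table_vv_def)
  then show ?thesis
    unfolding kernel_column periodic_def by (simp only: nat_mod_6_less)
qed

definition table_vw :: "int list list" where
  "table_vw = [[0, 0, 0, 0, 0, 0],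
    [0, 1, 0, 0, 1, 0],
    [0, 0, 0, 0, 0, 1],
    [0, 0, 0, 0, 0, 0],
    [0, 1, 0, 0, 0, 0],
    [0, 0, 1, 0, 0, 1]]"

lemma symmetric_table_vw: "symmetric_table table_vw 0"
  by (simp add: symmetric_table_def all_less_6 table_vw_def)

lemma diff_table_vw: "2 * (kernel table_vw 0 (int a) (int b) - kernel table_vw 0 (int a) (- int b)) =
    3 * (periodic coef_v 0 a * periodic coef_w 0 b) + 3 * (periodic coef_w 0 a * periodic coef_v 0 b)"
proof -
  have "\<forall>i<6. \<forall>j<6. 2 * ((table_vw ! i ! j * x ^ 0 + table_vw ! j ! i * y ^ 0 + table_vw ! ((12 - i - j) mod 6) ! i * (- x - y) ^ 0)
    - (table_vw ! i ! ((6 - j) mod 6) * x ^ 0 + table_vw ! ((6 - j) mod 6) ! i * (- y) ^ 0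
        + table_vw ! ((12 - i - (6 - j) mod 6) mod 6) ! i * (- x + y) ^ 0)) =
    3 * (coef_v ! i * x ^ 0 * (coef_w ! j * y ^ 0)) + 3 * (coef_w ! i * x ^ 0 * (coef_v ! j * y ^ 0))" for x y
    by (simp add: all_less_6 table_vw_def)
  then show ?thesis
    unfolding kernel_diff periodic_def by (simp only: nat_mod_6_less)
qed

lemma row_table_vw:
  assumes "0 < d"
  shows "2 * (\<Sum>a = 1..<d. kernel table_vw 0 (int a) (- int d)) =  periodic [0, 2, 1, 0, 1, 2] 1 d - 2 * periodic coef_w 0 d"
proof -
  define n where "n = int (d div 6)"
  have "\<forall>r<6. 2 * (2 * (n * (\<Sum>i<6. table_vw ! i ! ((6 - r) mod 6)) + (\<Sum>i<r. table_vw ! i ! ((6 - r) mod 6)))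
     + (n * (\<Sum>i<6. table_vw ! r ! ((6 - i) mod 6)) + (\<Sum>i<r. table_vw ! r ! ((6 - i) mod 6)))
     - (2 * table_vw ! 0 ! ((6 - r) mod 6) + table_vw ! r ! 0)) =
      ([0, 2, 1, 0, 1, 2] ! r * (6 * n + int r) ^ 1) - 2 * (coef_w ! r * (6 * n + int r) ^ 0)"
    by (simp add: all_less_6 sum_less_6 table_vw_def algebra_simps)
  from this[rule_format, OF nat_mod_6_less, of d] show ?thesis
    unfolding kernel_row_sum_0[OF symmetric_table_vw assms] periodic_def n_def div_mod_6_int .
qed

lemma column_table_vw: "kernel table_vw 0 (int d) 0 = 0"
proof -
  have "\<forall>r<6. table_vw ! r ! 0 * x ^ 0 + table_vw ! 0 ! r * 0 ^ 0 + table_vw ! ((12 - r) mod 6) ! r * (- x) ^ 0 = 0" for x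
    by (simp add: all_less_6 table_vw_def)
  then show ?thesis
    unfolding kernel_column periodic_def by (simp only: nat_mod_6_less)
qed

definition table_ww :: "int list list" where
  "table_ww = [[0, 0, 0, 0, 0, 0],
    [0, 1, - 1, - 1, 1, 0],
    [0, - 1, 4, - 1, 0, 1],
    [0, - 1, - 1, 0, - 1, - 1],
    [0, 1, 0, - 1, 4, - 1],
    [0, 0, 1, - 1, - 1, 1]]"

lemma symmetric_table_ww: "symmetric_table table_ww 0"
  by (simp add: symmetric_table_def all_less_6 table_ww_def)

lemma diff_table_ww: "(kernel table_ww 0 (int a) (int b) - kernel table_ww 0 (int a) (- int b)) =
    3 * (periodic coef_w 0 a * periodic coef_w 0 b)"
proof -
  have "\<forall>i<6. \<forall>j<6. ((table_ww ! i ! j * x ^ 0 + table_ww ! j ! i * y ^ 0 + table_ww ! ((12 - i - j) mod 6) ! i * (- x - y) ^ 0)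
    - (table_ww ! i ! ((6 - j) mod 6) * x ^ 0 + table_ww ! ((6 - j) mod 6) ! i * (- y) ^ 0
        + table_ww ! ((12 - i - (6 - j) mod 6) mod 6) ! i * (- x + y) ^ 0)) =
    3 * (coef_w ! i * x ^ 0 * (coef_w ! j * y ^ 0))" for x y
    by (simp add: all_less_6 table_ww_def)
  then show ?thesis
    unfolding kernel_diff periodic_def by (simp only: nat_mod_6_less)
qed

lemma row_table_ww:
  assumes "0 < d"
  shows "2 * (\<Sum>a = 1..<d. kernel table_ww 0 (int a) (- int d)) =  periodic [0, 0, 3, - 4, 3, 0] 1 d"
proof -
  define n where "n = int (d div 6)"
  have "\<forall>r<6. 2 * (2 * (n * (\<Sum>i<6. table_ww ! i ! ((6 - r) mod 6)) + (\<Sum>i<r. table_ww ! i ! ((6 - r) mod 6)))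
     + (n * (\<Sum>i<6. table_ww ! r ! ((6 - i) mod 6)) + (\<Sum>i<r. table_ww ! r ! ((6 - i) mod 6)))
     - (2 * table_ww ! 0 ! ((6 - r) mod 6) + table_ww ! r ! 0)) =
      ([0, 0, 3, - 4, 3, 0] ! r * (6 * n + int r) ^ 1)"
    by (simp add: all_less_6 sum_less_6 table_ww_def algebra_simps)
  from this[rule_format, OF nat_mod_6_less, of d] show ?thesis
    unfolding kernel_row_sum_0[OF symmetric_table_ww assms] periodic_def n_def div_mod_6_int .
qed

lemma column_table_ww: "kernel table_ww 0 (int d) 0 = 0"
proof -
  have "\<forall>r<6. table_ww ! r ! 0 * x ^ 0 + table_ww ! 0 ! r * 0 ^ 0 + table_ww ! ((12 - r) mod 6) ! r * (- x) ^ 0 = 0" for x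
    by (simp add: all_less_6 table_ww_def)
  then show ?thesis
    unfolding kernel_column periodic_def by (simp only: nat_mod_6_less)
qed

text \<open>
  This kernel and the next one are of degree 1: they express that \<open>V\<close> and \<open>W\<close> are
  eta quotients, so that \<open>\<theta> V / V\<close> and \<open>\<theta> W / W\<close> are Lambert series.
\<close>

definition table_ve :: "int list list" where
  "table_ve = [[0, 0, 0, 0, 0, 0],
    [- 3, 2, 1, 1, 2, - 3],
    [0, - 2, 0, - 2, 0, 4],
    [0, 1, 1, 0, - 1, - 1],
    [0, - 4, 0, 2, 0, 2],
    [3, 3, - 2, - 1, - 1, - 2]]"

lemma symmetric_table_ve: "symmetric_table table_ve 1"
  by (simp add: symmetric_table_def all_less_6 table_ve_def)

lemma diff_table_ve: "(kernel table_ve 1 (int a) (int b) - kernel table_ve 1 (int a) (- int b)) =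
    3 * (periodic coef_v 0 a * periodic coef_e 1 b) + 3 * (periodic coef_e 1 a * periodic coef_v 0 b)"
proof -
  have "\<forall>i<6. \<forall>j<6. ((table_ve ! i ! j * x ^ 1 + table_ve ! j ! i * y ^ 1 + table_ve ! ((12 - i - j) mod 6) ! i * (- x - y) ^ 1)
    - (table_ve ! i ! ((6 - j) mod 6) * x ^ 1 + table_ve ! ((6 - j) mod 6) ! i * (- y) ^ 1
        + table_ve ! ((12 - i - (6 - j) mod 6) mod 6) ! i * (- x + y) ^ 1)) =
    3 * (coef_v ! i * x ^ 0 * (coef_e ! j * y ^ 1)) + 3 * (coef_e ! i * x ^ 1 * (coef_v ! j * y ^ 0))" for x y
    by (simp add: all_less_6 table_ve_def algebra_simps)
  then show ?thesis
    unfolding kernel_diff periodic_def by (simp only: nat_mod_6_less)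
qed

lemma row_table_ve:
  assumes "0 < d"
  shows "(\<Sum>a = 1..<d. kernel table_ve 1 (int a) (- int d)) = - 2 * periodic coef_e 1 d + 6 * int d * periodic coef_v 0 d"
proof -
  define n where "n = int (d div 6)"
  have "\<forall>r<6. (2 * ((\<Sum>i<6. table_ve ! i ! ((6 - r) mod 6) * (3 * n * (n - 1) + int i * n))
          + (\<Sum>i<r. table_ve ! i ! ((6 - r) mod 6) * (6 * n + int i)))
     + (6 * n + int r) * (n * (\<Sum>i<6. table_ve ! r ! ((6 - i) mod 6)) + (\<Sum>i<r. table_ve ! r ! ((6 - i) mod 6)))
     - (6 * n + int r) * table_ve ! r ! 0) =
     - 2 * (coef_e ! r * (6 * n + int r) ^ 1) + 6 * (6 * n + int r) * (coef_v ! r * (6 * n + int r) ^ 0)"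
    by (simp add: all_less_6 sum_less_6 table_ve_def algebra_simps)
  from this[rule_format, OF nat_mod_6_less, of d] show ?thesis
    unfolding kernel_row_sum_1[OF symmetric_table_ve assms] periodic_def n_def div_mod_6_int .
qed

lemma column_table_ve: "kernel table_ve 1 (int d) 0 = int d * (- 6 * periodic coef_v 0 d)"
proof -
  have "\<forall>r<6. table_ve ! r ! 0 * x ^ 1 + table_ve ! 0 ! r * 0 ^ 1 + table_ve ! ((12 - r) mod 6) ! r * (- x) ^ 1 = x * (- 6 * (coef_v ! r * x ^ 0))" for x
    by (simp add: all_less_6 table_ve_def)
  then show ?thesis
    unfolding kernel_column periodic_def by (simp only: nat_mod_6_less)
qed

definition table_wf :: "int list list" where
  "table_wf = [[0, 0, 0, 0, 0, 0],
    [- 3, - 2, 5, 5, - 2, - 3],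
    [6, - 4, 0, - 4, 6, - 4],
    [0, - 1, - 1, 0, 1, 1],
    [- 6, 4, - 6, 4, 0, 4],
    [3, 3, 2, - 5, - 5, 2]]"

lemma symmetric_table_wf: "symmetric_table table_wf 1"
  by (simp add: symmetric_table_def all_less_6 table_wf_def)

lemma diff_table_wf: "(kernel table_wf 1 (int a) (int b) - kernel table_wf 1 (int a) (- int b)) =
    3 * (periodic coef_w 0 a * periodic coef_f 1 b) + 3 * (periodic coef_f 1 a * periodic coef_w 0 b)"
proof -
  have "\<forall>i<6. \<forall>j<6. ((table_wf ! i ! j * x ^ 1 + table_wf ! j ! i * y ^ 1 + table_wf ! ((12 - i - j) mod 6) ! i * (- x - y) ^ 1)
    - (table_wf ! i ! ((6 - j) mod 6) * x ^ 1 + table_wf ! ((6 - j) mod 6) ! i * (- y) ^ 1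
        + table_wf ! ((12 - i - (6 - j) mod 6) mod 6) ! i * (- x + y) ^ 1)) =
    3 * (coef_w ! i * x ^ 0 * (coef_f ! j * y ^ 1)) + 3 * (coef_f ! i * x ^ 1 * (coef_w ! j * y ^ 0))" for x y
    by (simp add: all_less_6 table_wf_def algebra_simps)
  then show ?thesis
    unfolding kernel_diff periodic_def by (simp only: nat_mod_6_less)
qed

lemma row_table_wf:
  assumes "0 < d"
  shows "(\<Sum>a = 1..<d. kernel table_wf 1 (int a) (- int d)) = - 6 * periodic coef_w 0 d + 6 * int d * periodic coef_w 0 d"
proof -
  define n where "n = int (d div 6)"
  have "\<forall>r<6. (2 * ((\<Sum>i<6. table_wf ! i ! ((6 - r) mod 6) * (3 * n * (n - 1) + int i * n))
          + (\<Sum>i<r. table_wf ! i ! ((6 - r) mod 6) * (6 * n + int i)))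
     + (6 * n + int r) * (n * (\<Sum>i<6. table_wf ! r ! ((6 - i) mod 6)) + (\<Sum>i<r. table_wf ! r ! ((6 - i) mod 6)))
     - (6 * n + int r) * table_wf ! r ! 0) =
     - 6 * (coef_w ! r * (6 * n + int r) ^ 0) + 6 * (6 * n + int r) * (coef_w ! r * (6 * n + int r) ^ 0)"
    by (simp add: all_less_6 sum_less_6 table_wf_def algebra_simps)
  from this[rule_format, OF nat_mod_6_less, of d] show ?thesis
    unfolding kernel_row_sum_1[OF symmetric_table_wf assms] periodic_def n_def div_mod_6_int .
qed

lemma column_table_wf: "kernel table_wf 1 (int d) 0 = int d * (- 6 * periodic coef_w 0 d)"
proof -
  have "\<forall>r<6. table_wf ! r ! 0 * x ^ 1 + table_wf ! 0 ! r * 0 ^ 1 + table_wf ! ((12 - r) mod 6) ! r * (- x) ^ 1 = x * (- 6 * (coef_w ! r * x ^ 0))" for x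
    by (simp add: all_less_6 table_wf_def)
  then show ?thesis
    unfolding kernel_column periodic_def by (simp only: nat_mod_6_less)
qed

text \<open>
  This kernel of degree 2 gives the analogue for level 6 of Ramanujan's formula for the derivative of the
  quasimodular Eisenstein series of weight 2.
\<close>

definition table_ee :: "int list list" where
  "table_ee = [[2, 1, - 3, 2, - 3, 1],
    [- 3, 2, 3, 3, 2, - 3],
    [3, - 3, 0, - 3, 3, - 4],
    [- 2, 1, 1, - 2, 1, 1],
    [3, - 4, 3, - 3, 0, - 3],
    [- 3, - 3, 2, 3, 3, 2]]"

lemma symmetric_table_ee: "symmetric_table table_ee 2"
  by (simp add: symmetric_table_def all_less_6 table_ee_def)

lemma diff_table_ee: "(kernel table_ee 2 (int a) (int b) - kernel table_ee 2 (int a) (- int b)) =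
    2 * (periodic coef_e 1 a * periodic coef_e 1 b) + (periodic coef_g 1 a * periodic coef_d 1 b) + (periodic coef_d 1 a * periodic coef_g 1 b)"
proof -
  have "\<forall>i<6. \<forall>j<6. ((table_ee ! i ! j * x ^ 2 + table_ee ! j ! i * y ^ 2 + table_ee ! ((12 - i - j) mod 6) ! i * (- x - y) ^ 2)
    - (table_ee ! i ! ((6 - j) mod 6) * x ^ 2 + table_ee ! ((6 - j) mod 6) ! i * (- y) ^ 2
        + table_ee ! ((12 - i - (6 - j) mod 6) mod 6) ! i * (- x + y) ^ 2)) =
    2 * (coef_e ! i * x ^ 1 * (coef_e ! j * y ^ 1)) + (coef_g ! i * x ^ 1 * (coef_d ! j * y ^ 1)) + (coef_d ! i * x ^ 1 * (coef_g ! j * y ^ 1))" for x y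
    by (simp add: all_less_6 table_ee_def power2_eq_square algebra_simps)
  then show ?thesis
    unfolding kernel_diff periodic_def by (simp only: nat_mod_6_less)
qed

lemma row_table_ee:
  assumes "0 < d"
  shows "(\<Sum>a = 1..<d. kernel table_ee 2 (int a) (- int d)) = - 2 * periodic coef_g 1 d + 2 * int d * periodic coef_e 1 d"
proof -
  define n where "n = int (d div 6)"
  have "\<forall>r<6. (2 * ((\<Sum>i<6. table_ee ! i ! ((6 - r) mod 6) * (6 * n * (n - 1) * (2 * n - 1) + 6 * int i * n * (n - 1) + int i ^ 2 * n))
          + (\<Sum>i<r. table_ee ! i ! ((6 - r) mod 6) * (6 * n + int i) ^ 2))
     + (6 * n + int r) ^ 2 * (n * (\<Sum>i<6. table_ee ! r ! ((6 - i) mod 6)) + (\<Sum>i<r. table_ee ! r ! ((6 - i) mod 6)))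
     - (6 * n + int r) ^ 2 * table_ee ! r ! 0) =
     - 2 * (coef_g ! r * (6 * n + int r) ^ 1) + 2 * (6 * n + int r) * (coef_e ! r * (6 * n + int r) ^ 1)"
    by (simp add: all_less_6 sum_less_6 table_ee_def algebra_simps power2_eq_square)
  from this[rule_format, OF nat_mod_6_less, of d] show ?thesis
    unfolding kernel_row_sum_2[OF symmetric_table_ee assms] periodic_def n_def div_mod_6_int .
qed

lemma column_table_ee: "kernel table_ee 2 (int d) 0 = int d * (- 2 * periodic coef_e 1 d)"
proof -
  have "\<forall>r<6. table_ee ! r ! 0 * x ^ 2 + table_ee ! 0 ! r * 0 ^ 2 + table_ee ! ((12 - r) mod 6) ! r * (- x) ^ 2 = x * (- 2 * (coef_e ! r * x ^ 1))" for x
    by (simp add: all_less_6 table_ee_def power2_eq_square)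
  then show ?thesis
    unfolding kernel_column periodic_def by (simp only: nat_mod_6_less)
qed

section \<open>Differential equations for Eisenstein series of level 6\<close>

lemma lambert_series_cong: "(\<And>d. 0 < d \<Longrightarrow> g d = h d) \<Longrightarrow> lambert_series g = lambert_series h"
  by (rule fps_ext) (auto simp: lambert_series_nth dvd_pos_nat intro!: sum.cong)

lemma lambert_series_linear:
  "lambert_series (\<lambda>d. g d + h d) = lambert_series g + lambert_series h"
  "lambert_series (\<lambda>d. g d - h d) = lambert_series g - lambert_series h"
  "lambert_series (\<lambda>d. - g d) = - lambert_series g"
  "lambert_series (\<lambda>d. numeral k * g d) = numeral k * lambert_series g"
  "lambert_series (\<lambda>d. 0) = 0"
  by (rule fps_ext; simp add: lambert_series_nth sum.distrib sum_subtractf sum_negf sum_distrib_left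
        numeral_fps_const)+

definition quad_series :: "(nat \<Rightarrow> nat \<Rightarrow> int) \<Rightarrow> int fps" where
  "quad_series F = Abs_fps (\<lambda>N. \<Sum>(a, m, b, n)\<in>quads N. F a b)"

lemma quad_series_linear:
  "quad_series (\<lambda>a b. F a b + G a b) = quad_series F + quad_series G"
  "quad_series (\<lambda>a b. numeral k * F a b) = numeral k * quad_series F"
  by (rule fps_ext; simp add: quad_series_def sum.distrib sum_distrib_left case_prod_unfold numeral_fps_const)+

lemma quad_series_mult: "quad_series (\<lambda>a b. g a * h b) = lambert_series g * lambert_series h"
  by (rule fps_ext) (simp add: quad_series_def lambert_series_mult_nth)

lemma quad_series_kernel:
  assumes "symmetric_table T p"
    and "\<And>d. 0 < d \<Longrightarrow> (\<Sum>a = 1..<d. kernel T p (int a) (- int d)) + int d * u d = s d"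
    and "\<And>d. 0 < d \<Longrightarrow> kernel T p (int d) 0 = int d * u d"
  shows "quad_series (\<lambda>a b. kernel T p (int a) (int b) - kernel T p (int a) (- int b)) = lambert_series s - theta (lambert_series u)"
  unfolding quad_series_def by (rule kernel_lambert[OF assms])

definition periodic_lambert :: "int list \<Rightarrow> nat \<Rightarrow> int fps" where
  "periodic_lambert c p = lambert_series (periodic c p)"

lemma theta_linear:
  fixes f g :: "'a :: comm_ring_1 fps"
  shows "theta (f + g) = theta f + theta g" "theta (f - g) = theta f - theta g"
    "theta (- f) = - theta f" "theta (numeral k * f) = numeral k * theta f" "theta 0 = 0" "theta 1 = 0"
    "theta (fps_const c * f) = fps_const c * theta f"
  by (rule fps_ext; simp add: algebra_simps numeral_fps_const)+

lemma theta_mult: "theta (f * g) = f * theta g + theta f * (g :: 'a :: comm_ring_1 fps)"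
  by (simp add: theta_def algebra_simps)

lemma product_vv: "6 * (periodic_lambert coef_v 0 * periodic_lambert coef_v 0) = periodic_lambert [0, 4, 3, 4, 3, 4] 1 - 4 * periodic_lambert coef_v 0"
proof -
  let ?r = "\<lambda>d. \<Sum>a = 1..<d. kernel table_vv 0 (int a) (- int d)"
  have "quad_series (\<lambda>a b. kernel table_vv 0 (int a) (int b) - kernel table_vv 0 (int a) (- int b)) = lambert_series ?r - theta (lambert_series (\<lambda>d. 0))"
    by (rule quad_series_kernel[OF symmetric_table_vv]) (simp_all add: column_table_vv)
  then have "3 * (periodic_lambert coef_v 0 * periodic_lambert coef_v 0) = lambert_series ?r"
    unfolding diff_table_vv by (simp only: quad_series_linear quad_series_mult lambert_series_linear theta_linear periodic_lambert_def diff_0_right)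
  moreover have "2 * lambert_series ?r = lambert_series (\<lambda>d. periodic [0, 4, 3, 4, 3, 4] 1 d - 4 * periodic coef_v 0 d)"
    unfolding lambert_series_linear(4)[symmetric] by (rule lambert_series_cong) (rule row_table_vv)
  ultimately have "2 * (3 * (periodic_lambert coef_v 0 * periodic_lambert coef_v 0)) = periodic_lambert [0, 4, 3, 4, 3, 4] 1 - 4 * periodic_lambert coef_v 0"
    by (simp only: periodic_lambert_def lambert_series_linear)
  then show ?thesis
    by simp
qed

lemma product_vw: "6 * (periodic_lambert coef_v 0 * periodic_lambert coef_w 0) = periodic_lambert [0, 2, 1, 0, 1, 2] 1 - 2 * periodic_lambert coef_w 0"
proof -
  let ?r = "\<lambda>d. \<Sum>a = 1..<d. kernel table_vw 0 (int a) (- int d)"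
  have "2 * quad_series (\<lambda>a b. kernel table_vw 0 (int a) (int b) - kernel table_vw 0 (int a) (- int b))
      = 2 * (lambert_series ?r - theta (lambert_series (\<lambda>d. 0)))"
    by (rule arg_cong[OF quad_series_kernel[OF symmetric_table_vw]]) (simp_all add: column_table_vw)
  then have "6 * (periodic_lambert coef_v 0 * periodic_lambert coef_w 0) = 2 * lambert_series ?r"
    unfolding quad_series_linear(2)[symmetric] diff_table_vw
    by (simp only: quad_series_linear quad_series_mult lambert_series_linear theta_linear periodic_lambert_def diff_0_right) (simp add: mult.commute)
  moreover have "2 * lambert_series ?r = lambert_series (\<lambda>d. periodic [0, 2, 1, 0, 1, 2] 1 d - 2 * periodic coef_w 0 d)"
    unfolding lambert_series_linear(4)[symmetric] by (rule lambert_series_cong) (rule row_table_vw)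
  ultimately show ?thesis
    by (simp add: periodic_lambert_def lambert_series_linear)
qed

lemma product_ww: "6 * (periodic_lambert coef_w 0 * periodic_lambert coef_w 0) = periodic_lambert [0, 0, 3, - 4, 3, 0] 1"
proof -
  let ?r = "\<lambda>d. \<Sum>a = 1..<d. kernel table_ww 0 (int a) (- int d)"
  have "quad_series (\<lambda>a b. kernel table_ww 0 (int a) (int b) - kernel table_ww 0 (int a) (- int b)) = lambert_series ?r - theta (lambert_series (\<lambda>d. 0))"
    by (rule quad_series_kernel[OF symmetric_table_ww]) (simp_all add: column_table_ww)
  then have "3 * (periodic_lambert coef_w 0 * periodic_lambert coef_w 0) = lambert_series ?r"
    unfolding diff_table_ww by (simp only: quad_series_linear quad_series_mult lambert_series_linear theta_linear periodic_lambert_def diff_0_right)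
  moreover have "2 * lambert_series ?r = lambert_series (periodic [0, 0, 3, - 4, 3, 0] 1)"
    unfolding lambert_series_linear(4)[symmetric] by (rule lambert_series_cong) (rule row_table_ww)
  ultimately have "2 * (3 * (periodic_lambert coef_w 0 * periodic_lambert coef_w 0)) = periodic_lambert [0, 0, 3, - 4, 3, 0] 1"
    by (simp only: periodic_lambert_def lambert_series_linear)
  then show ?thesis
    by simp
qed

lemma product_ve: "3 * (periodic_lambert coef_v 0 * periodic_lambert coef_e 1) = 3 * theta (periodic_lambert coef_v 0) - periodic_lambert coef_e 1"
proof -
  have "quad_series (\<lambda>a b. kernel table_ve 1 (int a) (int b) - kernel table_ve 1 (int a) (- int b))
     = lambert_series (\<lambda>d. - 2 * periodic coef_e 1 d) - theta (lambert_series (\<lambda>d. - 6 * periodic coef_v 0 d))"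
    by (rule quad_series_kernel[OF symmetric_table_ve]) (simp_all add: column_table_ve row_table_ve del: One_nat_def)
  then have "2 * (3 * (periodic_lambert coef_v 0 * periodic_lambert coef_e 1)) = 2 * (3 * theta (periodic_lambert coef_v 0) - periodic_lambert coef_e 1)"
    unfolding diff_table_ve quad_series_linear quad_series_mult periodic_lambert_def minus_mult_left[symmetric] lambert_series_linear theta_linear
    by (simp add: algebra_simps)
  then show ?thesis
    by (subst (asm) mult_cancel_left) simp
qed

lemma product_wf: "periodic_lambert coef_w 0 * periodic_lambert coef_f 1 = theta (periodic_lambert coef_w 0) - periodic_lambert coef_w 0"
proof -
  have "quad_series (\<lambda>a b. kernel table_wf 1 (int a) (int b) - kernel table_wf 1 (int a) (- int b))
     = lambert_series (\<lambda>d. - 6 * periodic coef_w 0 d) - theta (lambert_series (\<lambda>d. - 6 * periodic coef_w 0 d))"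
    by (rule quad_series_kernel[OF symmetric_table_wf]) (simp_all add: column_table_wf row_table_wf del: One_nat_def)
  then have "6 * (periodic_lambert coef_w 0 * periodic_lambert coef_f 1) = 6 * (theta (periodic_lambert coef_w 0) - periodic_lambert coef_w 0)"
    unfolding diff_table_wf quad_series_linear quad_series_mult periodic_lambert_def minus_mult_left[symmetric] lambert_series_linear theta_linear
    by (simp add: algebra_simps)
  then show ?thesis
    by (subst (asm) mult_cancel_left) simp
qed

lemma product_ee: "periodic_lambert coef_e 1 * periodic_lambert coef_e 1 + periodic_lambert coef_g 1 * periodic_lambert coef_d 1 = theta (periodic_lambert coef_e 1) - periodic_lambert coef_g 1"
proof -
  have "quad_series (\<lambda>a b. kernel table_ee 2 (int a) (int b) - kernel table_ee 2 (int a) (- int b))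
     = lambert_series (\<lambda>d. - 2 * periodic coef_g 1 d) - theta (lambert_series (\<lambda>d. - 2 * periodic coef_e 1 d))"
    by (rule quad_series_kernel[OF symmetric_table_ee]) (simp_all add: column_table_ee row_table_ee del: One_nat_def)
  then have "2 * (periodic_lambert coef_e 1 * periodic_lambert coef_e 1 + periodic_lambert coef_g 1 * periodic_lambert coef_d 1) = 2 * (theta (periodic_lambert coef_e 1) - periodic_lambert coef_g 1)"
    unfolding diff_table_ee quad_series_linear quad_series_mult periodic_lambert_def minus_mult_left[symmetric] lambert_series_linear theta_linear
    by (simp add: algebra_simps)
  then show ?thesis
    by (subst (asm) mult_cancel_left) simp
qed

text \<open>
  Two Eisenstein series of weight 1 for the character modulo 3.  They are the eta quotients
  \<open>\<eta>\<^sub>2\<^sup>6 \<eta>\<^sub>3 / (\<eta>\<^sub>1\<^sup>3 \<eta>\<^sub>6\<^sup>2)\<close> and \<open>\<eta>\<^sub>1 \<eta>\<^sub>6\<^sup>6 / (\<eta>\<^sub>2\<^sup>2 \<eta>\<^sub>3\<^sup>3)\<close>, where \<open>\<eta>\<^sub>k = \<eta>(k\<tau>)\<close>, and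
  vanish at one cusp each; the other two cusps belong to \<open>V - W\<close> and \<open>V - 9 W\<close>.
\<close>

definition eis_V :: "int fps" where "eis_V = 1 + 3 * periodic_lambert coef_v 0"
definition eis_W :: "int fps" where "eis_W = periodic_lambert coef_w 0"
text \<open>
  The logarithmic derivatives of \<open>V\<close> and of the generating function of \<open>tbar\<close>, as
  \<open>theta_eis_V\<close> and \<open>theta_tbar\<close> show.
\<close>

definition dlog_V :: "int fps" where "dlog_V = periodic_lambert coef_e 1"
definition dlog_tbar :: "int fps" where "dlog_tbar = periodic_lambert [1, 1, 2, 0, 2, 1] 1"

lemma lambert_series_eq_0I:
  assumes "\<forall>r<6. \<forall>x. f r x = 0" and "\<And>d. g d = f (d mod 6) (int d)"
  shows "lambert_series g = 0"
  using lambert_series_cong[of g "\<lambda>d. 0"] assms by (simp add: lambert_series_linear)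

text \<open>
  Lambert series of equal weight are compared through their six coefficients.
\<close>

lemma periodic_lambert_relations:
  "3 * periodic_lambert [0, 4, 3, 4, 3, 4] 1 - 10 * periodic_lambert [0, 2, 1, 0, 1, 2] 1 + 3 * periodic_lambert [0, 0, 3, - 4, 3, 0] 1
     = 2 * periodic_lambert coef_d 1"
  "2 * (2 * dlog_tbar + dlog_V) = 5 * periodic_lambert [0, 2, 1, 0, 1, 2] 1 - periodic_lambert [0, 0, 3, - 4, 3, 0] 1"
  "2 * periodic_lambert coef_g 1 = 3 * periodic_lambert [0, 2, 1, 0, 1, 2] 1 - 3 * periodic_lambert [0, 0, 3, - 4, 3, 0] 1"
  "periodic_lambert coef_f 1 = dlog_V + periodic_lambert coef_d 1"
proof -
  have "\<forall>r<6. \<forall>x. 3 * ([0, 4, 3, 4, 3, 4] ! r * x ^ 1) - 10 * ([0, 2, 1, 0, 1, 2] ! r * x ^ 1)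
      + 3 * ([0, 0, 3, - 4, 3, 0] ! r * x ^ 1) - 2 * (coef_d ! r * x ^ 1) = (0 :: int)"
    by (simp add: all_less_6)
  from lambert_series_eq_0I[OF this refl]
  show "3 * periodic_lambert [0, 4, 3, 4, 3, 4] 1 - 10 * periodic_lambert [0, 2, 1, 0, 1, 2] 1 + 3 * periodic_lambert [0, 0, 3, - 4, 3, 0] 1
     = 2 * periodic_lambert coef_d 1"
    unfolding periodic_lambert_def periodic_def lambert_series_linear by simp
  have "\<forall>r<6. \<forall>x. 2 * (2 * ([1, 1, 2, 0, 2, 1] ! r * x ^ 1) + coef_e ! r * x ^ 1)
     - (5 * ([0, 2, 1, 0, 1, 2] ! r * x ^ 1) - [0, 0, 3, - 4, 3, 0] ! r * x ^ 1) = (0 :: int)"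
    by (simp add: all_less_6)
  from lambert_series_eq_0I[OF this refl]
  show "2 * (2 * dlog_tbar + dlog_V) = 5 * periodic_lambert [0, 2, 1, 0, 1, 2] 1 - periodic_lambert [0, 0, 3, - 4, 3, 0] 1"
    unfolding periodic_lambert_def periodic_def lambert_series_linear dlog_tbar_def dlog_V_def by simp
  have "\<forall>r<6. \<forall>x. 2 * (coef_g ! r * x ^ 1)
     - (3 * ([0, 2, 1, 0, 1, 2] ! r * x ^ 1) - 3 * ([0, 0, 3, - 4, 3, 0] ! r * x ^ 1)) = (0 :: int)"
    by (simp add: all_less_6)
  from lambert_series_eq_0I[OF this refl]
  show "2 * periodic_lambert coef_g 1 = 3 * periodic_lambert [0, 2, 1, 0, 1, 2] 1 - 3 * periodic_lambert [0, 0, 3, - 4, 3, 0] 1"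
    unfolding periodic_lambert_def periodic_def lambert_series_linear by simp
  have "\<forall>r<6. \<forall>x. coef_f ! r * x ^ 1 - (coef_e ! r * x ^ 1 + coef_d ! r * x ^ 1) = (0 :: int)"
    by (simp add: all_less_6)
  from lambert_series_eq_0I[OF this refl]
  show "periodic_lambert coef_f 1 = dlog_V + periodic_lambert coef_d 1"
    unfolding periodic_lambert_def periodic_def lambert_series_linear dlog_V_def by simp
qed

lemma two_times_cancel: "2 * f = 2 * g \<Longrightarrow> f = (g :: int fps)"
  by (subst (asm) mult_cancel_left) simp

text \<open>
  The difference of the logarithmic derivatives of \<open>W\<close> and \<open>V\<close>: it has weight 2 and vanishes at the
  two cusps at which neither \<open>V\<close> nor \<open>W\<close> vanishes.
\<close>

lemma weight_two_lambert: "(eis_V - eis_W) * (eis_V - 9 * eis_W) = 1 + periodic_lambert coef_d 1"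
proof (rule two_times_cancel)
  have "2 * ((eis_V - eis_W) * (eis_V - 9 * eis_W)) = 2 + 12 * periodic_lambert coef_v 0 + 3 * (6 * (periodic_lambert coef_v 0 * periodic_lambert coef_v 0))
      - 20 * eis_W - 10 * (6 * (periodic_lambert coef_v 0 * periodic_lambert coef_w 0)) + 3 * (6 * (periodic_lambert coef_w 0 * periodic_lambert coef_w 0))"
    by (simp add: eis_V_def eis_W_def algebra_simps)
  also have "\<dots> = 2 + (3 * periodic_lambert [0, 4, 3, 4, 3, 4] 1 - 10 * periodic_lambert [0, 2, 1, 0, 1, 2] 1
      + 3 * periodic_lambert [0, 0, 3, - 4, 3, 0] 1)"
    unfolding product_vv product_vw product_ww by (simp add: eis_W_def algebra_simps)
  also have "\<dots> = 2 * (1 + periodic_lambert coef_d 1)"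
    unfolding periodic_lambert_relations by (simp only: distrib_left mult_1_right)
  finally show "2 * ((eis_V - eis_W) * (eis_V - 9 * eis_W)) = 2 * (1 + periodic_lambert coef_d 1)" .
qed

lemma theta_eis_V: "theta eis_V = eis_V * dlog_V"
  using product_ve by (simp add: eis_V_def dlog_V_def theta_linear algebra_simps)

lemma theta_eis_W: "theta eis_W = eis_W * (dlog_V + (eis_V - eis_W) * (eis_V - 9 * eis_W))"
  using product_wf unfolding periodic_lambert_relations(4) weight_two_lambert by (simp add: eis_W_def algebra_simps)

lemma dlog_tbar_eq: "2 * dlog_tbar + dlog_V = 5 * (eis_V * eis_W) - 3 * eis_W ^ 2"
proof (rule two_times_cancel)
  have "2 * (5 * (eis_V * eis_W) - 3 * eis_W ^ 2) = 10 * eis_W + 5 * (6 * (periodic_lambert coef_v 0 * periodic_lambert coef_w 0)) - 6 * (periodic_lambert coef_w 0 * periodic_lambert coef_w 0)"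
    by (simp add: eis_V_def eis_W_def power2_eq_square algebra_simps)
  then show "2 * (2 * dlog_tbar + dlog_V) = 2 * (5 * (eis_V * eis_W) - 3 * eis_W ^ 2)"
    unfolding product_vw product_ww periodic_lambert_relations by (simp add: eis_W_def algebra_simps)
qed

text \<open>
  The second order information: \<open>\<theta> E - E\<^sup>2\<close> is a modular form of weight 4 for \<open>E = \<theta> V / V\<close>, which
  amounts to a linear differential equation of order two for \<open>V\<close> as a function of \<open>W / V\<close>.
\<close>

lemma theta_dlog_V: "theta dlog_V = dlog_V ^ 2 + 3 * eis_W * (eis_V - 3 * eis_W) * ((eis_V - eis_W) * (eis_V - 9 * eis_W))"
proof -
  have "2 * (3 * eis_W * (eis_V - 3 * eis_W)) = 6 * eis_W + 3 * (6 * (periodic_lambert coef_v 0 * periodic_lambert coef_w 0)) - 3 * (6 * (periodic_lambert coef_w 0 * periodic_lambert coef_w 0))"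
    by (simp add: eis_V_def eis_W_def algebra_simps)
  then have "2 * (3 * eis_W * (eis_V - 3 * eis_W)) = 2 * periodic_lambert coef_g 1"
    unfolding product_vw product_ww periodic_lambert_relations by (simp add: eis_W_def algebra_simps)
  from two_times_cancel[OF this] show ?thesis
    using product_ee unfolding weight_two_lambert dlog_V_def by (simp add: power2_eq_square algebra_simps)
qed

section \<open>The generating function and the congruence modulo 3\<close>

text \<open>
  The logarithmic derivative of \<open>1 / (1 - q\<^sup>m)\<close>.
\<close>

definition geo :: "nat \<Rightarrow> int fps" where
  "geo m = Abs_fps (\<lambda>n. if 0 < n \<and> m dvd n then int m else 0)"

lemma theta_one_minus_X_power:
  assumes "0 < m"
  shows "theta (1 - fps_X ^ m) = - ((1 - fps_X ^ m) * geo m)"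
proof (rule fps_ext)
  fix n
  have "(fps_X ^ m * geo m) $ n = (if n < m then 0 else geo m $ (n - m))"
    by (simp add: fps_X_power_mult_nth)
  moreover have "m dvd n - m \<longleftrightarrow> m dvd n" if "m \<le> n"
    using that by (simp add: dvd_minus_self)
  moreover have "\<not> m dvd n" if "0 < n" "n < m"
    using that by (simp add: nat_dvd_not_less)
  ultimately show "theta (1 - fps_X ^ m) $ n = (- ((1 - fps_X ^ m) * geo m)) $ n"
    using assms by (auto simp: geo_def fps_X_power_nth left_diff_distrib)
qed

lemma theta_tbar_factor:
  assumes "0 < j"
  shows "theta (tbar_factor j) = tbar_factor j * (geo (2 * j) + geo j - geo (3 * j))"
proof -
  define D :: "int fps" where "D = (1 - fps_X ^ (2 * j)) * (1 - fps_X ^ j)"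
  have eq: "tbar_factor j * D = 1 - fps_X ^ (3 * j)"
    unfolding D_def by (rule tbar_factor_mult) (use assms in simp)
  have D: "theta D = - (D * (geo (2 * j) + geo j))"
    unfolding D_def theta_mult using assms by (simp add: theta_one_minus_X_power algebra_simps)
  have "theta (tbar_factor j * D) = - (tbar_factor j * D * geo (3 * j))"
    unfolding eq by (rule theta_one_minus_X_power) (use assms in simp)
  then have "D * theta (tbar_factor j) = D * (tbar_factor j * (geo (2 * j) + geo j - geo (3 * j)))"
    unfolding theta_mult D by (simp add: algebra_simps)
  moreover have "D $ 0 = 1"
    using assms by (simp add: D_def)
  then have "D \<noteq> 0" by auto
  ultimately show ?thesis
    by simp
qed

lemma theta_tbar_partial_prod:
  "theta (\<Prod>k<N. tbar_factor (Suc k)) =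
     (\<Prod>k<N. tbar_factor (Suc k)) * (\<Sum>j = 1..N. geo (2 * j) + geo j - geo (3 * j))"
proof (induction N)
  case (Suc N)
  then show ?case
    by (simp add: theta_mult theta_tbar_factor algebra_simps)
qed (simp add: theta_linear)

lemma sum_geo_nth:
  assumes "0 < c" "0 < n" "n \<le> N"
  shows "(\<Sum>j = 1..N. geo (c * j) $ n) = (\<Sum>a | a dvd n. if c dvd a then int a else 0)"
proof -
  have "(\<Sum>j = 1..N. geo (c * j) $ n) = (\<Sum>j | j \<in> {1..N} \<and> c * j dvd n. int (c * j))"
    using assms by (subst sum.inter_filter) (auto simp: geo_def intro!: sum.cong)
  also have "\<dots> = (\<Sum>a | a \<in> {a. a dvd n} \<and> c dvd a. int a)"
  proof (rule sum.reindex_bij_witness[where i = "\<lambda>a. a div c" and j = "\<lambda>j. c * j"])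
    fix a assume "a \<in> {a. a \<in> {a. a dvd n} \<and> c dvd a}"
    then obtain j where j: "a = c * j" "c * j dvd n" by (auto elim: dvdE)
    with assms have "0 < j" by (auto intro!: Nat.gr0I)
    moreover have "j \<le> N"
      using dvd_imp_le[of j n] dvd_mult_right[OF j(2)] assms by simp
    ultimately show "a div c \<in> {j. j \<in> {1..N} \<and> c * j dvd n}" "c * (a div c) = a"
      using j assms by simp_all
  qed (use assms in auto)
  also have "\<dots> = (\<Sum>a | a dvd n. if c dvd a then int a else 0)"
    using assms by (subst sum.inter_filter) auto
  finally show ?thesis .
qed

lemma dlog_tbar_nth:
  assumes "n \<le> N"
  shows "(\<Sum>j = 1..N. geo (2 * j) + geo j - geo (3 * j)) $ n = dlog_tbar $ n"
proof (cases "n = 0")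
  case False
  have dlog_periodic: "periodic [1, 1, 2, 0, 2, 1] 1 a =
      (if 2 dvd a then int a else 0) + (if 1 dvd a then int a else 0) - (if 3 dvd a then int a else 0)" for a
  proof -
    have "\<forall>r<6. \<forall>x. [1, 1, 2, 0, 2, 1] ! r * x ^ 1 =
        (if 2 dvd r then x else 0) + x - (if 3 dvd r then x else (0 :: int))"
      by (simp add: all_less_6)
    moreover have "2 dvd a mod 6 \<longleftrightarrow> 2 dvd a" "3 dvd a mod 6 \<longleftrightarrow> 3 dvd a"
      by (simp_all add: dvd_mod_iff)
    ultimately show ?thesis
      using nat_mod_6_less[of a] by (simp add: periodic_def del: power_one_right)
  qed
  have "(\<Sum>j = 1..N. geo (2 * j) + geo j - geo (3 * j)) $ n =
      (\<Sum>j = 1..N. geo (2 * j) $ n) + (\<Sum>j = 1..N. geo (1 * j) $ n) - (\<Sum>j = 1..N. geo (3 * j) $ n)"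
    by (simp add: fps_sum_nth sum.distrib sum_subtractf)
  also have "\<dots> = dlog_tbar $ n"
    using False assms unfolding dlog_tbar_def periodic_lambert_def lambert_series_nth dlog_periodic
    by (subst (1 2 3) sum_geo_nth) (simp_all add: sum.distrib sum_subtractf)
  finally show ?thesis .
qed (simp add: fps_sum_nth geo_def dlog_tbar_def periodic_lambert_def lambert_series_nth)

text \<open>
  Logarithmic differentiation of the product.
\<close>

lemma theta_tbar: "theta tbar_gf = tbar_gf * dlog_tbar"
proof (rule fps_ext)
  fix n
  have "theta tbar_gf $ n = theta (\<Prod>k<n. tbar_factor (Suc k)) $ n"
    by (simp add: tbar_eq_partial_prod[of n n, unfolded tbar_def])
  also have "\<dots> = (\<Sum>i = 0..n. (\<Prod>k<n. tbar_factor (Suc k)) $ i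
      * (\<Sum>j = 1..n. geo (2 * j) + geo j - geo (3 * j)) $ (n - i))"
    unfolding theta_tbar_partial_prod by (simp only: fps_mult_nth)
  also have "\<dots> = (\<Sum>i = 0..n. tbar_gf $ i * dlog_tbar $ (n - i))"
    by (intro sum.cong refl arg_cong2[of _ _ _ _ "(*)"] dlog_tbar_nth)
      (simp_all add: tbar_eq_partial_prod[unfolded tbar_def])
  finally show "theta tbar_gf $ n = (tbar_gf * dlog_tbar) $ n"
    by (simp only: fps_mult_nth)
qed

lemma eis_W_0_1: "eis_W $ 0 = 0" "eis_W $ 1 = 1" and eis_V_0: "eis_V $ 0 = 1"
  by (simp_all add: eis_W_def eis_V_def dlog_V_def periodic_lambert_def lambert_series_nth periodic_def numeral_fps_const)

lemma tbar_1: "tbar 1 = 1"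
proof -
  have "theta tbar_gf $ 1 = (tbar_gf * dlog_tbar) $ 1"
    by (simp only: theta_tbar)
  then show ?thesis
    using tbar_0 by (simp add: fps_mult_nth tbar_def dlog_tbar_def periodic_lambert_def lambert_series_nth periodic_def)
qed

text \<open>
  Modulo 3 the integer \<open>d\<close> is congruent to the character value that occurs in \<open>W\<close>.
\<close>

lemma dlog_tbar_mod_3: "\<exists>G. dlog_tbar = eis_W + 3 * G"
proof -
  have "lambert_series (periodic [1, 1, 2, 0, 2, 1] 1) = lambert_series (\<lambda>d. periodic coef_w 0 d + 3 * ((periodic [1, 1, 2, 0, 2, 1] 1 d - periodic coef_w 0 d) div 3))"
  proof (rule lambert_series_cong)
    fix d
    have "\<forall>r<6. \<forall>x. 3 dvd x - int r \<longrightarrow> 3 dvd [1, 1, 2, 0, 2, 1] ! r * x ^ 1 - coef_w ! r * x ^ 0"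
      by (simp add: all_less_6; presburger)
    moreover have "int d - int (d mod 6) = 3 * (2 * int (d div 6))"
      using div_mod_6_int[of d] by linarith
    then have "3 dvd int d - int (d mod 6)" by (rule dvdI)
    ultimately have "3 dvd periodic [1, 1, 2, 0, 2, 1] 1 d - periodic coef_w 0 d"
      using nat_mod_6_less[of d] unfolding periodic_def by blast
    then show "periodic [1, 1, 2, 0, 2, 1] 1 d = periodic coef_w 0 d + 3 * ((periodic [1, 1, 2, 0, 2, 1] 1 d - periodic coef_w 0 d) div 3)"
      by simp
  qed
  then show ?thesis
    unfolding dlog_tbar_def eis_W_def periodic_lambert_def lambert_series_linear by blast
qed

lemma dlog_W_mod_3: "\<exists>G. dlog_V + (eis_V - eis_W) * (eis_V - 9 * eis_W) = 1 - eis_W + 3 * G"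
proof -
  have "lambert_series (periodic coef_f 1) = lambert_series (\<lambda>d. - periodic coef_w 0 d + 3 * ((periodic coef_f 1 d + periodic coef_w 0 d) div 3))"
  proof (rule lambert_series_cong)
    fix d
    have "\<forall>r<6. \<forall>x. 3 dvd x - int r \<longrightarrow> 3 dvd coef_f ! r * x ^ 1 + coef_w ! r * x ^ 0"
      by (simp add: all_less_6; presburger)
    moreover have "int d - int (d mod 6) = 3 * (2 * int (d div 6))"
      using div_mod_6_int[of d] by linarith
    then have "3 dvd int d - int (d mod 6)" by (rule dvdI)
    ultimately have "3 dvd periodic coef_f 1 d + periodic coef_w 0 d"
      using nat_mod_6_less[of d] unfolding periodic_def by blast
    then show "periodic coef_f 1 d = - periodic coef_w 0 d + 3 * ((periodic coef_f 1 d + periodic coef_w 0 d) div 3)"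
      by simp
  qed
  then have *: "periodic_lambert coef_f 1 = - eis_W + 3 * lambert_series (\<lambda>d. (periodic coef_f 1 d + periodic coef_w 0 d) div 3)"
    unfolding eis_W_def periodic_lambert_def lambert_series_linear .
  have "dlog_V + (eis_V - eis_W) * (eis_V - 9 * eis_W) = 1 + periodic_lambert coef_f 1"
    unfolding weight_two_lambert periodic_lambert_relations(4) by (simp only: add_ac)
  also note *
  also have "1 + (- eis_W + 3 * lambert_series (\<lambda>d. (periodic coef_f 1 d + periodic coef_w 0 d) div 3))
      = 1 - eis_W + 3 * lambert_series (\<lambda>d. (periodic coef_f 1 d + periodic coef_w 0 d) div 3)"
    by simp
  finally show ?thesis by blast
qed

lemma theta_numeral: "theta (numeral k :: 'a :: comm_ring_1 fps) = 0"
  by (rule fps_ext) (simp add: numeral_fps_const)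

text \<open>
  Modulo 3 one has \<open>\<theta> f = W f\<close> and \<open>\<theta> W = W (1 - W)\<close>, hence \<open>\<theta>\<^sup>2 f = (W - W\<^sup>2 + W\<^sup>2) f = \<theta> f\<close>.  In the
  class of 2 this reads \<open>4 t = 2 t\<close>.
\<close>

lemma three_dvd_tbar: "3 dvd tbar (3 * n + 2)"
proof -
  let ?f = tbar_gf
  obtain G where G: "dlog_tbar = eis_W + 3 * G" using dlog_tbar_mod_3 by blast
  obtain H where H: "dlog_V + (eis_V - eis_W) * (eis_V - 9 * eis_W) = 1 - eis_W + 3 * H" using dlog_W_mod_3 by blast
  define K where "K = ?f * (eis_W * H + theta G + 2 * (eis_W * G) + 3 * G ^ 2 - G)"
  have "theta (theta ?f) - theta ?f = 3 * K"
    unfolding theta_tbar theta_mult G theta_linear theta_eis_W H K_def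
    by (simp add: theta_numeral power2_eq_square algebra_simps)
  then have "(theta (theta ?f) - theta ?f) $ (3 * n + 2) = (fps_const 3 * K) $ (3 * n + 2)"
    by (simp only: numeral_fps_const)
  then have eq: "int (3 * n + 2) * (int (3 * n + 2) * tbar (3 * n + 2)) - int (3 * n + 2) * tbar (3 * n + 2)
      = 3 * K $ (3 * n + 2)"
    by (simp only: fps_sub_nth theta_nth fps_mult_left_const_nth tbar_def)
  define t z k where "t = tbar (3 * n + 2)" and "z = (3 * int n * int n + 3 * int n) * t"
    and "k = fps_nth K (3 * n + 2)"
  have "int (3 * n + 2) * (int (3 * n + 2) * t) - int (3 * n + 2) * t = 2 * t + 3 * z"
    unfolding z_def by (simp add: algebra_simps)
  with eq have "2 * t + 3 * z = 3 * k"
    unfolding t_def[symmetric] k_def by (simp only:)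
  then have "2 * t = 3 * (k - z)"
    by simp
  then have "3 dvd 2 * t" by (rule dvdI)
  then show ?thesis
    unfolding t_def[symmetric] by presburger
qed

section \<open>The differential equation of order two in characteristic p\<close>

text \<open>
  The polynomial \<open>x (1 - x) (1 - 9 x)\<close>; its roots are the values of \<open>W / V\<close> at three of the cusps.
\<close>

definition sing_poly :: "'k :: field poly" where "sing_poly = [:0, 1, - 10, 9:]"

lemma sing_poly_fps: "fps_of_poly sing_poly = fps_X - 10 * fps_X ^ 2 + 9 * (fps_X ^ 3 :: 'k :: field fps)"
  by (simp add: sing_poly_def fps_of_poly_pCons numeral_fps_const power2_eq_square power3_eq_cube algebra_simps
      flip: fps_const_neg)

lemma sing_poly'_fps: "fps_of_poly (pderiv sing_poly) = 1 - 20 * fps_X + 27 * (fps_X ^ 2 :: 'k :: field fps)"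
  by (simp add: sing_poly_def pderiv_pCons fps_of_poly_pCons numeral_fps_const power2_eq_square algebra_simps
      flip: fps_const_neg)

text \<open>
  The operator whose solution regular at 0 has the coefficients \<open>\<Sum>\<^sub>k (n choose k)\<^sup>2 (2k choose k)\<close>.
\<close>

definition ode_op :: "'k :: field fps \<Rightarrow> 'k fps" where
  "ode_op f = fps_of_poly sing_poly * fps_deriv (fps_deriv f) + fps_of_poly (pderiv sing_poly) * fps_deriv f
     + (9 * fps_X - 3) * f"

text \<open>
  The recurrence \<open>(n+1)\<^sup>2 u\<^sub>n\<^sub>+\<^sub>1 = (10 n\<^sup>2 + 10 n + 3) u\<^sub>n - 9 n\<^sup>2 u\<^sub>n\<^sub>-\<^sub>1\<close>.
\<close>

lemma ode_op_nth:
  fixes f :: "'k :: field fps"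
  shows
  "ode_op f $ n = of_nat (n + 1) ^ 2 * f $ (n + 1) - (10 * of_nat n ^ 2 + 10 * of_nat n + 3) * f $ n
     + (if n = 0 then 0 else 9 * of_nat n ^ 2 * f $ (n - 1))"
proof -
  have distr: "(x - c1 * x2 + c2 * x3) * u + (1 - c3 * x + c4 * x2) * v + (c2 * x - c5) * f
      = x * u - c1 * (x2 * u) + c2 * (x3 * u) + v - c3 * (x * v) + c4 * (x2 * v) + c2 * (x * f) - c5 * f"
    for x x2 x3 c1 c2 c3 c4 c5 u v f :: "'k fps"
    by (simp add: algebra_simps)
  have expand: "ode_op f = fps_X ^ 1 * fps_deriv (fps_deriv f) - fps_const 10 * (fps_X ^ 2 * fps_deriv (fps_deriv f))
     + fps_const 9 * (fps_X ^ 3 * fps_deriv (fps_deriv f)) + fps_deriv f - fps_const 20 * (fps_X ^ 1 * fps_deriv f)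
     + fps_const 27 * (fps_X ^ 2 * fps_deriv f) + fps_const 9 * (fps_X ^ 1 * f) - fps_const 3 * f"
    unfolding ode_op_def sing_poly_fps sing_poly'_fps numeral_fps_const power_one_right by (rule distr)
  consider "n = 0" | "n = 1" | m where "n = Suc (Suc m)"
    by (metis One_nat_def not0_implies_Suc)
  then show ?thesis
  proof cases
    case 3
    then show ?thesis
      unfolding expand by (simp add: fps_X_power_mult_nth del: power_Suc) (simp add: algebra_simps power2_eq_square)
  qed (simp_all add: expand fps_X_power_mult_nth algebra_simps power2_eq_square)
qed

lemma fps_deriv_eq_0_nth:
  assumes "fps_deriv f = (0 :: 'k :: field fps)" "0 < n" "fps_nth f n \<noteq> 0"
  shows "CHAR('k) dvd n"
proof -
  obtain m where m: "n = Suc m" using assms(2) by (cases n) auto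
  have "fps_deriv f $ m = 0" using assms(1) by simp
  then have "of_nat n * f $ n = 0" by (simp add: m)
  then show ?thesis using assms(3) by (simp add: of_nat_eq_0_iff_char_dvd)
qed

text \<open>
  The leading coefficient of the recurrence vanishes for \<open>n + 1 = p\<close>, which is why the truncation
  below \<open>p\<close> is a solution.  The Wronskian of \<open>F\<close> and \<open>B\<close> times \<open>sing_poly\<close> has derivative 0.  If it were
  not 0, then its lowest exponent would be a multiple \<open>r + 1\<close> of \<open>p\<close>, and the derivative of \<open>F / B\<close> would start
  with the exponent \<open>r \<equiv> -1\<close> modulo \<open>p\<close>, which no derivative does.
\<close>

lemma ode_polynomial_solution:
  fixes F :: "'k :: field fps"
  assumes p: "CHAR('k) = p" "prime p" and F0: "F $ 0 = 1" and solves: "ode_op F = 0"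
  obtains B c where "degree B < p" "poly B 0 = 1" "ode_op (fps_of_poly B) = 0"
    "F = fps_of_poly B * c" "fps_deriv c = 0" "fps_nth c 0 = 1"
proof -
  have p0: "0 < p" using p(2) by (rule prime_gt_0_nat)
  have ofp: "of_nat p = (0 :: 'k)" using p(1) by (simp add: of_nat_eq_0_iff_char_dvd)
  define B where "B = truncate_fps p F"
  have Bn: "coeff B n = (if n < p then F $ n else 0)" for n
    by (simp add: B_def coeff_truncate_fps)
  have "ode_op (fps_of_poly B) = 0"
  proof (rule fps_ext)
    fix n
    have F: "of_nat (n + 1) ^ 2 * F $ (n + 1) - (10 * of_nat n ^ 2 + 10 * of_nat n + 3) * F $ n
     + (if n = 0 then 0 else 9 * of_nat n ^ 2 * F $ (n - 1)) = (0 :: 'k)"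
      using ode_op_nth[of F n] solves by simp
    consider "n + 1 < p" | "n + 1 = p" | "n = p" | "p < n" by linarith
    then show "ode_op (fps_of_poly B) $ n = 0 $ n"
    proof cases
      case 1
      then have "fps_nth (fps_of_poly B) (n + 1) = fps_nth F (n + 1)" "fps_nth (fps_of_poly B) n = fps_nth F n"
          "fps_nth (fps_of_poly B) (n - 1) = fps_nth F (n - 1)"
        by (simp_all add: Bn)
      then show ?thesis using F unfolding ode_op_nth by (simp only: fps_zero_nth)
    next
      case 2
      then have "of_nat (n + 1) = (0 :: 'k)" using ofp by simp
      moreover have "fps_nth (fps_of_poly B) n = fps_nth F n" "fps_nth (fps_of_poly B) (n - 1) = fps_nth F (n - 1)"
        using 2 by (simp_all add: Bn)
      ultimately show ?thesis
        using F unfolding ode_op_nth by (simp only: fps_zero_nth zero_power2 mult_zero_left)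
    next
      case 3
      then show ?thesis using ofp by (simp add: ode_op_nth Bn)
    next
      case 4
      then show ?thesis by (simp add: ode_op_nth Bn)
    qed
  qed
  define b where "b = fps_of_poly B"
  have b0: "b $ 0 = 1" using p0 F0 by (simp add: b_def Bn)
  then have b_nz: "b \<noteq> 0" by auto
  define c where "c = F * inverse b"
  have Fbc: "F = b * c"
    using b0 by (simp add: c_def inverse_mult_eq_1' algebra_simps)
  define s where "s = (fps_of_poly sing_poly :: 'k fps)"
  \<comment> \<open>the Wronskian of \<open>F\<close> and \<open>b\<close> times \<open>s\<close>\<close>
  define h where "h = s * (b ^ 2 * fps_deriv c)"
  have s': "fps_deriv s = fps_of_poly (pderiv sing_poly)" by (simp add: s_def fps_of_poly_pderiv)
  have "fps_deriv h = b * ode_op F - F * ode_op b"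
    unfolding h_def ode_op_def Fbc s'[symmetric] s_def[symmetric]
    by (simp add: power2_eq_square algebra_simps)
  then have h': "fps_deriv h = 0"
    using solves \<open>ode_op (fps_of_poly B) = 0\<close> by (simp add: b_def)
  have c': "fps_deriv c = 0"
  proof (rule ccontr)
    assume nz: "fps_deriv c \<noteq> 0"
    have s1: "s = fps_X * (1 - 10 * fps_X + 9 * fps_X ^ 2)"
      by (simp add: s_def sing_poly_fps power2_eq_square power3_eq_cube algebra_simps)
    define e where "e = (1 - 10 * fps_X + 9 * fps_X ^ 2) * b ^ 2"
    have "e $ 0 = 1" using b0 by (simp add: e_def numeral_fps_const power2_eq_square)
    then have e: "e \<noteq> 0" "subdegree e = 0" by (auto simp: subdegree_eq_0_iff)
    have h: "h = fps_X * (e * fps_deriv c)"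
      by (simp add: h_def s1 e_def algebra_simps)
    define r where "r = subdegree (fps_deriv c)"
    have "subdegree h = Suc r"
      using e nz by (simp add: h r_def)
    moreover have "h \<noteq> 0" using e nz by (simp add: h)
    ultimately have "h $ Suc r \<noteq> 0" by (metis nth_subdegree_nonzero)
    with h' have "p dvd Suc r" using fps_deriv_eq_0_nth[of h "Suc r"] p by simp
    then have "of_nat (Suc r) = (0 :: 'k)" using p by (simp only: of_nat_eq_0_iff_char_dvd)
    then have "fps_nth (fps_deriv c) r = 0" by (simp del: of_nat_Suc)
    moreover have "fps_nth (fps_deriv c) r \<noteq> 0"
      unfolding r_def using nz by (rule nth_subdegree_nonzero)
    ultimately show False by contradiction
  qed
  show ?thesis
  proof (rule that)
    show "degree B < p" unfolding B_def using p0 by (rule degree_truncate_fps)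
    show "poly B 0 = 1" using p0 F0 by (simp add: poly_0_coeff_0 Bn)
    show "fps_nth c 0 = 1" using b0 F0 by (simp add: c_def)
  qed (fact | simp add: Fbc b_def)+
qed

lemma order_factor:
  assumes "q \<noteq> (0 :: 'k :: field poly)"
  obtains r where "q = [:- z, 1:] ^ order z q * r" "poly r z \<noteq> 0"
  using order_decomp[OF assms, of z] by (auto simp: poly_eq_0_iff_dvd)

text \<open>
  The coefficient of highest degree in the equation gives \<open>(deg B + 1)\<^sup>2 = 0\<close>.  At a root \<open>z\<close> of order \<open>j\<close> the
  indicial equation is \<open>j (j - 1) = 0\<close> if \<open>z\<close> is a regular point and \<open>j\<^sup>2 = 0\<close> if it is singular; since
  \<open>0 < j < p\<close> the latter is impossible and the former means \<open>j = 1\<close>.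
\<close>

lemma ode_polynomial_simple_roots:
  fixes B :: "'k :: field poly"
  assumes p: "CHAR('k) = p" "prime p" "5 \<le> p"
    and deg: "degree B < p" and B0: "poly B 0 = 1" and solves: "ode_op (fps_of_poly B) = 0"
  shows "degree B = p - 1" and "poly B z = 0 \<Longrightarrow> order z B = 1 \<and> poly sing_poly z \<noteq> 0"
proof -
  have nz: "B \<noteq> 0" using B0 by auto
  have nat0: "of_nat n = (0 :: 'k) \<longleftrightarrow> p dvd n" for n
    using p(1) by (simp add: of_nat_eq_0_iff_char_dvd)
  have num: "(2 :: 'k) \<noteq> 0" "(3 :: 'k) \<noteq> 0" "(9 :: 'k) \<noteq> 0" "(8 :: 'k) \<noteq> 0"
  proof -
    have "\<not> p dvd 2" "\<not> p dvd 3" using p(3) by (auto dest: dvd_imp_le)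
    then show "(2 :: 'k) \<noteq> 0" "(3 :: 'k) \<noteq> 0" using nat0[of 2] nat0[of 3] by simp_all
    moreover have "(9 :: 'k) = 3 * 3" "(8 :: 'k) = 2 * 2 * 2" by simp_all
    ultimately show "(9 :: 'k) \<noteq> 0" "(8 :: 'k) \<noteq> 0" by (metis mult_eq_0_iff)+
  qed
  define n where "n = degree B"
  have "ode_op (fps_of_poly B) $ (n + 1) = 0" using solves by simp
  then have "9 * of_nat (n + 1) ^ 2 * coeff B n = (0 :: 'k)"
    unfolding ode_op_nth by (simp add: n_def coeff_eq_0 del: of_nat_Suc of_nat_add)
  then have "of_nat (n + 1) = (0 :: 'k)" using nz num by (simp add: n_def del: of_nat_add of_nat_Suc)
  then have "p dvd n + 1" by (simp only: nat0)
  then show "degree B = p - 1"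
    using deg dvd_imp_le[of p "n + 1"] unfolding n_def by simp
  have ode': "sing_poly * pderiv (pderiv B) + pderiv sing_poly * pderiv B + [:- 3, 9:] * B = 0"
  proof -
    have lin: "fps_of_poly [:- 3, 9:] = 9 * fps_X - (3 :: 'k fps)"
      by (simp add: fps_of_poly_pCons numeral_fps_const flip: fps_const_neg)
    have "fps_of_poly (sing_poly * pderiv (pderiv B) + pderiv sing_poly * pderiv B + [:- 3, 9:] * B) = ode_op (fps_of_poly B)"
      unfolding ode_op_def fps_of_poly_add fps_of_poly_mult lin by (simp only: fps_of_poly_pderiv)
    then show ?thesis using solves fps_of_poly_eq_iff[of _ 0] by (metis fps_of_poly_0)
  qed
  assume z: "poly B z = 0"
  define j where "j = order z B"
  obtain r where r: "B = [:- z, 1:] ^ j * r" "poly r z \<noteq> 0"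
    using order_factor[OF nz, of z] unfolding j_def by blast
  have "0 < j" using z nz by (simp add: j_def order_gt_0_iff)
  have "j \<le> degree B" unfolding j_def using nz by (rule order_degree)
  with deg have "\<not> p dvd j" using \<open>0 < j\<close> by (auto dest: dvd_imp_le)
  then have j0: "of_nat j \<noteq> (0 :: 'k)" by (simp add: nat0)
  define t where "t = [:- z, 1:]"
  have t': "pderiv t = 1" by (simp add: t_def pderiv_pCons)
  have tz: "poly t z = 0" by (simp add: t_def)
  have tnz: "t \<noteq> 0" by (simp add: t_def)
  show "order z B = 1 \<and> poly sing_poly z \<noteq> 0"
  proof (cases j)
    case 0
    with \<open>0 < j\<close> show ?thesis by simp
  next
    case (Suc i)
    define r1 where "r1 = smult (of_nat j) r + t * pderiv r"
    have B: "B = t ^ i * (t * r)"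
      using r(1) unfolding Suc t_def[symmetric] power_Suc by (simp only: mult_ac)
    have tpow: "t * pderiv (t ^ m) = smult (of_nat m) (t ^ m)" for m
    proof (cases m)
      case (Suc k)
      show ?thesis
        unfolding Suc pderiv_power_Suc t' by (simp add: mult.left_commute)
    qed simp
    have "t * pderiv B = t * (t ^ i * pderiv (t * r)) + t * r * (t * pderiv (t ^ i))"
      unfolding B pderiv_mult by (simp only: distrib_left mult_ac)
    also have "\<dots> = t * (t ^ i * r1)"
      unfolding tpow pderiv_mult t' r1_def Suc by (simp add: algebra_simps smult_add_left)
    finally have B1: "pderiv B = t ^ i * r1"
      using tnz by simp
    have r1z: "poly r1 z = of_nat j * poly r z" by (simp add: r1_def tz)
    have B2: "t * pderiv (pderiv B) = t ^ i * (smult (of_nat i) r1 + t * pderiv r1)"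
    proof -
      have "t * pderiv (pderiv B) = t * (t ^ i * pderiv r1) + r1 * (t * pderiv (t ^ i))"
        unfolding B1 pderiv_mult by (simp only: distrib_left mult_ac)
      then show ?thesis
        unfolding tpow by (simp add: algebra_simps)
    qed
    have "t * (sing_poly * pderiv (pderiv B) + pderiv sing_poly * pderiv B + [:- 3, 9:] * B)
        = sing_poly * (t * pderiv (pderiv B)) + pderiv sing_poly * (t * pderiv B) + [:- 3, 9:] * (t * B)"
      by (simp only: distrib_left mult_ac)
    also have "t * pderiv B = t ^ i * (t * r1)"
      unfolding B1 by (simp only: mult_ac)
    also have "t * B = t ^ i * (t * (t * r))"
      by (subst B) (simp only: mult_ac)
    also have "sing_poly * (t * pderiv (pderiv B)) + pderiv sing_poly * (t ^ i * (t * r1)) + [:- 3, 9:] * (t ^ i * (t * (t * r)))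
        = t ^ i * (sing_poly * (smult (of_nat i) r1 + t * pderiv r1) + t * pderiv sing_poly * r1 + [:- 3, 9:] * (t * (t * r)))"
      unfolding B2 by (simp only: distrib_left mult_ac)
    finally have "t ^ i * (sing_poly * (smult (of_nat i) r1 + t * pderiv r1) + t * pderiv sing_poly * r1 + [:- 3, 9:] * (t * (t * r)))
        = t * (sing_poly * pderiv (pderiv B) + pderiv sing_poly * pderiv B + [:- 3, 9:] * B)" ..
    then have *: "sing_poly * (smult (of_nat i) r1 + t * pderiv r1) + t * pderiv sing_poly * r1 + [:- 3, 9:] * (t * (t * r)) = 0"
      using tnz unfolding ode' by simp
    have "poly (sing_poly * (smult (of_nat i) r1 + t * pderiv r1) + t * pderiv sing_poly * r1 + [:- 3, 9:] * (t * (t * r))) z = 0"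
      unfolding * by simp
    then have "poly sing_poly z * of_nat i * of_nat j * poly r z = 0"
      by (simp add: tz r1z)
    then have Si: "poly sing_poly z = 0 \<or> of_nat i = (0 :: 'k)" using j0 r by auto
    have Sz: "poly sing_poly z \<noteq> 0"
    proof
      assume S0: "poly sing_poly z = 0"
      then obtain q where q: "sing_poly = t * q" by (auto simp: t_def poly_eq_0_iff_dvd elim: dvdE)
      have "t * (q * (smult (of_nat i) r1 + t * pderiv r1) + pderiv sing_poly * r1 + [:- 3, 9:] * (t * r)) = 0"
        using * unfolding q by (simp add: algebra_simps)
      then have "q * (smult (of_nat i) r1 + t * pderiv r1) + pderiv sing_poly * r1 + [:- 3, 9:] * (t * r) = 0"
        using tnz by simp
      then have "poly (q * (smult (of_nat i) r1 + t * pderiv r1) + pderiv sing_poly * r1 + [:- 3, 9:] * (t * r)) z = 0"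
        by simp
      moreover have "poly (pderiv sing_poly) z = poly q z"
        unfolding q by (simp add: pderiv_mult t' tz)
      ultimately have "poly q z * (of_nat i + 1) * of_nat j * poly r z = 0"
        by (simp add: tz r1z algebra_simps)
      moreover have "of_nat i + 1 = (of_nat j :: 'k)" by (simp add: Suc)
      ultimately have "poly (pderiv sing_poly) z = 0" using j0 r \<open>poly (pderiv sing_poly) z = poly q z\<close> by auto
      then have 1: "27 * z ^ 2 - 20 * z + 1 = 0" and 2: "z * ((1 - z) * (1 - 9 * z)) = 0"
        using S0 by (simp_all add: sing_poly_def pderiv_pCons algebra_simps power2_eq_square)
      have "z \<noteq> 0" using z B0 by auto
      with 2 consider "z = 1" | "9 * z = 1" by auto
      then show False
      proof cases
        case 1
        with \<open>27 * z ^ 2 - 20 * z + 1 = 0\<close> num show False by simp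
      next
        case 2
        have "27 * z ^ 2 - 20 * z + 1 = (9 * z) * (3 * z) - 20 * z + 1" by (simp add: power2_eq_square)
        also have "\<dots> = 1 - 17 * z" unfolding 2 by simp
        finally have "9 * (1 - 17 * z) = 0" using \<open>27 * z ^ 2 - 20 * z + 1 = 0\<close> by simp
        moreover have "9 * (1 - 17 * z) = 9 - 17 * (9 * z)" by (simp add: algebra_simps)
        ultimately have "- 8 = (0 :: 'k)" unfolding 2 by simp
        with num show False by simp
      qed
    qed
    with Si have "p dvd i" by (simp add: nat0)
    moreover have "i < p" using Suc \<open>j \<le> degree B\<close> deg by simp
    ultimately have "i = 0" by (auto dest: dvd_imp_le)
    with Sz show ?thesis using Suc by (simp add: j_def)
  qed
qed

section \<open>Kummer extensions inside power series\<close>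

definition eval_fps :: "'k :: field fps \<Rightarrow> 'k poly poly \<Rightarrow> 'k fps" where
  "eval_fps Y h = poly (map_poly fps_of_poly h) Y"

lemma fps_of_poly_eq_0_iff [simp]: "fps_of_poly p = 0 \<longleftrightarrow> p = 0"
  using fps_of_poly_eq_iff[of p 0] by simp

lemma eval_fps_simps:
  "eval_fps Y 0 = 0"
  "eval_fps Y (pCons c h) = fps_of_poly c + Y * eval_fps Y h"
  "eval_fps Y (f + g) = eval_fps Y f + eval_fps Y g"
  "eval_fps Y (smult c g) = fps_of_poly c * eval_fps Y g"
  "eval_fps Y (f * g) = eval_fps Y f * eval_fps Y g"
proof -
  show zero: "eval_fps Y 0 = 0" by (simp add: eval_fps_def)
  show step: "eval_fps Y (pCons c h) = fps_of_poly c + Y * eval_fps Y h" for c h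
    unfolding eval_fps_def by (subst Polynomial.map_poly_pCons) simp_all
  show add: "eval_fps Y (f + g) = eval_fps Y f + eval_fps Y g" for f g
  proof (induction f arbitrary: g)
    case 0
    show ?case by (simp add: zero)
  next
    case (pCons a f)
    obtain b g' where g: "g = pCons b g'" by (cases g)
    show ?case
      by (simp add: g pCons.IH step fps_of_poly_add algebra_simps)
  qed
  show smult: "eval_fps Y (smult c g) = fps_of_poly c * eval_fps Y g" for c g
    by (induction g) (simp_all add: zero step fps_of_poly_mult algebra_simps)
  show "eval_fps Y (f * g) = eval_fps Y f * eval_fps Y g"
    by (induction f) (simp_all add: zero step add smult algebra_simps)
qed

lemma eval_fps_monom: "eval_fps Y (monom c n) = fps_of_poly c * Y ^ n"
  by (induction n) (simp_all add: monom_0 monom_Suc eval_fps_simps algebra_simps)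

lemma eval_fps_sum: "eval_fps Y (sum h A) = (\<Sum>x\<in>A. eval_fps Y (h x))"
  by (induction A rule: infinite_finite_induct) (simp_all add: eval_fps_simps)

text \<open>
  Let \<open>d\<close> be the degree of the minimal polynomial \<open>h\<close> of \<open>C\<close> over the rational functions.  It divides
  \<open>Y\<^sup>n - M/N = \<Prod> (Y - \<zeta> C)\<close>, where \<open>\<zeta>\<close> runs over the \<open>n\<close>-th roots of unity, all of which are constants.
  Hence \<open>h\<close> is a product of \<open>d\<close> of these linear factors, and its constant term shows that \<open>C\<^sup>d\<close> is rational.
\<close>

lemma kummer_degree:
  fixes C :: "'k :: field fps" and M N :: "'k poly"
  assumes C: "C \<noteq> 0" and n: "0 < n" and N: "N \<noteq> 0"
    and rel: "fps_of_poly N * C ^ n = fps_of_poly M"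
    and roots: "card {z :: 'k. z ^ n = 1} = n"
  obtains d P R where "0 < d" "d \<le> n" "P \<noteq> 0" "R \<noteq> 0" "fps_of_poly P * C ^ d = fps_of_poly R"
    "\<And>h i. (\<Sum>i<d. fps_of_poly (h i) * C ^ i) = 0 \<Longrightarrow> i < d \<Longrightarrow> h i = 0"
proof -
  define g where "g = monom N n + [:- M:]"
  have eval_g: "eval_fps Y g = fps_of_poly N * Y ^ n - fps_of_poly M" for Y
    by (simp add: g_def eval_fps_monom eval_fps_simps fps_of_poly_uminus)
  have deg_g: "degree g = n"
  proof -
    have "degree (monom N n + [:- M:]) = degree (monom N n)"
      by (rule degree_add_eq_left) (use n N in \<open>simp add: degree_monom_eq\<close>)
    then show ?thesis unfolding g_def using degree_monom_eq[OF N, of n] by (simp only:)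
  qed
  then have g0: "g \<noteq> 0" using n by auto
  have eg: "eval_fps C g = 0" by (simp add: eval_g rel)
  define I where "I h \<longleftrightarrow> h \<noteq> 0 \<and> eval_fps C h = 0" for h
  obtain h where h: "I h" and least: "\<And>h'. I h' \<Longrightarrow> degree h \<le> degree h'"
    using ex_has_least_nat[of I g degree] g0 eg unfolding I_def by blast
  define d where "d = degree h"
  have small: "h' = 0" if "eval_fps C h' = 0" "degree h' < d" for h'
    using least[of h'] that by (auto simp: I_def d_def)
  have "d \<le> n" using least[of g] g0 eg deg_g by (simp add: I_def d_def)
  have "0 < d"
  proof (rule ccontr)
    assume "\<not> 0 < d"
    then obtain c where "h = [:c:]" by (auto simp: d_def elim: degree_eq_zeroE)
    with h have "c \<noteq> 0" "fps_of_poly c = 0" by (auto simp: I_def eval_fps_simps)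
    then show False by simp
  qed
  have h0: "h \<noteq> 0" "eval_fps C h = 0" using h by (simp_all add: I_def)
  obtain a q where aq: "a \<noteq> 0" "smult a g = h * q + pseudo_mod g h"
    using pseudo_mod(1)[OF h0(1), of g] by blast
  have "eval_fps C (smult a g) = eval_fps C (h * q + pseudo_mod g h)" using aq(2) by simp
  then have "eval_fps C (pseudo_mod g h) = 0"
    unfolding eval_fps_simps by (simp add: eg h0)
  with pseudo_mod(2)[OF h0(1), of g] small have "pseudo_mod g h = 0"
    by (auto simp: d_def)
  then have aq': "smult a g = h * q" using aq(2) by (simp only: add_0_right)
  have "degree (smult a g) = n" using aq(1) deg_g by simp
  then have "degree (h * q) = n" unfolding aq' .
  have q0: "q \<noteq> 0" using aq' aq g0 by auto
  then have deg_q: "d + degree q = n"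
    using \<open>degree (h * q) = n\<close> h0 by (simp add: degree_mult_eq d_def)
  let ?h = "map_poly fps_of_poly h" and ?q = "map_poly fps_of_poly q"
  have deg_map: "degree (map_poly fps_of_poly f) = degree f" for f :: "'k poly poly"
    by (rule degree_map_poly) simp
  have map_0: "map_poly fps_of_poly f = 0 \<longleftrightarrow> f = 0" for f :: "'k poly poly"
    by (rule map_poly_eq_0_iff) simp_all
  define Z where "Z = (\<lambda>z. fps_const z * C) ` {z :: 'k. z ^ n = 1}"
  have finU: "finite {z :: 'k. z ^ n = 1}"
    using roots n by (intro card_ge_0_finite) simp
  have "inj_on (\<lambda>z. fps_const z * C) {z :: 'k. z ^ n = 1}"
    using C by (auto simp: inj_on_def)
  then have cardZ: "card Z = n" unfolding Z_def using roots by (simp add: card_image)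
  have finZ: "finite Z" using finU by (simp add: Z_def)
  have "Z \<subseteq> {y \<in> Z. poly ?h y = 0} \<union> {y. poly ?q y = 0}"
  proof
    fix y assume y: "y \<in> Z"
    then obtain z where z: "z ^ n = 1" "y = fps_const z * C" by (auto simp: Z_def)
    then have "y ^ n = C ^ n"
      by (simp add: power_mult_distrib fps_const_power)
    then have "eval_fps y g = 0" by (simp add: eval_g rel)
    then have "eval_fps y (h * q) = 0"
      unfolding aq'[symmetric] eval_fps_simps by simp
    with y show "y \<in> {y \<in> Z. poly ?h y = 0} \<union> {y. poly ?q y = 0}"
      unfolding eval_fps_simps by (auto simp: eval_fps_def)
  qed
  moreover have fq: "finite {y. poly ?q y = 0}"
    by (rule poly_roots_finite) (use q0 map_0 in blast)
  ultimately have "n \<le> card ({y \<in> Z. poly ?h y = 0} \<union> {y. poly ?q y = 0})"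
    using card_mono[of "{y \<in> Z. poly ?h y = 0} \<union> {y. poly ?q y = 0}" Z] finZ cardZ by simp
  also have "\<dots> \<le> card {y \<in> Z. poly ?h y = 0} + card {y. poly ?q y = 0}"
    by (rule card_Un_le)
  also have "card {y. poly ?q y = 0} \<le> degree q"
    using card_poly_roots_bound[of ?q] q0 by (simp add: map_0 deg_map)
  finally have "d \<le> card {y \<in> Z. poly ?h y = 0}"
    using deg_q by linarith
  then obtain S where S: "S \<subseteq> {y \<in> Z. poly ?h y = 0}" "card S = d" "finite S"
    by (meson obtain_subset_with_card_n)
  define lc where "lc = fps_of_poly (coeff h d)"
  let ?prod = "smult lc (\<Prod>s\<in>S. [:- s, 1:])"
  have lc0: "coeff h d \<noteq> 0" using h0 by (simp add: d_def)
  have deg_prod: "degree (\<Prod>s\<in>S. [:- s, 1:]) = d"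
    using S by (subst degree_prod_eq_sum_degree) auto
  have "monic (\<Prod>s\<in>S. [:- s, 1:])"
    by (rule monic_prod) simp
  then have "coeff (\<Prod>s\<in>S. [:- s, 1:]) d = 1" using deg_prod by simp
  have "?h = ?prod"
  proof (rule poly_eqI_degree_lead_coeff[where n = d and A = S])
    show "coeff ?h d = coeff ?prod d"
      using \<open>coeff (\<Prod>s\<in>S. [:- s, 1:]) d = 1\<close> by (simp add: coeff_map_poly lc_def)
    show "degree ?prod \<le> d" using deg_prod by (metis degree_smult_le)
    show "degree ?h \<le> d" by (simp add: deg_map d_def)
    show "poly ?h z = poly ?prod z" if "z \<in> S" for z
      using that S by (auto simp: poly_prod intro!: prod_zero)
  qed (use S in simp)
  then have "fps_of_poly (coeff h 0) = poly ?prod 0"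
    unfolding poly_0_coeff_0 by (metis coeff_map_poly fps_of_poly_0)
  then have h_0: "fps_of_poly (coeff h 0) = lc * (\<Prod>s\<in>S. - s)"
    by (simp add: poly_prod)
  define u where "u = (\<lambda>s. SOME z. z ^ n = 1 \<and> s = fps_const (z :: 'k) * C)"
  have u: "u s ^ n = 1 \<and> s = fps_const (u s) * C" if "s \<in> S" for s
    unfolding u_def by (rule someI_ex) (use that S in \<open>auto simp: Z_def\<close>)
  define \<kappa> where "\<kappa> = (\<Prod>s\<in>S. - u s)"
  have "(\<Prod>s\<in>S. - s) = (\<Prod>s\<in>S. fps_const (- u s) * C)"
    by (rule prod.cong[OF refl]) (metis u fps_const_neg minus_mult_left)
  also have "\<dots> = (\<Prod>s\<in>S. fps_const (- u s)) * C ^ d"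
    using S by (simp add: prod.distrib)
  also have "(\<Prod>s\<in>S. fps_const (- u s)) = fps_const \<kappa>"
    unfolding \<kappa>_def using S(3) by (induction S rule: finite_induct) (simp_all flip: fps_const_mult fps_const_neg)
  finally have prod_s: "(\<Prod>s\<in>S. - s) = fps_const \<kappa> * C ^ d" .
  have "u s \<noteq> 0" if "s \<in> S" for s
    using u[OF that] n by (auto simp: power_0_left)
  then have \<kappa>: "\<kappa> \<noteq> 0" unfolding \<kappa>_def using S(3) by auto
  show ?thesis
  proof (rule that)
    show "0 < d" "d \<le> n" by fact+
    show "smult \<kappa> (coeff h d) \<noteq> 0" using \<kappa> lc0 by simp
    show eq: "fps_of_poly (smult \<kappa> (coeff h d)) * C ^ d = fps_of_poly (coeff h 0)"
      unfolding h_0 prod_s lc_def by (simp add: fps_of_poly_smult algebra_simps)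
    show "coeff h 0 \<noteq> 0"
    proof
      assume "coeff h 0 = 0"
      with eq have "fps_of_poly (smult \<kappa> (coeff h d)) = 0" using C by simp
      then have "smult \<kappa> (coeff h d) = 0" by (simp only: fps_of_poly_eq_0_iff)
      with \<kappa> lc0 show False by simp
    qed
    fix f :: "nat \<Rightarrow> 'k poly" and i
    assume sum: "(\<Sum>i<d. fps_of_poly (f i) * C ^ i) = 0" and i: "i < d"
    define F where "F = (\<Sum>i<d. monom (f i) i)"
    have "eval_fps C F = 0"
      unfolding F_def eval_fps_sum eval_fps_monom by (fact sum)
    moreover have "degree F < d"
      unfolding F_def using \<open>0 < d\<close>
      by (intro degree_sum_less) (auto intro: le_less_trans[OF degree_monom_le])
    ultimately have "F = 0" by (rule small)
    moreover have "coeff F i = f i"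
      unfolding F_def using i by (simp add: coeff_sum)
    ultimately show "f i = 0" by simp
  qed
qed

section \<open>Orders of vanishing and derivations\<close>

text \<open>
  Multiplying the derivative by \<open>x - z\<close> avoids the case distinction for order 0.
\<close>

lemma order_deriv_expansion:
  fixes q :: "'k :: field poly"
  assumes "q \<noteq> 0"
  obtains r where "q = [:- z, 1:] ^ order z q * r" "poly r z \<noteq> 0"
    "[:- z, 1:] * pderiv q = [:- z, 1:] ^ order z q * (smult (of_nat (order z q)) r + [:- z, 1:] * pderiv r)"
proof -
  define t where "t = [:- z, 1:]"
  have t': "pderiv t = 1" by (simp add: t_def pderiv_pCons)
  obtain r where r: "q = t ^ order z q * r" "poly r z \<noteq> 0"
    unfolding t_def using order_factor[OF assms, of z] by blast
  have tpow: "t * pderiv (t ^ m) = smult (of_nat m) (t ^ m)" for m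
  proof (cases m)
    case (Suc k)
    show ?thesis
      unfolding Suc pderiv_power_Suc t' by (simp add: mult.left_commute)
  qed simp
  have "t * pderiv (t ^ m * r) = t * (t ^ m * pderiv r) + r * (t * pderiv (t ^ m))" for m
    unfolding pderiv_mult by (simp only: distrib_left mult_ac)
  then have "t * pderiv (t ^ m * r) = t ^ m * (smult (of_nat m) r + t * pderiv r)" for m
    unfolding tpow by (simp add: algebra_simps)
  with r show ?thesis
    using that unfolding t_def by metis
qed

lemma order_linear_power_mult:
  fixes r :: "'k :: field poly"
  assumes "poly r z \<noteq> 0"
  shows "order z ([:- z, 1:] ^ n * r) = n"
proof -
  have "[:- z, 1:] ^ n * r \<noteq> 0" using assms by auto
  then have "order z ([:- z, 1:] ^ n * r) = order z ([:- z, 1:] ^ n) + order z r"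
    by (rule order_mult)
  then show ?thesis using assms by (simp add: order_power_n_n order_0I del: power_Suc)
qed

text \<open>
  Differentiation lowers the order by one and \<open>M\<close> adds two; the factor \<open>order z q\<close> that appears in the
  leading coefficient vanishes exactly if the characteristic divides it.
\<close>

lemma order_weighted_deriv:
  fixes q M :: "'k :: field poly"
  assumes q: "q \<noteq> 0" and M: "M \<noteq> 0" "order z M = 2"
  shows "\<not> CHAR('k) dvd order z q \<Longrightarrow> M * pderiv q \<noteq> 0 \<and> order z (M * pderiv q) = order z q + 1"
    and "CHAR('k) dvd order z q \<Longrightarrow> [:- z, 1:] ^ (order z q + 2) dvd M * pderiv q"
proof -
  define t where "t = [:- z, 1:]"
  have tnz: "t \<noteq> 0" by (simp add: t_def)
  obtain r where r: "q = t ^ order z q * r" "poly r z \<noteq> 0"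
    "t * pderiv q = t ^ order z q * (smult (of_nat (order z q)) r + t * pderiv r)"
    unfolding t_def using order_deriv_expansion[OF q, of z] by blast
  obtain M0 where M0: "M = t ^ 2 * M0" "poly M0 z \<noteq> 0"
    unfolding t_def using order_factor[OF M(1), of z] M(2) by metis
  define s where "s = smult (of_nat (order z q)) r + t * pderiv r"
  have "M * pderiv q = t * M0 * (t * pderiv q)"
    unfolding M0(1) power2_eq_square by (simp only: mult_ac)
  then have eq: "M * pderiv q = t ^ (order z q + 1) * (M0 * s)"
    unfolding r(3) s_def[symmetric] by (simp only: power_add power_one_right mult_ac)
  show "M * pderiv q \<noteq> 0 \<and> order z (M * pderiv q) = order z q + 1" if "\<not> CHAR('k) dvd order z q"
  proof -
    have "of_nat (order z q) \<noteq> (0 :: 'k)" using that by (simp add: of_nat_eq_0_iff_char_dvd)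
    then have "poly (M0 * s) z \<noteq> 0"
      using M0(2) r(2) by (simp add: s_def t_def)
    then have "order z (M * pderiv q) = order z q + 1"
      unfolding eq t_def by (rule order_linear_power_mult)
    moreover have "M0 * s \<noteq> 0"
      using \<open>poly (M0 * s) z \<noteq> 0\<close> by auto
    ultimately show ?thesis using tnz unfolding eq by simp
  qed
  show "[:- z, 1:] ^ (order z q + 2) dvd M * pderiv q" if "CHAR('k) dvd order z q"
  proof -
    have "of_nat (order z q) = (0 :: 'k)" using that by (simp add: of_nat_eq_0_iff_char_dvd)
    then have "s = t * pderiv r" by (simp add: s_def)
    then have "M * pderiv q = t ^ (order z q + 2) * (M0 * pderiv r)"
      unfolding eq by (simp add: algebra_simps power_add power2_eq_square)
    then show ?thesis unfolding t_def by (metis dvd_triv_left)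
  qed
qed

text \<open>
  The hypothesis says that \<open>N / M\<close> has derivative 0.
\<close>

lemma order_proportional_cong:
  fixes N M :: "'k :: field poly"
  assumes N: "N \<noteq> 0" and M: "M \<noteq> 0" and eq: "pderiv N * M = N * pderiv M"
  shows "of_nat (order z N) = (of_nat (order z M) :: 'k)"
proof -
  define t where "t = [:- z, 1:]"
  have tnz: "t \<noteq> 0" by (simp add: t_def)
  obtain r where r: "N = t ^ order z N * r" "poly r z \<noteq> 0"
    "t * pderiv N = t ^ order z N * (smult (of_nat (order z N)) r + t * pderiv r)"
    unfolding t_def using order_deriv_expansion[OF N, of z] by blast
  obtain s where s: "M = t ^ order z M * s" "poly s z \<noteq> 0"
    "t * pderiv M = t ^ order z M * (smult (of_nat (order z M)) s + t * pderiv s)"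
    unfolding t_def using order_deriv_expansion[OF M, of z] by blast
  define a b where "a = order z N" and "b = order z M"
  have "(t * pderiv N) * M = N * (t * pderiv M)"
    using arg_cong[OF eq, of "\<lambda>x. t * x"] by (simp only: mult_ac)
  moreover have "(t * pderiv N) * M = t ^ (a + b) * ((smult (of_nat a) r + t * pderiv r) * s)"
    unfolding r(3) by (subst s(1)) (simp only: a_def b_def power_add mult_ac)
  moreover have "N * (t * pderiv M) = t ^ (a + b) * (r * (smult (of_nat b) s + t * pderiv s))"
    unfolding s(3) by (subst r(1)) (simp only: a_def b_def power_add mult_ac)
  ultimately have "(smult (of_nat a) r + t * pderiv r) * s = r * (smult (of_nat b) s + t * pderiv s)"
    using tnz by simp
  then have "poly ((smult (of_nat a) r + t * pderiv r) * s) z = poly (r * (smult (of_nat b) s + t * pderiv s)) z"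
    by (rule arg_cong)
  then show ?thesis
    using r(2) s(2) by (simp add: t_def a_def b_def)
qed

lemma degree_weighted_deriv_iterate:
  fixes M q :: "'k :: field poly"
  assumes "degree M \<le> Suc k"
  shows "degree (((\<lambda>q. M * pderiv q) ^^ n) q) \<le> degree q + n * k"
proof (induction n)
  case (Suc n)
  let ?q = "((\<lambda>q. M * pderiv q) ^^ n) q"
  have "degree (M * pderiv ?q) \<le> degree ?q + k"
  proof (cases "degree ?q = 0")
    case True
    then obtain c where "?q = [:c:]" by (auto elim: degree_eq_zeroE)
    then show ?thesis by (simp add: pderiv_pCons)
  next
    case False
    have "degree (M * pderiv ?q) \<le> degree M + degree (pderiv ?q)" by (rule degree_mult_le)
    also have "\<dots> \<le> Suc k + (degree ?q - 1)"
      using assms degree_pderiv_le[of ?q] by simp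
    finally show ?thesis using False by simp
  qed
  with Suc.IH show ?case by simp
qed simp

lemma card_roots_simple:
  fixes B :: "'k :: alg_closed_field poly"
  assumes "B \<noteq> 0" and simple: "\<And>z. poly B z = 0 \<Longrightarrow> order z B = 1"
  shows "degree B \<le> card {z. poly B z = 0}"
proof -
  obtain A where A: "size A = degree B" "B = smult (lead_coeff B) (\<Prod>x\<in>#A. [:- x, 1:])"
    using alg_closed_imp_factorization[OF assms(1)] by blast
  have sub: "set_mset A \<subseteq> {z. poly B z = 0}"
  proof
    fix x assume "x \<in># A"
    then have "[:- x, 1:] dvd (\<Prod>x\<in>#A. [:- x, 1:])"
      by (metis (no_types, lifting) dvd_prod_mset image_eqI set_image_mset)
    then have "[:- x, 1:] dvd B" using A(2) by (metis dvd_smult)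
    then show "x \<in> {z. poly B z = 0}" by (simp add: poly_eq_0_iff_dvd)
  qed
  have "count A x \<le> 1" if "x \<in># A" for x
  proof -
    have "replicate_mset (count A x) x \<subseteq># A"
      by (simp flip: count_le_replicate_mset_subset_eq)
    then have "image_mset (\<lambda>x. [:- x, 1:]) (replicate_mset (count A x) x) \<subseteq># image_mset (\<lambda>x. [:- x, 1:]) A"
      by (rule image_mset_subseteq_mono)
    then have "[:- x, 1:] ^ count A x dvd (\<Prod>x\<in>#A. [:- x, 1:])"
      using prod_mset_subset_imp_dvd by fastforce
    then have "[:- x, 1:] ^ count A x dvd B" using A(2) by (metis dvd_smult)
    then have "count A x \<le> order x B" using assms(1) by (simp add: order_divides)
    then show ?thesis using simple[of x] sub that by auto
  qed
  then have "size A \<le> (\<Sum>x\<in>set_mset A. 1)"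
    unfolding size_multiset_overloaded_eq by (intro sum_mono) auto
  then have "degree B \<le> card (set_mset A)" using A(1) by simp
  also have "\<dots> \<le> card {z. poly B z = 0}"
    by (rule card_mono[OF poly_roots_finite[OF assms(1)] sub])
  finally show ?thesis .
qed

lemma root_with_small_order:
  fixes B N :: "'k :: alg_closed_field poly"
  assumes B: "B \<noteq> 0" "\<And>z. poly B z = 0 \<Longrightarrow> order z B = 1" and N: "N \<noteq> 0"
    and deg: "degree N < degree B * b" and b: "0 < b"
  obtains z where "poly B z = 0" "order z N < b"
proof (rule ccontr)
  assume "\<not> thesis"
  with that have ge: "b \<le> order z N" if "poly B z = 0" for z
    using not_less that by blast
  have fin: "finite {z. poly N z = 0}" by (rule poly_roots_finite[OF N])
  have sub: "{z. poly B z = 0} \<subseteq> {z. poly N z = 0}"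
  proof safe
    fix z assume "poly B z = 0"
    with ge[of z] b have "0 < order z N" by linarith
    then show "poly N z = 0" using N by (simp add: order_gt_0_iff)
  qed
  have "degree B * b \<le> card {z. poly B z = 0} * b"
    using card_roots_simple[OF B] by simp
  also have "\<dots> = (\<Sum>z | poly B z = 0. b)" by simp
  also have "\<dots> \<le> (\<Sum>z | poly B z = 0. order z N)"
    by (intro sum_mono) (simp add: ge)
  also have "\<dots> \<le> (\<Sum>z | poly N z = 0. order z N)"
    by (rule sum_mono2[OF fin sub]) simp
  also have "\<dots> \<le> degree N" by (rule sum_order_le_degree[OF N])
  finally show False using deg by simp
qed

lemma of_nat_cong_char:
  assumes "[a = b] (mod CHAR('k :: comm_ring_1))"
  shows "of_nat a = (of_nat b :: 'k)"
proof -
  have *: "of_nat x = (of_nat (x mod CHAR('k)) :: 'k)" for x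
  proof -
    have "of_nat x = (of_nat (CHAR('k) * (x div CHAR('k)) + x mod CHAR('k)) :: 'k)" by simp
    also have "\<dots> = of_nat (x mod CHAR('k))" unfolding of_nat_add of_nat_mult by simp
    finally show ?thesis .
  qed
  have "of_nat a = (of_nat (a mod CHAR('k)) :: 'k)" by (rule *)
  also have "\<dots> = of_nat (b mod CHAR('k))" using assms by (simp only: cong_def)
  also have "\<dots> = of_nat b" by (rule *[symmetric])
  finally show ?thesis .
qed

lemma of_nat_fermat:
  assumes "CHAR('k :: comm_ring_1) = p" "prime p" "\<not> p dvd a"
  shows "of_nat a ^ (p - 1) = (1 :: 'k)"
proof -
  have "[a ^ (p - 1) = 1] (mod CHAR('k))"
    unfolding assms(1) by (rule fermat_theorem) (use assms in auto)
  from of_nat_cong_char[OF this] show ?thesis by simp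
qed

text \<open>
  Fermat's little theorem: the roots are the elements of the prime field.
\<close>

lemma card_roots_of_unity_char:
  assumes p: "CHAR('k :: field) = p" "prime p"
  shows "card {z :: 'k. z ^ (p - 1) = 1} = p - 1"
proof (rule antisym)
  have n: "0 < p - 1" using prime_gt_1_nat[OF p(2)] by simp
  define f :: "'k poly" where "f = monom 1 (p - 1) + [:- 1:]"
  have deg: "degree f = p - 1"
  proof -
    have "degree f = degree (monom 1 (p - 1) :: 'k poly)"
      unfolding f_def by (rule degree_add_eq_left) (use n in \<open>simp add: degree_monom_eq\<close>)
    then show ?thesis by (simp add: degree_monom_eq)
  qed
  then have f0: "f \<noteq> 0" using n by auto
  have roots: "{z. poly f z = 0} = {z :: 'k. z ^ (p - 1) = 1}"
    by (simp add: f_def poly_monom)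
  show "card {z :: 'k. z ^ (p - 1) = 1} \<le> p - 1"
    using card_poly_roots_bound[OF f0] unfolding roots deg .
  have inj: "inj_on (of_nat :: nat \<Rightarrow> 'k) {1..<p}"
  proof (rule linorder_inj_onI)
    fix x y assume xy: "x < y" "x \<in> {1..<p}" "y \<in> {1..<p}"
    show "of_nat x \<noteq> (of_nat y :: 'k)"
    proof
      assume "of_nat x = (of_nat y :: 'k)"
      then have "of_nat (y - x) = (0 :: 'k)" using xy by (simp add: of_nat_diff)
      then have "p dvd y - x" using p by (simp add: of_nat_eq_0_iff_char_dvd)
      then show False using xy by (auto dest: dvd_imp_le)
    qed
  qed auto
  have "p - 1 = card ((of_nat :: nat \<Rightarrow> 'k) ` {1..<p})"
    using inj by (simp add: card_image)
  also have "\<dots> \<le> card {z :: 'k. z ^ (p - 1) = 1}"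
  proof (rule card_mono)
    show "finite {z :: 'k. z ^ (p - 1) = 1}"
      using poly_roots_finite[OF f0] unfolding roots .
    show "(of_nat :: nat \<Rightarrow> 'k) ` {1..<p} \<subseteq> {z. z ^ (p - 1) = 1}"
      using of_nat_fermat[OF p] by (auto simp: nat_dvd_not_less)
  qed
  finally show "p - 1 \<le> card {z :: 'k. z ^ (p - 1) = 1}" .
qed

lemma sum_lessThan_add: "(\<Sum>j<m + n. f j) = (\<Sum>j<m. f j) + (\<Sum>j<n. f (m + j :: nat) :: 'a :: comm_monoid_add)"
  by (induction n) (simp_all add: add_ac)

lemma order_weighted_deriv_iterate:
  fixes M q :: "'k :: field poly"
  assumes M: "M \<noteq> 0" "order z M = 2" and q: "q \<noteq> 0"
    and nd: "\<And>i. i < n \<Longrightarrow> \<not> CHAR('k) dvd order z q + i"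
  shows "((\<lambda>q. M * pderiv q) ^^ n) q \<noteq> 0 \<and> order z (((\<lambda>q. M * pderiv q) ^^ n) q) = order z q + n"
  using nd
proof (induction n)
  case (Suc n)
  have IH: "((\<lambda>q. M * pderiv q) ^^ n) q \<noteq> 0" "order z (((\<lambda>q. M * pderiv q) ^^ n) q) = order z q + n"
    using Suc.IH Suc.prems by simp_all
  then have "\<not> CHAR('k) dvd order z (((\<lambda>q. M * pderiv q) ^^ n) q)"
    using Suc.prems[of n] by simp
  from order_weighted_deriv(1)[OF IH(1) M this] show ?case
    using IH(2) by simp
qed (use q in simp)

lemma fps_deriv_power_zero:
  fixes C :: "'k :: field fps"
  assumes "fps_deriv C = 0"
  shows "fps_deriv (C ^ n) = 0"
  by (induction n) (simp_all add: assms)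

text \<open>
  Constants of the derivation can be moved out, and what remains is a derivation on polynomials.
\<close>

lemma weighted_deriv_iterate_fps:
  fixes S F c1 C :: "'k :: field fps" and M q :: "'k poly"
  assumes "S * F ^ 2 = fps_of_poly M * C" and "fps_deriv c1 = 0" "fps_deriv C = 0"
  shows "((\<lambda>h. S * F ^ 2 * fps_deriv h) ^^ n) (c1 * fps_of_poly q)
       = c1 * C ^ n * fps_of_poly (((\<lambda>q. M * pderiv q) ^^ n) q)"
proof (induction n)
  case (Suc n)
  let ?q = "((\<lambda>q. M * pderiv q) ^^ n) q"
  have deriv: "fps_deriv (c1 * C ^ n * fps_of_poly ?q) = c1 * C ^ n * fps_of_poly (pderiv ?q)"
    by (simp add: assms fps_deriv_power_zero fps_of_poly_pderiv)
  have "((\<lambda>h. S * F ^ 2 * fps_deriv h) ^^ Suc n) (c1 * fps_of_poly q)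
      = S * F ^ 2 * fps_deriv (((\<lambda>h. S * F ^ 2 * fps_deriv h) ^^ n) (c1 * fps_of_poly q))"
    by simp
  also have "\<dots> = S * F ^ 2 * (c1 * C ^ n * fps_of_poly (pderiv ?q))"
    unfolding Suc.IH deriv ..
  also have "\<dots> = c1 * C ^ Suc n * fps_of_poly (M * pderiv ?q)"
    unfolding assms(1) by (simp add: fps_of_poly_mult mult_ac)
  finally show ?case by simp
qed simp

lemma pderiv_power_mult: "q * pderiv (q ^ n) = smult (of_nat n) (q ^ n * pderiv (q :: 'k :: field poly))"
proof (cases n)
  case (Suc k)
  show ?thesis
    unfolding Suc pderiv_power_Suc by (simp add: mult_ac)
qed simp

section \<open>Absence of relations between iterated derivatives\<close>

text \<open>
  The equation has the solution \<open>B\<^bsup>-1/2\<^esup> (1 - x)\<^bsup>1/8\<^esup> (1 - 9 x)\<^bsup>-7/24\<^esup>\<close>.  In characteristic \<open>p\<close> the exponents may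
  be replaced by natural numbers in the same residue classes.
\<close>

lemma polynomial_solution_g:
  fixes B :: "'k :: field poly"
  assumes p: "CHAR('k) = p" "prime p" "5 \<le> p" and m: "p = 2 * m + 1" and B0: "poly B 0 = 1"
  obtains G i j where "G = B ^ m * [:1, - 1:] ^ i * [:1, - 9:] ^ j"
    "smult 2 ([:1, - 10, 9:] * B * pderiv G) = G * ([:5, - 3:] * B - [:1, - 10, 9:] * pderiv B)"
proof -
  have cop: "coprime 2 p" "coprime 3 p"
    using prime_imp_coprime[OF p(2), of 2] prime_imp_coprime[OF p(2), of 3] p(3)
    by (simp_all add: coprime_commute nat_dvd_not_less)
  then have "coprime (2 * 2 * 2) p" "coprime (2 * 2 * 2 * 3) p"
    by (simp_all only: coprime_mult_left_iff)
  then have c8: "coprime 8 p" "coprime 24 p" by simp_all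
  obtain i where i: "[8 * i = 1] (mod p)" using cong_solve_coprime_nat[OF c8(1)] by auto
  obtain j' where j': "[24 * j' = 1] (mod p)" using cong_solve_coprime_nat[OF c8(2)] by auto
  \<comment> \<open>the factor \<open>p - 1\<close> stands for \<open>-1\<close>\<close>
  define j where "j = 7 * j' * (p - 1)"
  have nat0: "of_nat n = (0 :: 'k) \<longleftrightarrow> p dvd n" for n
    using p(1) by (simp add: of_nat_eq_0_iff_char_dvd)
  have "\<not> p dvd 4" using p(3) by (auto dest: dvd_imp_le)
  then have four: "(4 :: 'k) \<noteq> 0" using nat0[of 4] by simp
  have "of_nat (8 * i) = (of_nat 1 :: 'k)"
    by (rule of_nat_cong_char) (use i p(1) in simp)
  then have i1: "8 * of_nat i = (1 :: 'k)" by simp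
  have "of_nat (24 * j') = (of_nat 1 :: 'k)"
    by (rule of_nat_cong_char) (use j' p(1) in simp)
  then have j1: "24 * of_nat j' = (1 :: 'k)" by simp
  have "Suc (p - 1) = p" using p(3) by simp
  then have "of_nat (Suc (p - 1)) = (of_nat p :: 'k)" by (simp only:)
  then have "of_nat (p - 1) + 1 = (of_nat p :: 'k)" by (simp only: of_nat_Suc add.commute)
  then have pm1: "of_nat (p - 1) = (- 1 :: 'k)"
    using nat0[of p] by (simp add: eq_neg_iff_add_eq_0)
  have "24 * of_nat j = 7 * (24 * of_nat j') * (of_nat (p - 1) :: 'k)" by (simp add: j_def)
  then have j2: "24 * of_nat j = (- 7 :: 'k)" unfolding j1 pm1 by simp
  have m2: "2 * of_nat m = (- 1 :: 'k)"
    using pm1 m by simp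
  define x y :: "'k" where "x = of_nat i" and "y = of_nat j"
  \<comment> \<open>the exponents \<open>1/8\<close> and \<open>-7/24\<close>\<close>
  have xy: "8 * x = 1" "24 * y = - 7" using i1 j2 by (simp_all add: x_def y_def)
  have "4 * (- 2 * x - 18 * y) = - (8 * x) - 3 * (24 * y)" by (simp add: algebra_simps)
  also have "\<dots> = 4 * 5" unfolding xy by simp
  finally have e5: "- 2 * x - 18 * y = 5" using four mult_left_cancel by blast
  have "4 * (18 * x + 18 * y) = 9 * (8 * x) + 3 * (24 * y)" by (simp add: algebra_simps)
  also have "\<dots> = 4 * (- 3)" unfolding xy by simp
  finally have e3: "18 * x + 18 * y = - 3" using four mult_left_cancel by blast
  define u v :: "'k poly" where "u = [:1, - 1:]" and "v = [:1, - 9:]"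
  define G where "G = B ^ m * u ^ i * v ^ j"
  have Q: "[:1, - 10, 9:] = u * v" by (simp add: u_def v_def)
  have u': "pderiv u = - 1" and v': "pderiv v = [:- 9:]" by (simp_all add: u_def v_def pderiv_pCons one_pCons)
  have "u * v * B * pderiv G = (B * pderiv (B ^ m)) * (u * u ^ i) * (v * v ^ j)
      + (B * B ^ m) * (u * pderiv (u ^ i)) * (v * v ^ j) + (B * B ^ m) * (u * u ^ i) * (v * pderiv (v ^ j))"
    unfolding G_def pderiv_mult by (simp only: distrib_left distrib_right mult_ac add_ac)
  also have "\<dots> = G * (smult (of_nat m) (u * v * pderiv B) + smult x (- B * v) + smult (- 9 * y) (B * u))"
    unfolding pderiv_power_mult u' v' G_def x_def y_def by (simp add: algebra_simps)
  finally have "smult 2 (u * v * B * pderiv G) = G * smult 2 (smult (of_nat m) (u * v * pderiv B) + smult x (- B * v) + smult (- 9 * y) (B * u))"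
    by simp
  also have "smult 2 (smult (of_nat m) (u * v * pderiv B) + smult x (- B * v) + smult (- 9 * y) (B * u))
      = smult (2 * of_nat m) (u * v * pderiv B) + (smult (- 2 * x) v + smult (- 18 * y) u) * B"
    by (simp add: smult_add_right smult_diff_right algebra_simps)
  also have "smult (- 2 * x) v + smult (- 18 * y) u = [:- 2 * x - 18 * y, 18 * x + 18 * y:]"
    by (simp add: u_def v_def algebra_simps)
  finally have "smult 2 (u * v * B * pderiv G) = G * ([:5, - 3:] * B - u * v * pderiv B)"
    unfolding e5 e3 m2 by simp
  then show ?thesis
    using that[of G i j] unfolding Q G_def u_def v_def by simp
qed

text \<open>
  The series are written in the variable \<open>x\<close>, so that \<open>\<theta>\<close> is \<open>sing_poly F\<^sup>2 d/dx\<close>; the hypothesis on \<open>\<theta>\<^sup>p x\<close>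
  records that \<open>\<theta>\<close> comes from \<open>q d/dq\<close>.  It says that \<open>N C\<^bsup>p-1\<^esup> = M\<close> for \<open>N = D\<^sup>p x\<close> and
  \<open>M = D x\<close>.  A count of degrees gives a root \<open>z\<close> of \<open>B\<close> at which the order of \<open>N\<close> is small enough
  for \<open>N / M\<close> to have order \<open>p\<close> or \<open>2 p\<close>.  With \<open>P C\<^sup>d = R\<close> from \<open>kummer_degree\<close> the orders at \<open>z\<close> show that
  \<open>p - 1\<close> divides \<open>d\<close> or \<open>2 d\<close>, respectively.
\<close>

theorem no_theta_relation:
  fixes F g :: "'k :: alg_closed_field fps" and e :: "nat \<Rightarrow> 'k"
  assumes p: "CHAR('k) = p" "prime p" "5 \<le> p"
    and F0: "fps_nth F 0 = 1" and odeF: "ode_op F = 0" and g0: "fps_nth g 0 = 1"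
    and g: "2 * fps_of_poly [:1, - 10, 9:] * F * fps_deriv g
      = g * (fps_of_poly [:5, - 3:] * F - fps_of_poly [:1, - 10, 9:] * fps_deriv F)"
    and frob: "((\<lambda>h. fps_of_poly sing_poly * F ^ 2 * fps_deriv h) ^^ p) fps_X
      = fps_of_poly sing_poly * F ^ 2 * fps_deriv fps_X"
    and rel: "(\<Sum>j<p - 1. fps_const (e j) * ((\<lambda>h. fps_of_poly sing_poly * F ^ 2 * fps_deriv h) ^^ Suc j) g) = 0"
  shows "e 0 = 0"
proof (rule ccontr)
  assume e0: "e 0 \<noteq> 0"
  have "odd p" using p(2,3) prime_odd_nat[of p] by simp
  then obtain m where m: "p = 2 * m + 1" by (elim oddE)
  obtain B c where deg: "degree B < p" and B0: "poly B 0 = 1" and odeB: "ode_op (fps_of_poly B) = 0"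
    and Fc: "F = fps_of_poly B * c" and c': "fps_deriv c = 0" and c0: "fps_nth c 0 = 1"
    using ode_polynomial_solution[OF p(1,2) F0 odeF] by blast
  note degB = ode_polynomial_simple_roots(1)[OF p deg B0 odeB]
    and roots = ode_polynomial_simple_roots(2)[OF p deg B0 odeB]
  have Bnz: "B \<noteq> 0" using B0 by auto
  have Spnz: "(sing_poly :: 'k poly) \<noteq> 0" by (simp add: sing_poly_def)
  define C where "C = c ^ 2"
  have C': "fps_deriv C = 0" unfolding C_def by (rule fps_deriv_power_zero[OF c'])
  have cnz: "c \<noteq> 0" using c0 by auto
  then have Cnz: "C \<noteq> 0" by (simp add: C_def)
  define M where "M = sing_poly * B ^ 2"
  have Mnz: "M \<noteq> 0" using Spnz Bnz by (simp add: M_def)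
  have SF: "fps_of_poly sing_poly * F ^ 2 = fps_of_poly M * C"
    by (simp add: Fc M_def C_def fps_of_poly_mult fps_of_poly_power power_mult_distrib)
  define D where "D = (\<lambda>q. M * pderiv q)"

  obtain G i j where Gdef: "G = B ^ m * [:1, - 1:] ^ i * [:1, - 9:] ^ j"
    and Geq: "smult 2 ([:1, - 10, 9:] * B * pderiv G) = G * ([:5, - 3:] * B - [:1, - 10, 9:] * pderiv B)"
    using polynomial_solution_g[OF p m B0] by blast
  have G0: "poly G 0 = 1" using B0 by (simp add: Gdef)
  define \<gamma> where "\<gamma> = fps_of_poly G"
  have \<gamma>0: "fps_nth \<gamma> 0 = 1" using G0 by (simp add: \<gamma>_def poly_0_coeff_0)
  then have \<gamma>nz: "\<gamma> \<noteq> 0" by auto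
  \<comment> \<open>\<open>g\<close> and \<open>\<gamma>\<close> solve the same equation of order one, so their quotient is a constant\<close>
  define c1 where "c1 = g * inverse \<gamma>"
  have gc: "g = c1 * \<gamma>"
    using \<gamma>0 by (simp add: c1_def mult.assoc inverse_mult_eq_1)
  have c1nz: "c1 \<noteq> 0" using g0 gc by auto
  have "2 \<noteq> (0 :: 'k)"
  proof
    assume "(2 :: 'k) = 0"
    then have "of_nat 2 = (0 :: 'k)" by simp
    then have "p dvd 2" using p(1) by (simp only: of_nat_eq_0_iff_char_dvd)
    then show False using p(3) by (auto dest: dvd_imp_le)
  qed
  define Q b where "Q = fps_of_poly [:1, - 10, 9 :: 'k:]" and "b = fps_of_poly B"
  have Qnz: "2 * Q * b \<noteq> 0"
    using \<open>2 \<noteq> 0\<close> Bnz by (simp add: Q_def b_def numeral_fps_const)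
  have c1': "fps_deriv c1 = 0"
  proof -
    have F': "fps_deriv F = fps_deriv b * c" by (simp add: Fc b_def c')
    have "c * (2 * Q * b * fps_deriv g) = c * (g * (fps_of_poly [:5, - 3:] * b - Q * fps_deriv b))"
      using g unfolding F' unfolding Fc Q_def[symmetric] b_def[symmetric] by (simp add: algebra_simps)
    then have 1: "2 * Q * b * fps_deriv g = g * (fps_of_poly [:5, - 3:] * b - Q * fps_deriv b)"
      using cnz by simp
    have 2: "2 * Q * b * fps_deriv \<gamma> = \<gamma> * (fps_of_poly [:5, - 3:] * b - Q * fps_deriv b)"
      using arg_cong[OF Geq, of fps_of_poly] unfolding Q_def b_def \<gamma>_def
      by (simp only: fps_of_poly_smult fps_of_poly_mult fps_of_poly_diff fps_of_poly_pderiv numeral_fps_const mult_ac)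
    have "fps_deriv g = c1 * fps_deriv \<gamma> + fps_deriv c1 * \<gamma>" unfolding gc by simp
    then have "2 * Q * b * fps_deriv g = c1 * (2 * Q * b * fps_deriv \<gamma>) + (2 * Q * b) * (fps_deriv c1 * \<gamma>)"
      by (simp add: algebra_simps)
    then have "g * (fps_of_poly [:5, - 3:] * b - Q * fps_deriv b)
        = c1 * (\<gamma> * (fps_of_poly [:5, - 3:] * b - Q * fps_deriv b)) + (2 * Q * b) * (fps_deriv c1 * \<gamma>)"
      unfolding 1 2 .
    then have "(2 * Q * b) * (fps_deriv c1 * \<gamma>) = 0"
      unfolding gc mult.assoc by simp
    then show ?thesis using Qnz \<gamma>nz by simp
  qed

  \<comment> \<open>a power of \<open>C\<close> is a rational function\<close>
  define N where "N = (D ^^ p) [:0, 1:]"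
  have iter_X: "((\<lambda>h. fps_of_poly sing_poly * F ^ 2 * fps_deriv h) ^^ n) fps_X = C ^ n * fps_of_poly ((D ^^ n) [:0, 1:])" for n
    using weighted_deriv_iterate_fps[OF SF, of 1 n "[:0, 1:]"] C' unfolding D_def by simp
  have "C ^ p * fps_of_poly N = fps_of_poly sing_poly * F ^ 2 * fps_deriv fps_X"
    using frob unfolding iter_X N_def .
  then have "C ^ p * fps_of_poly N = C * fps_of_poly M"
    unfolding SF by (simp add: mult.commute)
  moreover have "C ^ p = C * C ^ (p - 1)"
    using p(3) by (simp flip: power_Suc)
  ultimately have NC: "fps_of_poly N * C ^ (p - 1) = fps_of_poly M"
    using Cnz by (simp add: mult_ac)
  then have Nnz: "N \<noteq> 0" using Mnz by auto
  have N'M: "pderiv N * M = N * pderiv M"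
  proof -
    have "fps_deriv (fps_of_poly N * C ^ (p - 1)) = fps_deriv (fps_of_poly M)" unfolding NC ..
    then have "fps_of_poly (pderiv N) * C ^ (p - 1) = fps_of_poly (pderiv M)"
      by (simp add: fps_deriv_power_zero[OF C'] fps_of_poly_pderiv)
    then have "fps_of_poly (pderiv N) * (fps_of_poly N * C ^ (p - 1)) = fps_of_poly N * fps_of_poly (pderiv M)"
      by (metis mult.left_commute)
    then have "fps_of_poly (pderiv N * M) = fps_of_poly (N * pderiv M)"
      unfolding NC fps_of_poly_mult .
    then show ?thesis by (simp only: fps_of_poly_eq_iff)
  qed

  \<comment> \<open>if \<open>N\<close> vanished to the order \<open>3 p + 2\<close> at all \<open>p - 1\<close> roots of \<open>B\<close>, its degree would be too large\<close>
  have "degree N \<le> degree [:0, 1 :: 'k:] + p * (2 * p)"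
    unfolding N_def D_def
  proof (rule degree_weighted_deriv_iterate)
    have "degree M = degree (sing_poly :: 'k poly) + 2 * degree B"
      using Spnz Bnz by (simp add: M_def degree_mult_eq degree_power_eq)
    moreover have "degree (sing_poly :: 'k poly) \<le> 3" by (simp add: sing_poly_def)
    ultimately show "degree M \<le> Suc (2 * p)" using degB p(3) by simp
  qed
  moreover have "1 + p * (2 * p) < (p - 1) * (3 * p + 2)"
  proof -
    obtain r where r: "p = r + 5" using p(3) by (metis add.commute le_Suc_ex)
    show ?thesis unfolding r by (simp add: algebra_simps)
  qed
  ultimately have "degree N < degree B * (3 * p + 2)"
    using degB by simp
  with roots obtain z where z: "poly B z = 0" "order z N < 3 * p + 2"
    using root_with_small_order[OF Bnz _ Nnz, of "3 * p + 2"] by auto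
  have ordB: "order z B = 1" and Spz: "poly sing_poly z \<noteq> 0" using roots[OF z(1)] by simp_all
  have ordM: "order z M = 2"
    using Mnz ordB Spz unfolding M_def by (simp add: order_mult order_0I power2_eq_square)

  have ordG: "order z G = m" and Gnz: "G \<noteq> 0"
  proof -
    show "G \<noteq> 0" using G0 by auto
    have S: "sing_poly = [:0, 1:] * [:1, - 1:] * [:1, - 9 :: 'k:]" by (simp add: sing_poly_def)
    have "poly [:1, - 1:] z \<noteq> 0" "poly [:1, - 9:] z \<noteq> 0"
      using Spz unfolding S by auto
    then have "poly ([:1, - 1:] ^ i * [:1, - 9:] ^ j) z \<noteq> 0" by (simp add: poly_power)
    then have "order z ([:1, - 1:] ^ i * [:1, - 9:] ^ j) = 0" by (rule order_0I)
    moreover have "G = B ^ m * ([:1, - 1:] ^ i * [:1, - 9:] ^ j)" by (simp only: Gdef mult.assoc)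
    moreover have "order z (B ^ n) = n" for n
      by (induction n) (use Bnz ordB in \<open>simp_all add: order_mult\<close>)
    ultimately show "order z G = m" using \<open>G \<noteq> 0\<close> by (simp add: order_mult)
  qed
  have iterG: "(D ^^ k) G \<noteq> 0 \<and> order z ((D ^^ k) G) = m + k" if "k \<le> m + 1" for k
    unfolding ordG[symmetric] D_def
  proof (rule order_weighted_deriv_iterate[OF Mnz ordM Gnz])
    fix l assume "l < k"
    with that have "0 < m + l" "m + l < p" using m p(3) by linarith+
    then show "\<not> CHAR('k) dvd order z G + l"
      unfolding p(1) ordG by (rule nat_dvd_not_less)
  qed

  \<comment> \<open>the order of \<open>D\<^sup>k x\<close> is \<open>k + 1\<close> up to \<open>k = p - 1\<close>, where it is \<open>p\<close>; the last step gains at least two\<close>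
  have ordN: "p + 2 \<le> order z N"
  proof -
    let ?q = "(D ^^ (p - 2)) M"
    have DX: "D [:0, 1:] = M" by (simp add: D_def pderiv_pCons)
    have "N = D ((D ^^ (p - 2)) (D [:0, 1:]))"
    proof -
      have "p = Suc (Suc (p - 2))" using p(3) by simp
      then have "N = (D ^^ Suc (Suc (p - 2))) [:0, 1:]" unfolding N_def by (rule arg_cong)
      then show ?thesis by (simp add: funpow_swap1)
    qed
    then have N: "N = M * pderiv ?q" by (simp add: DX) (simp add: D_def)
    have "?q \<noteq> 0 \<and> order z ?q = order z M + (p - 2)"
      unfolding D_def
    proof (rule order_weighted_deriv_iterate[OF Mnz ordM Mnz])
      fix l assume "l < p - 2"
      then show "\<not> CHAR('k) dvd order z M + l"
        unfolding p(1) ordM by (intro nat_dvd_not_less) simp_all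
    qed
    then have q: "?q \<noteq> 0" "order z ?q = p" using ordM p(3) by simp_all
    have "[:- z, 1:] ^ (order z ?q + 2) dvd N"
      unfolding N by (rule order_weighted_deriv(2)[OF q(1) Mnz ordM]) (simp add: q p(1))
    then have "[:- z, 1:] ^ (p + 2) dvd N" unfolding q(2) .
    then show ?thesis using Nnz order_divides[of z "p + 2" N] by blast
  qed
  define w where "w = order z N - 2"
  have wN: "order z N = w + 2" using ordN by (simp add: w_def)
  have "p dvd w"
  proof -
    have "of_nat (w + 2) = (of_nat 2 :: 'k)"
      using order_proportional_cong[OF Nnz Mnz N'M, of z] unfolding wN ordM .
    then have "of_nat w = (0 :: 'k)" by simp
    then show ?thesis using p(1) by (simp only: of_nat_eq_0_iff_char_dvd)
  qed
  then obtain s where s: "w = p * s" by (elim dvdE)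
  have s12: "s = 1 \<or> s = 2"
  proof -
    have "p * 1 \<le> p * s" using ordN wN s by simp
    moreover have "p * s < p * 3" using z(2) wN s by simp
    ultimately have "1 \<le> s" "s < 3" using p(3) by simp_all
    then show ?thesis by auto
  qed

  have iter_g: "((\<lambda>h. fps_of_poly sing_poly * F ^ 2 * fps_deriv h) ^^ k) g = c1 * C ^ k * fps_of_poly ((D ^^ k) G)" for k
    unfolding gc \<gamma>_def D_def by (rule weighted_deriv_iterate_fps[OF SF c1' C'])
  define \<phi> where "\<phi> j = smult (e j) ((D ^^ Suc j) G)" for j
  have "(c1 * C) * (\<Sum>j<p - 1. fps_of_poly (\<phi> j) * C ^ j) = 0"
    using rel unfolding iter_g sum_distrib_left \<phi>_def fps_of_poly_smult by (simp add: mult_ac)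
  then have rel': "(\<Sum>j<p - 1. fps_of_poly (\<phi> j) * C ^ j) = 0"
    using c1nz Cnz by simp
  have \<phi>0: "\<phi> 0 \<noteq> 0" "order z (\<phi> 0) = m + 1"
    using e0 iterG[of 1] by (simp_all add: \<phi>_def order_smult)

  obtain d P R where d: "0 < d" "d \<le> p - 1" and P: "P \<noteq> 0" and R: "R \<noteq> 0"
    and PC: "fps_of_poly P * C ^ d = fps_of_poly R"
    and indep: "\<And>h i. (\<Sum>i<d. fps_of_poly (h i) * C ^ i) = 0 \<Longrightarrow> i < d \<Longrightarrow> h i = 0"
    using kummer_degree[OF Cnz _ Nnz NC card_roots_of_unity_char[OF p(1,2)]] p(3) by auto
  define n where "n = p - 1"
  have n: "p = n + 1" "n = 2 * m" using p(3) m by (simp_all add: n_def)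
  have "P ^ n * M ^ d = R ^ n * N ^ d"
  proof -
    have "fps_of_poly (P ^ n) * C ^ (d * n) = fps_of_poly (R ^ n)"
      using arg_cong[OF PC, of "\<lambda>x. x ^ n"] by (simp add: power_mult_distrib fps_of_poly_power power_mult)
    note PR = this
    have NM: "fps_of_poly (N ^ d) * C ^ (d * n) = fps_of_poly (M ^ d)"
      using arg_cong[OF NC, of "\<lambda>x. x ^ d"] unfolding n_def
      by (simp add: power_mult_distrib fps_of_poly_power power_mult mult.commute[of d])
    have "fps_of_poly (P ^ n * M ^ d) = fps_of_poly (P ^ n) * (fps_of_poly (N ^ d) * C ^ (d * n))"
      unfolding NM fps_of_poly_mult ..
    also have "\<dots> = (fps_of_poly (P ^ n) * C ^ (d * n)) * fps_of_poly (N ^ d)"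
      by (simp only: mult_ac)
    also have "\<dots> = fps_of_poly (R ^ n * N ^ d)"
      unfolding PR fps_of_poly_mult ..
    finally show ?thesis by (simp only: fps_of_poly_eq_iff)
  qed
  moreover have ord_pow: "order z (q ^ l) = l * order z q" if "q \<noteq> 0" for q :: "'k poly" and l
    by (induction l) (use that in \<open>simp_all add: order_mult\<close>)
  then have "order z (P ^ n * M ^ d) = n * order z P + d * 2" "order z (R ^ n * N ^ d) = n * order z R + d * (w + 2)"
    using P R Nnz Mnz ordM wN by (simp_all add: order_mult)
  ultimately have "n * order z P + d * 2 = n * order z R + d * (w + 2)"
    by simp
  then have nPR: "n * order z P = n * order z R + d * w" by (simp add: algebra_simps)
  have "n dvd d * w"
    using dvd_triv_left[of n "order z P"] unfolding nPR by (simp only: dvd_add_right_iff dvd_triv_left)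
  then have "n dvd d * s * p" unfolding s by (simp only: mult_ac)
  moreover have "coprime n p" unfolding n(1) by simp
  ultimately have "n dvd d * s"
    by (simp only: coprime_dvd_mult_left_iff)
  then obtain l where l: "d * s = n * l" by (elim dvdE)
  have npos: "0 < n" using p(3) by (simp add: n_def)
  have "d = n \<or> (s = 2 \<and> d = m)"
  proof -
    have "0 < l"
    proof (rule Nat.gr0I)
      assume "l = 0"
      with l have "d * s = 0" by simp
      with d s12 show False by auto
    qed
    show ?thesis
      using s12
    proof
      assume "s = 1"
      then have "d = n * l" using l by (simp only: mult_1_right)
      then have "n \<le> d" using \<open>0 < l\<close> by (simp only:) simp
      moreover have "d \<le> n" using d(2) by (simp only: n_def)
      ultimately show ?thesis by simp
    next
      assume "s = 2"
      have "d * 2 = (m * l) * 2"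
        using l unfolding \<open>s = 2\<close> n(2) by (simp only: mult_ac)
      then have "d = m * l" by simp
      moreover have "l = 1 \<or> 2 \<le> l" using \<open>0 < l\<close> by linarith
      moreover have "d = n" if "2 \<le> l" "d = m * l"
      proof -
        have "m * 2 \<le> m * l" by (rule mult_le_mono2[OF that(1)])
        then have "n \<le> d" unfolding n(2) that(2) by (simp only: mult.commute)
        moreover have "d \<le> n" using d(2) by (simp only: n_def)
        ultimately show ?thesis by simp
      qed
      ultimately show ?thesis using \<open>s = 2\<close> by auto
    qed
  qed
  then show False
  proof
    assume "d = n"
    have "(\<Sum>j<d. fps_of_poly (\<phi> j) * C ^ j) = 0"
      using rel' unfolding \<open>d = n\<close> n_def .
    from indep[OF this d(1)] \<phi>0(1) show False by contradiction
  next
    assume *: "s = 2 \<and> d = m"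
    then have s2: "s = 2" and dm: "d = m" by simp_all
    have "d * w = n * p"
      unfolding s dm s2 n(2) by (simp only: mult_ac)
    with nPR have "n * order z P = n * (order z R + p)"
      by (simp only: distrib_left)
    then have PR: "order z P = order z R + p" using npos by simp
    \<comment> \<open>reduce the relation to powers of \<open>C\<close> below \<open>m\<close> by means of \<open>P C\<^sup>m = R\<close>\<close>
    have "(\<Sum>j<m. fps_of_poly (P * \<phi> j + R * \<phi> (m + j)) * C ^ j)
        = (\<Sum>j<m. fps_of_poly P * (fps_of_poly (\<phi> j) * C ^ j)) + (\<Sum>j<m. fps_of_poly P * (fps_of_poly (\<phi> (m + j)) * C ^ (m + j)))"
      unfolding sum.distrib[symmetric]
    proof (rule sum.cong[OF refl])
      fix j
      have "fps_of_poly R = fps_of_poly P * C ^ m" using PC unfolding dm by (rule sym)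
      then show "fps_of_poly (P * \<phi> j + R * \<phi> (m + j)) * C ^ j
        = fps_of_poly P * (fps_of_poly (\<phi> j) * C ^ j) + fps_of_poly P * (fps_of_poly (\<phi> (m + j)) * C ^ (m + j))"
        by (simp add: fps_of_poly_add fps_of_poly_mult power_add algebra_simps)
    qed
    also have "\<dots> = fps_of_poly P * (\<Sum>j<m + m. fps_of_poly (\<phi> j) * C ^ j)"
      unfolding sum_lessThan_add distrib_left sum_distrib_left ..
    also have "\<dots> = 0" using rel' unfolding n_def[symmetric] n(2) mult_2 by simp
    finally have "P * \<phi> 0 + R * \<phi> (m + 0) = 0"
      using indep[of "\<lambda>j. P * \<phi> j + R * \<phi> (m + j)" 0] d(1) unfolding dm by blast
    then have eq: "P * \<phi> 0 = - (R * \<phi> m)" by (simp only: eq_neg_iff_add_eq_0 add_0_right)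
    have nz: "P * \<phi> 0 \<noteq> 0" using P \<phi>0 by simp
    then have \<phi>m: "\<phi> m \<noteq> 0" using eq by auto
    then have "e m \<noteq> 0" by (auto simp: \<phi>_def)
    then have "order z (\<phi> m) = order z ((D ^^ Suc m) G)" unfolding \<phi>_def by (rule order_smult)
    also have "\<dots> = p" using iterG[of "m + 1"] m by simp
    finally have om: "order z (\<phi> m) = p" .
    have "R * \<phi> m \<noteq> 0" using R \<phi>m by simp
    have "order z (P * \<phi> 0) = order z (R * \<phi> m)"
      unfolding eq by (rule order_uminus)
    then have "order z P + (m + 1) = order z R + p"
      unfolding order_mult[OF nz] order_mult[OF \<open>R * \<phi> m \<noteq> 0\<close>] \<phi>0(2) om .
    then show False unfolding PR by simp
  qed
qed

section \<open>Reduction modulo a prime\<close>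

definition fps_of_int_series :: "int fps \<Rightarrow> 'k :: comm_ring_1 fps" where
  "fps_of_int_series h = Abs_fps (\<lambda>n. of_int (fps_nth h n))"

lemma fps_of_int_series_hom:
  "fps_of_int_series (f + g) = fps_of_int_series f + (fps_of_int_series g :: 'k :: comm_ring_1 fps)"
  "fps_of_int_series (f - g) = fps_of_int_series f - (fps_of_int_series g :: 'k fps)"
  "fps_of_int_series (f * g) = fps_of_int_series f * (fps_of_int_series g :: 'k fps)"
  "fps_of_int_series (numeral m) = (numeral m :: 'k fps)"
  "fps_of_int_series (f ^ 2) = (fps_of_int_series f :: 'k fps) ^ 2"
  "fps_of_int_series (theta f) = theta (fps_of_int_series f :: 'k fps)"
  by (rule fps_ext; simp add: fps_of_int_series_def fps_mult_nth numeral_fps_const power2_eq_square)+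

lemma fps_of_int_series_nth [simp]: "fps_nth (fps_of_int_series h) n = of_int (fps_nth h n)"
  by (simp add: fps_of_int_series_def)

lemma theta_iterate_nth: "fps_nth ((theta ^^ k) h) n = of_nat n ^ k * fps_nth h n"
  by (induction k) (simp_all add: mult_ac)

lemma of_nat_power_char:
  assumes "CHAR('k :: comm_ring_1) = p" "prime p"
  shows "of_nat n ^ p = (of_nat n :: 'k)"
proof (cases "p dvd n")
  case True
  then have "of_nat n = (0 :: 'k)" using assms(1) by (simp only: of_nat_eq_0_iff_char_dvd)
  then show ?thesis using prime_gt_0_nat[OF assms(2)] by (simp add: power_0_left)
next
  case False
  have "Suc (p - 1) = p" using prime_gt_0_nat[OF assms(2)] by simp
  then have "of_nat n ^ p = (of_nat n * of_nat n ^ (p - 1) :: 'k)" by (metis power_Suc)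
  then show ?thesis using of_nat_fermat[OF assms False] by simp
qed

text \<open>
  The sum \<open>\<Sum> (n/a)\<^sup>j\<close> over \<open>1 \<le> j < p\<close> vanishes unless \<open>n \<equiv> a\<close>; so the operator on the left is, up to
  a factor, the projection to the exponents in the class of \<open>a\<close>.
\<close>

lemma theta_relation_of_congruence:
  fixes f :: "'k :: field fps"
  assumes p: "CHAR('k) = p" "prime p" and a: "0 < a" "a < p"
    and van: "\<And>n. n mod p = a \<Longrightarrow> fps_nth f n = 0"
  shows "(\<Sum>j<p - 1. fps_const (inverse (of_nat a) ^ Suc j) * (theta ^^ Suc j) f) = 0"
proof (rule fps_ext)
  fix n
  have a0: "of_nat a \<noteq> (0 :: 'k)"
    using a p(1) by (simp add: of_nat_eq_0_iff_char_dvd nat_dvd_not_less)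
  define y :: 'k where "y = of_nat n / of_nat a"
  have "fps_nth (\<Sum>j<p - 1. fps_const (inverse (of_nat a) ^ Suc j) * (theta ^^ Suc j) f) n
      = (\<Sum>j<p - 1. y ^ Suc j * fps_nth f n)"
    unfolding fps_sum_nth fps_mult_left_const_nth theta_iterate_nth
    by (simp only: y_def divide_inverse power_mult_distrib mult_ac)
  also have "\<dots> = y * fps_nth f n * (\<Sum>j<p - 1. y ^ j)"
    by (simp add: sum_distrib_left mult_ac)
  also have "\<dots> = 0"
  proof (cases "n mod p = a \<or> p dvd n")
    case True
    then show ?thesis
    proof
      assume "n mod p = a"
      then show ?thesis using van by simp
    next
      assume "p dvd n"
      then have "of_nat n = (0 :: 'k)" using p(1) by (simp only: of_nat_eq_0_iff_char_dvd)
      then show ?thesis by (simp add: y_def)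
    qed
  next
    case False
    have "y \<noteq> 1"
    proof
      assume "y = 1"
      then have "of_nat n = (of_nat a :: 'k)" using a0 by (simp add: y_def)
      then have "of_int (int n - int a) = (0 :: 'k)" by simp
      then have "int p dvd int n - int a" using p(1) by (simp only: of_int_eq_0_iff_char_dvd)
      then have "int n mod int p = int a mod int p" by (simp only: mod_eq_dvd_iff)
      then have "n mod p = a mod p" by (simp only: zmod_int[symmetric] of_nat_eq_iff)
      with a False show False by simp
    qed
    moreover have "y ^ (p - 1) = 1"
    proof -
      have "\<not> p dvd a" using a by (simp add: nat_dvd_not_less)
      then show ?thesis
        using of_nat_fermat[OF p, of n] of_nat_fermat[OF p, of a] False by (simp add: y_def power_divide)
    qed
    ultimately have "(\<Sum>j<p - 1. y ^ j) = 0"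
      by (simp add: geometric_sum)
    then show ?thesis by simp
  qed
  finally show "fps_nth (\<Sum>j<p - 1. fps_const (inverse (of_nat a) ^ Suc j) * (theta ^^ Suc j) f) n = fps_nth 0 n"
    by simp
qed

text \<open>
  The change of variable from \<open>q\<close> to \<open>x = W / V\<close>: composition with the inverse series of
  \<open>x(q)\<close> is a ring homomorphism that turns \<open>q d/dq\<close> into \<open>\<theta>(x) d/dx\<close>.
\<close>

lemma no_congruence_in_char:
  assumes p: "CHAR('k :: alg_closed_field) = p" "prime p" "5 \<le> p" and a: "0 < a" "a < p"
    and cong: "\<And>n. int p dvd tbar (p * n + a)"
  shows False
proof -
  define v w \<epsilon> f l :: "'k fps" where "v = fps_of_int_series eis_V" and "w = fps_of_int_series eis_W"
    and "\<epsilon> = fps_of_int_series dlog_V" and "f = fps_of_int_series tbar_gf" and "l = fps_of_int_series dlog_tbar"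
  note defs = v_def w_def \<epsilon>_def f_def l_def
  have tv: "theta v = v * \<epsilon>"
    using arg_cong[OF theta_eis_V, of fps_of_int_series] unfolding fps_of_int_series_hom defs .
  have tw: "theta w = w * (\<epsilon> + (v - w) * (v - 9 * w))"
    using arg_cong[OF theta_eis_W, of fps_of_int_series] unfolding fps_of_int_series_hom defs .
  have te: "theta \<epsilon> = \<epsilon> ^ 2 + 3 * w * (v - 3 * w) * ((v - w) * (v - 9 * w))"
    using arg_cong[OF theta_dlog_V, of fps_of_int_series] unfolding fps_of_int_series_hom defs .
  have le: "2 * l + \<epsilon> = 5 * (v * w) - 3 * w ^ 2"
    using arg_cong[OF dlog_tbar_eq, of fps_of_int_series] unfolding fps_of_int_series_hom defs .
  have tf: "theta f = f * l"
    using arg_cong[OF theta_tbar, of fps_of_int_series] unfolding fps_of_int_series_hom defs .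
  have v0: "fps_nth v 0 = 1" and w01: "fps_nth w 0 = 0" "fps_nth w 1 = 1"
    using eis_V_0 eis_W_0_1 by (simp_all add: defs)
  have f0: "fps_nth f 0 = 1"
    using tbar_0 by (simp add: defs tbar_def)
  have vnz: "v \<noteq> 0" using v0 by auto

  define \<xi> where "\<xi> = w * inverse v"
  have wX: "w = \<xi> * v"
    using v0 by (simp add: \<xi>_def mult.assoc inverse_mult_eq_1)
  have X0: "fps_nth \<xi> 0 = 0" using w01 by (simp add: \<xi>_def)
  have X1: "fps_nth \<xi> 1 \<noteq> 0"
  proof -
    have "fps_nth (\<xi> * v) 1 = fps_nth \<xi> 1" using X0 v0 by (simp add: fps_mult_nth)
    then show ?thesis using w01 unfolding wX[symmetric] by simp
  qed
  have tX: "theta \<xi> = \<xi> * (1 - \<xi>) * (1 - 9 * \<xi>) * v ^ 2"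
  proof -
    have "theta w = \<xi> * theta v + theta \<xi> * v" unfolding wX theta_mult ..
    then have "v * theta \<xi> = v * (\<xi> * ((v - w) * (v - 9 * w)))"
      unfolding tw tv unfolding wX by (simp add: algebra_simps)
    then have "theta \<xi> = \<xi> * ((v - w) * (v - 9 * w))" using vnz by simp
    then show ?thesis unfolding wX by (simp add: power2_eq_square algebra_simps)
  qed

  define Y where "Y = fps_inv \<xi>"
  have Y0: "fps_nth Y 0 = 0" by (simp add: Y_def fps_inv_def)
  have XY: "fps_compose \<xi> Y = fps_X" unfolding Y_def by (rule fps_inv_right[OF X0 X1])
  have YX: "fps_compose Y \<xi> = fps_X" unfolding Y_def by (rule fps_inv[OF X0 X1])
  define F g where "F = fps_compose v Y" and "g = fps_compose f Y"
  note comp = fps_compose_mult_distrib[OF Y0] fps_compose_add_distrib fps_compose_sub_distrib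
    fps_compose_power[OF Y0, symmetric]
  have comp_num: "fps_compose (numeral m) Y = (numeral m :: 'k fps)" for m
    unfolding numeral_fps_const by (rule fps_const_compose)
  have wF: "fps_compose w Y = fps_X * F" unfolding wX comp XY F_def ..
  define S where "S = (fps_of_poly sing_poly :: 'k fps)"
  define Q where "Q = fps_of_poly [:1, - 10, 9 :: 'k:]"
  have Qf: "Q = 1 - 10 * fps_X + 9 * fps_X ^ 2"
    by (simp add: Q_def fps_of_poly_pCons numeral_fps_const power2_eq_square algebra_simps flip: fps_const_neg)
  have SQ: "S = fps_X * Q"
    unfolding S_def sing_poly_fps Qf by (simp add: power2_eq_square power3_eq_cube algebra_simps)
  have Q_factor: "(1 - fps_X) * (1 - 9 * fps_X) = Q"
    unfolding Qf by (simp add: power2_eq_square algebra_simps)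
  have tXY: "fps_compose (theta \<xi>) Y = S * F ^ 2"
    unfolding tX comp XY F_def[symmetric] comp_num fps_compose_1 SQ Q_factor[symmetric] by (simp only: mult.assoc)
  define \<theta> where "\<theta> = (\<lambda>h. S * F ^ 2 * fps_deriv h)"
  have transport: "fps_compose (theta h) Y = \<theta> (fps_compose h Y)" for h
  proof -
    have h: "h = fps_compose (fps_compose h Y) \<xi>"
      using fps_compose_assoc[OF X0 Y0, of h] YX by simp
    have "fps_deriv h = fps_compose (fps_deriv (fps_compose h Y)) \<xi> * fps_deriv \<xi>"
      by (subst h) (rule fps_compose_deriv[OF X0])
    then have "theta h = fps_compose (fps_deriv (fps_compose h Y)) \<xi> * theta \<xi>"
      by (simp add: theta_def mult_ac)
    then have "fps_compose (theta h) Y = fps_compose (fps_compose (fps_deriv (fps_compose h Y)) \<xi>) Y * (S * F ^ 2)"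
      by (simp only: comp tXY)
    also have "fps_compose (fps_compose (fps_deriv (fps_compose h Y)) \<xi>) Y = fps_deriv (fps_compose h Y)"
      using fps_compose_assoc[OF Y0 X0, of "fps_deriv (fps_compose h Y)"] XY by simp
    finally show ?thesis by (simp add: \<theta>_def mult_ac)
  qed
  have transport_iterate: "fps_compose ((theta ^^ k) h) Y = (\<theta> ^^ k) (fps_compose h Y)" for k h
    by (induction k) (simp_all add: transport)

  have F0: "fps_nth F 0 = 1" and g0: "fps_nth g 0 = 1" using v0 f0 by (simp_all add: F_def g_def)
  have Fnz: "F \<noteq> 0" using F0 by auto
  have Qnz: "Q \<noteq> 0" by (simp add: Q_def)
  have Snz: "S \<noteq> 0" unfolding SQ using Qnz by simp
  define e where "e = fps_compose \<epsilon> Y"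
  have eF: "e = S * F * fps_deriv F"
  proof -
    have "\<theta> F = F * e" using arg_cong[OF tv, of "\<lambda>h. fps_compose h Y"] unfolding transport comp F_def e_def .
    then have "F * (S * F * fps_deriv F) = F * e"
      unfolding \<theta>_def power2_eq_square by (simp only: mult_ac)
    then show ?thesis using Fnz by simp
  qed
  have "\<theta> e = e ^ 2 + 3 * (fps_X * F) * (F - 3 * (fps_X * F)) * ((F - fps_X * F) * (F - 9 * (fps_X * F)))"
    using arg_cong[OF te, of "\<lambda>h. fps_compose h Y"]
    unfolding transport comp wF F_def[symmetric] e_def[symmetric] comp_num .
  also have "\<dots> = e ^ 2 + 3 * ((1 - 3 * fps_X) * (fps_X * ((1 - fps_X) * (1 - 9 * fps_X))) * F ^ 4)"
    by (simp add: power2_eq_square power4_eq_xxxx algebra_simps)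
  also have "\<dots> = e ^ 2 + 3 * ((1 - 3 * fps_X) * S * F ^ 4)"
    unfolding Q_factor SQ ..
  finally have "S * F ^ 2 * (fps_deriv S * F * fps_deriv F + S * fps_deriv F ^ 2 + S * F * fps_deriv (fps_deriv F))
      = S * F ^ 2 * (S * fps_deriv F ^ 2 + 3 * (1 - 3 * fps_X) * F ^ 2)"
    unfolding \<theta>_def eF by (simp add: power2_eq_square power4_eq_xxxx algebra_simps)
  then have "fps_deriv S * F * fps_deriv F + S * fps_deriv F ^ 2 + S * F * fps_deriv (fps_deriv F)
      = S * fps_deriv F ^ 2 + 3 * (1 - 3 * fps_X) * F ^ 2"
    using Snz Fnz by simp
  then have "F * (S * fps_deriv (fps_deriv F) + fps_deriv S * fps_deriv F + (9 * fps_X - 3) * F) = 0"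
    by (simp add: power2_eq_square algebra_simps)
  then have odeF: "ode_op F = 0"
    using Fnz unfolding ode_op_def S_def fps_of_poly_pderiv by simp

  have g_eq: "2 * Q * F * fps_deriv g = g * (fps_of_poly [:5, - 3:] * F - Q * fps_deriv F)"
  proof -
    have lin: "fps_of_poly [:5, - 3:] = 5 - 3 * (fps_X :: 'k fps)"
      by (simp add: fps_of_poly_pCons numeral_fps_const flip: fps_const_neg)
    have 1: "\<theta> g = g * fps_compose l Y"
      using arg_cong[OF tf, of "\<lambda>h. fps_compose h Y"] unfolding transport comp g_def .
    have 2: "2 * fps_compose l Y + e = 5 * (F * (fps_X * F)) - 3 * (fps_X * F) ^ 2"
      using arg_cong[OF le, of "\<lambda>h. fps_compose h Y"]
      unfolding comp wF F_def[symmetric] e_def[symmetric] comp_num .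
    have "2 * \<theta> g = g * (2 * fps_compose l Y)" unfolding 1 by (simp only: mult_ac)
    also have "2 * fps_compose l Y = 5 * (F * (fps_X * F)) - 3 * (fps_X * F) ^ 2 - e"
      using 2 by (simp add: eq_diff_eq)
    finally have "(fps_X * F) * (2 * Q * F * fps_deriv g) = (fps_X * F) * (g * (fps_of_poly [:5, - 3:] * F - Q * fps_deriv F))"
      unfolding \<theta>_def eF SQ lin by (simp add: power2_eq_square algebra_simps)
    then show ?thesis using Fnz by simp
  qed

  have frob: "(\<theta> ^^ p) fps_X = \<theta> fps_X"
  proof -
    have "(theta ^^ p) \<xi> = theta \<xi>"
      by (rule fps_ext) (simp add: theta_iterate_nth of_nat_power_char[OF p(1,2)])
    then have "(\<theta> ^^ p) (fps_compose \<xi> Y) = \<theta> (fps_compose \<xi> Y)"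
      using transport_iterate[of p \<xi>] transport[of \<xi>] by simp
    then show ?thesis unfolding XY .
  qed

  have "fps_nth f n = 0" if "n mod p = a" for n
  proof -
    have "n = p * (n div p) + a" using that mult_div_mod_eq[of p n] by simp
    then have "int p dvd tbar n" using cong[of "n div p"] by simp
    then have "of_int (tbar n) = (0 :: 'k)" using p(1) by (simp only: of_int_eq_0_iff_char_dvd)
    then show ?thesis by (simp add: defs tbar_def)
  qed
  from theta_relation_of_congruence[OF p(1,2) a this]
  have "(\<Sum>j<p - 1. fps_const (inverse (of_nat a) ^ Suc j) * (theta ^^ Suc j) f) = 0" .
  from arg_cong[OF this, of "\<lambda>h. fps_compose h Y"]
  have rel: "(\<Sum>j<p - 1. fps_const (inverse (of_nat a) ^ Suc j) * (\<theta> ^^ Suc j) g) = 0"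
    unfolding fps_compose_sum_distrib comp fps_const_compose transport_iterate g_def fps_compose_0 .
  have "inverse (of_nat a) ^ Suc 0 = (0 :: 'k)"
    using no_theta_relation[OF p F0 odeF g0 g_eq[unfolded Q_def] frob[unfolded \<theta>_def S_def]
        rel[unfolded \<theta>_def S_def]] .
  then have "of_nat a = (0 :: 'k)" by simp
  then have "p dvd a" using p(1) by (simp only: of_nat_eq_0_iff_char_dvd)
  then show False using a by (auto dest: dvd_imp_le)
qed

section \<open>All primes\<close>

text \<open>
  An algebraically closed field of characteristic \<open>p\<close> is a type, and types cannot depend on the
  variable \<open>p\<close>.  But they may depend on a constant: it is enough to refute one counterexample, chosen once and for all
  if there is any.  If there is none, then 5 is a harmless default.
\<close>

definition bad_prime :: nat where
  "bad_prime = (let bad = (\<lambda>l. prime l \<and> 5 \<le> l \<and> (\<exists>a. 0 < a \<and> a < l \<and> (\<forall>n. int l dvd tbar (l * n + a))))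
     in if \<exists>l. bad l then SOME l. bad l else 5)"

lemma bad_prime: "prime bad_prime" "5 \<le> bad_prime"
  and bad_prime_congruence: "prime l \<Longrightarrow> 5 \<le> l \<Longrightarrow> 0 < a \<Longrightarrow> a < l \<Longrightarrow> (\<And>n. int l dvd tbar (l * n + a))
    \<Longrightarrow> \<exists>a. 0 < a \<and> a < bad_prime \<and> (\<forall>n. int bad_prime dvd tbar (bad_prime * n + a))"
proof -
  define bad where "bad l \<longleftrightarrow> prime l \<and> 5 \<le> l \<and> (\<exists>a. 0 < a \<and> a < l \<and> (\<forall>n. int l dvd tbar (l * n + a)))" for l
  have eq: "bad_prime = (if \<exists>l. bad l then SOME l. bad l else 5)"
    unfolding bad_prime_def bad_def Let_def ..
  have some: "bad bad_prime" if "\<exists>l. bad l"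
    using someI_ex[OF that] that by (simp add: eq)
  have none: "bad_prime = 5" if "\<not> (\<exists>l. bad l)"
    using that by (simp add: eq)
  have "prime (5 :: nat)" by simp
  with some none show "prime bad_prime" "5 \<le> bad_prime"
    unfolding bad_def by (metis, metis order_refl)
  assume "prime l" "5 \<le> l" "0 < a" "a < l" "\<And>n. int l dvd tbar (l * n + a)"
  then have "bad l" unfolding bad_def by blast
  with some have "bad bad_prime" by blast
  then show "\<exists>a. 0 < a \<and> a < bad_prime \<and> (\<forall>n. int bad_prime dvd tbar (bad_prime * n + a))"
    unfolding bad_def by blast
qed

typedef bad_residue = "{..<bad_prime}"
  using bad_prime(2) by (intro exI[of _ 0]) simp

lemma card_bad_residue: "CARD(bad_residue) = bad_prime"
  using type_definition.card[OF type_definition_bad_residue] by simp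

instance bad_residue :: prime_card
  by standard (simp add: card_bad_residue bad_prime(1))

theorem no_congruence_ge_5:
  assumes "prime l" "5 \<le> l" "0 < a" "a < l"
  shows "\<exists>n. \<not> int l dvd tbar (l * n + a)"
proof (rule ccontr)
  assume "\<not> (\<exists>n. \<not> int l dvd tbar (l * n + a))"
  then obtain b where b: "0 < b" "b < bad_prime" "\<And>n. int bad_prime dvd tbar (bad_prime * n + b)"
    using bad_prime_congruence[OF assms] by blast
  have "CHAR(bad_residue mod_ring alg_closure) = bad_prime"
    by (simp add: semiring_char_mod_ring card_bad_residue)
  from no_congruence_in_char[OF this bad_prime b] show False .
qed

theorem theorem2:
  fixes l a :: nat
  assumes "prime l" and "a \<le> l - 1"
  shows "(\<forall>n. [tbar (l * n + a) = 0] (mod int l)) \<longleftrightarrow> (l, a) = (3, 2)"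
proof
  assume "(l, a) = (3, 2)"
  then show "\<forall>n. [tbar (l * n + a) = 0] (mod int l)"
    using three_dvd_tbar by (simp add: cong_0_iff)
next
  assume "\<forall>n. [tbar (l * n + a) = 0] (mod int l)"
  then have dvd: "int l dvd tbar (l * n + a)" for n
    by (simp add: cong_0_iff)
  have l2: "2 \<le> l" using assms(1) by (rule prime_ge_2_nat)
  have a01: "a \<noteq> 0 \<and> a \<noteq> 1"
  proof (rule ccontr)
    assume "\<not> (a \<noteq> 0 \<and> a \<noteq> 1)"
    then have "tbar a = 1" using tbar_0 tbar_1 by auto
    with dvd[of 0] have "int l dvd 1" by simp
    with l2 show False by simp
  qed
  have "\<not> 5 \<le> l"
  proof
    assume "5 \<le> l"
    moreover have "0 < a" "a < l" using a01 assms(2) l2 by auto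
    ultimately show False using no_congruence_ge_5[OF assms(1)] dvd by blast
  qed
  moreover have "a < l" "2 \<le> a" using a01 assms(2) l2 by auto
  moreover have "l \<noteq> 4"
  proof
    assume "l = 4"
    then have "prime (4 :: nat)" using assms(1) by simp
    then have "2 = (1 :: nat) \<or> 2 = (4 :: nat)" using prime_nat_iff[of 4] dvd_triv_left[of 2 "2 :: nat"] by auto
    then show False by simp
  qed
  ultimately show "(l, a) = (3, 2)" by simp
qed

end
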